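(* Let $F$ be a fabric of species $33_4$ whose strands are perfectly coloured by a thick striping. If lattice units of $F$ are chosen so that their corners fall at the centres of redundant blocks of the striping, then these lattice units compose the net of a perfectly coloured isonemal woven cube.
   Context: **Prefabrics.** The plane is divided into unit square cells $[i,i+1]\times[j,j+1]$, $i,j\in\mathbb{Z}$. Each column of cells is a vertical strand (a warp) and each row a horizontal strand (a weft). A prefabric specifies, for each cell, which of the two strands crossing there is on top (seen from the obverse side). All prefabrics are periodic. A prefabric falls apart if the set of strands can be partitioned into two nonempty sets $A,B$ such that wherever a strand of $A$ crosses a strand of $B$ the strand of $A$ is on top. A fabric is a prefabric that does not fall apart. **Symmetries.** A symmetry of a prefabric is a pair $(g,\varepsilon)$ where $g$ is an isometry of the plane mapping cells to cells and $\varepsilon\in\{e,\tau\}$ ($e$ = without reversal of sides, $\tau$ = reflection in the plane of the fabric, exchanging over and under), such that for every cell $c$ the strand on top at $c$ is carried by $g$ to the strand on top at $g(c)$ if $\varepsilon=e$, and to the strand underneath at $g(c)$ if $\varepsilon=\tau$. The symmetries form the symmetry group. **Species $33_4$ and lattice units.** A group is of type $33_4$ if it is generated by the quarter-turns ($90^\circ$ rotations) without $\tau$ about two points $c$ and $d$, where $c,d$ are corners of cells and $d-c=(2a,2b)$ with $a,b$ coprime integers of opposite parity. Its translation lattice $\Lambda$ is the square lattice generated by $(2(a-b),2(a+b))$ and $(-2(a+b),2(a-b))$, and its quarter-turn centres are the points of $c+\Lambda$ and $d+\Lambda$. A fabric is of species $33_4$ if its (full) symmetry group is of type $33_4$. A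 lattice unit is a square, with sides the two generating vectors just given, whose corners are points of one of the two families $c+\Lambda$, $d+\Lambda$ of quarter-turn centres and whose centre is then in the other family; the plane is tiled by the lattice units with corners in a given family. **Thick striping.** A thick striping colours the warps dark and pale alternately in adjacent pairs (dark, dark, pale, pale, ...), and likewise the wefts. The plane is thereby divided into $2\times2$ blocks of cells, in each of which two equally coloured adjacent warps cross two equally coloured adjacent wefts. A block is redundant if its warps and wefts have the same colour, irredundant otherwise; the two kinds of block form a checkerboard. The strand colouring is perfect if every symmetry of the fabric, acting on the strands, either preserves the colour of every strand or reverses the colour of every strand. **Woven cubes.** Six lattice units from the tiling of the plane by lattice units, arranged as a net of a cube, compose the net of a woven cube: the net (with its woven, coloured strands, obverse side outward) is folded into a cube, whose faces are the six lattice units, and edges are joined so that strands continue across joined edges; strands thus become closed bands on the surface of the cube. The woven cube is isonemal if its six faces are woven in the same way, such that the rotations of the cube about its 4-fold, 3-fold and 2-fold axes are (as symmetries of the weaving) collectively transitive on the strands of the cube, and there are no centres of symmetry in the net other than the quarter-turns at the centres and corners of faces and the half-turns at the middles of their sides. A perfectly coloured isonemal woven cube is a cube woven isonemally with its strands so coloured that each rotational symmetry of the cube preserves or permutes the (two) colours showing in the cells, the colour showing in a cell being that of the strand on top (outermost) there. *)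

theory Defs
  imports "HOL-Analysis.Analysis" "HOL-Algebra.Generated_Groups"
begin

text \<open>
  The plane of the weaving is the type of complex numbers, so that the quarter-turn about \<open>c\<close>
  is \<open>z \<mapsto> c + \<i> * (z - c)\<close>.  The obverse side of the plane is the one from which the
  directions \<open>1\<close> and \<open>\<i>\<close> appear counterclockwise.
\<close>

section \<open>Prefabrics and fabrics\<close>

datatype strand = Warp int | Weft int

fun strip :: "strand \<Rightarrow> complex set" where
  "strip (Warp i) = {z. of_int i \<le> Re z \<and> Re z \<le> of_int (i + 1)}"
| "strip (Weft j) = {z. of_int j \<le> Im z \<and> Im z \<le> of_int (j + 1)}"

definition cell :: "int \<Rightarrow> int \<Rightarrow> complex set" where
  "cell i j = strip (Warp i) \<inter> strip (Weft j)"

text \<open>\<open>F i j\<close> says that, seen from the obverse side, the warp is on top at \<open>cell i j\<close>.\<close>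

type_synonym weave = "int \<Rightarrow> int \<Rightarrow> bool"

definition top_strand :: "weave \<Rightarrow> int \<Rightarrow> int \<Rightarrow> strand" where
  "top_strand F i j = (if F i j then Warp i else Weft j)"

definition bottom_strand :: "weave \<Rightarrow> int \<Rightarrow> int \<Rightarrow> strand" where
  "bottom_strand F i j = (if F i j then Weft j else Warp i)"

definition prefabric :: "weave \<Rightarrow> bool" where
  "prefabric F \<longleftrightarrow>
     (\<exists>p1 p2 q1 q2. p1 * q2 \<noteq> p2 * q1 \<and>
        (\<forall>i j. F (i + p1) (j + p2) = F i j \<and> F (i + q1) (j + q2) = F i j))"

definition falls_apart :: "weave \<Rightarrow> bool" where
  "falls_apart F \<longleftrightarrow>
     (\<exists>A B. A \<noteq> {} \<and> B \<noteq> {} \<and> A \<inter> B = {} \<and> A \<union> B = UNIV \<and>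
        (\<forall>i j. (Warp i \<in> A \<and> Weft j \<in> B \<longrightarrow> top_strand F i j = Warp i) \<and>
               (Weft j \<in> A \<and> Warp i \<in> B \<longrightarrow> top_strand F i j = Weft j)))"

definition fabric :: "weave \<Rightarrow> bool" where
  "fabric F \<longleftrightarrow> prefabric F \<and> \<not> falls_apart F"

section \<open>Symmetries and species\<close>

text \<open>
  Pairs of an isometry of the plane and a side-reversal flag, \<open>True\<close> standing for the
  reflection \<open>\<tau>\<close> in the plane of the fabric.
\<close>

definition isometry_group :: "((complex \<Rightarrow> complex) \<times> bool) monoid" where
  "isometry_group =
     \<lparr>carrier = {(g, e). bij g \<and> (\<forall>x y. dist (g x) (g y) = dist x y)},
      mult = (\<lambda>(g, e) (h, f). (g \<circ> h, e \<noteq> f)),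
      one = (id, False)\<rparr>"

definition symmetry_group :: "weave \<Rightarrow> ((complex \<Rightarrow> complex) \<times> bool) set" where
  "symmetry_group F =
     {(g, e). (g, e) \<in> carrier isometry_group \<and>
        (\<forall>i j. \<exists>i' j'. g ` cell i j = cell i' j' \<and>
           g ` strip (top_strand F i j) =
             strip (if e then bottom_strand F i' j' else top_strand F i' j'))}"

definition rotation_about :: "complex \<Rightarrow> complex \<Rightarrow> complex \<Rightarrow> complex" where
  "rotation_about x w z = x + w * (z - x)"

definition group_33_4 :: "complex \<Rightarrow> complex \<Rightarrow> ((complex \<Rightarrow> complex) \<times> bool) set" where
  "group_33_4 c d =
     generate isometry_group {(rotation_about c \<i>, False), (rotation_about d \<i>, False)}"

text \<open>The centres \<open>c\<close>, \<open>d\<close> and the integers \<open>a\<close>, \<open>b\<close> are not determined by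
  \<open>F\<close>; they are kept as arguments because the lattice units refer to them.\<close>

definition species_33_4 :: "weave \<Rightarrow> complex \<Rightarrow> complex \<Rightarrow> int \<Rightarrow> int \<Rightarrow> bool" where
  "species_33_4 F c d a b \<longleftrightarrow>
     fabric F \<and>
     Re c \<in> \<int> \<and> Im c \<in> \<int> \<and> Re d \<in> \<int> \<and> Im d \<in> \<int> \<and>
     d - c = Complex (of_int (2 * a)) (of_int (2 * b)) \<and>
     coprime a b \<and> odd (a + b) \<and>
     symmetry_group F = group_33_4 c d"

definition lattice_gen1 :: "int \<Rightarrow> int \<Rightarrow> complex" where
  "lattice_gen1 a b = Complex (of_int (2 * (a - b))) (of_int (2 * (a + b)))"

definition lattice_gen2 :: "int \<Rightarrow> int \<Rightarrow> complex" where
  "lattice_gen2 a b = Complex (of_int (- 2 * (a + b))) (of_int (2 * (a - b)))"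

text \<open>The translate \<open>k + \<Lambda>\<close> of the translation lattice.\<close>

definition lattice_coset :: "int \<Rightarrow> int \<Rightarrow> complex \<Rightarrow> complex set" where
  "lattice_coset a b k =
     {k + of_int m * lattice_gen1 a b + of_int n * lattice_gen2 a b | m n. True}"

section \<open>Thick striping\<close>

datatype colour = Dark | Pale

definition thick_striping :: "(strand \<Rightarrow> colour) \<Rightarrow> bool" where
  "thick_striping \<kappa> \<longleftrightarrow>
     (\<exists>p q. (\<forall>i. \<kappa> (Warp i) = (if even ((i - p) div 2) then Dark else Pale)) \<and>
            (\<forall>j. \<kappa> (Weft j) = (if even ((j - q) div 2) then Dark else Pale)))"

text \<open>In a thick striping two adjacent parallel strands of the same colour form one of the pairs
  of the striping, so the first two equations locate a block.\<close>

definition redundant_block_centre :: "(strand \<Rightarrow> colour) \<Rightarrow> complex \<Rightarrow> bool" where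
  "redundant_block_centre \<kappa> x \<longleftrightarrow>
     (\<exists>i j. x = Complex (of_int (i + 1)) (of_int (j + 1)) \<and>
        \<kappa> (Warp i) = \<kappa> (Warp (i + 1)) \<and> \<kappa> (Weft j) = \<kappa> (Weft (j + 1)) \<and>
        \<kappa> (Warp i) = \<kappa> (Weft j))"

definition perfect_colouring :: "weave \<Rightarrow> (strand \<Rightarrow> colour) \<Rightarrow> bool" where
  "perfect_colouring F \<kappa> \<longleftrightarrow>
     (\<forall>(g, e) \<in> symmetry_group F.
        (\<forall>t t'. g ` strip t = strip t' \<longrightarrow> \<kappa> t' = \<kappa> t) \<or>
        (\<forall>t t'. g ` strip t = strip t' \<longrightarrow> \<kappa> t' \<noteq> \<kappa> t))"

section \<open>Nets of the cube\<close>

text \<open>The square with first corner \<open>s\<close> and first side vector \<open>u\<close>, described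
  counterclockwise.  Note that \<open>lattice_gen2 a b = \<i> * lattice_gen1 a b\<close>.\<close>

definition corners :: "complex \<Rightarrow> complex \<Rightarrow> complex set" where
  "corners u s = {s, s + u, s + u + \<i> * u, s + \<i> * u}"

definition square :: "complex \<Rightarrow> complex \<Rightarrow> complex set" where
  "square u s = convex hull corners u s"

definition centre :: "complex \<Rightarrow> complex \<Rightarrow> complex" where
  "centre u s = midpoint s (s + u + \<i> * u)"

definition side_midpoints :: "complex \<Rightarrow> complex \<Rightarrow> complex set" where
  "side_midpoints u s =
     {midpoint s (s + u), midpoint (s + u) (s + u + \<i> * u),
      midpoint (s + u + \<i> * u) (s + \<i> * u), midpoint (s + \<i> * u) s}"

definition meet_along_side :: "'a::real_vector set \<Rightarrow> 'a set \<Rightarrow> bool" where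
  "meet_along_side S T \<longleftrightarrow> (\<exists>p q. p \<noteq> q \<and> S \<inter> T = closed_segment p q)"

definition cube :: "real \<Rightarrow> (real^3) set" where
  "cube l = {x. \<forall>i. \<bar>x $ i\<bar> \<le> l / 2}"

definition cube_faces :: "real \<Rightarrow> (real^3) set set" where
  "cube_faces l = {{x \<in> cube l. x $ i = h} | i h. h = l / 2 \<or> h = - l / 2}"

definition cube_rotation :: "real \<Rightarrow> real^3^3 \<Rightarrow> bool" where
  "cube_rotation l R \<longleftrightarrow> rotation_matrix R \<and> (\<lambda>x. R *v x) ` cube l = cube l"

text \<open>
  A net consists of squares with common side vector \<open>side_vec X\<close>, each given by its first
  corner in \<open>squares X\<close>; folding it up moves the square with first corner \<open>s\<close> into space by
  \<open>fold_map X s\<close> (given on the whole plane of that square).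
\<close>

record net =
  side_vec :: complex
  squares :: "complex set"
  fold_map :: "complex \<Rightarrow> complex \<Rightarrow> real^3"

abbreviation flat :: "net \<Rightarrow> complex \<Rightarrow> complex set" where
  "flat X s \<equiv> square (side_vec X) s"

definition face :: "net \<Rightarrow> complex \<Rightarrow> (real^3) set" where
  "face X s = fold_map X s ` flat X s"

text \<open>
  The squares form an edge-connected arrangement that is folded rigidly, along the sides shared
  by its squares, onto the six faces of a cube, each face being covered by one square, with the
  obverse side outward.  The cross product is the image of the obverse normal; the cube is
  centred at the origin.
\<close>

definition cube_net :: "net \<Rightarrow> bool" where
  "cube_net X \<longleftrightarrow>
     (\<forall>s \<in> squares X. \<forall>s' \<in> squares X.
        (s, s') \<in> {(p, q). p \<in> squares X \<and> q \<in> squares X \<and>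
                      meet_along_side (flat X p) (flat X q)}\<^sup>*) \<and>
     (\<forall>s \<in> squares X. \<forall>x y. dist (fold_map X s x) (fold_map X s y) = dist x y) \<and>
     (\<forall>s \<in> squares X.
        cross3 (fold_map X s 1 - fold_map X s 0) (fold_map X s \<i> - fold_map X s 0)
          \<bullet> fold_map X s (centre (side_vec X) s) > 0) \<and>
     (\<forall>s \<in> squares X. \<forall>s' \<in> squares X. meet_along_side (flat X s) (flat X s') \<longrightarrow>
        (\<forall>x \<in> flat X s \<inter> flat X s'. fold_map X s x = fold_map X s' x)) \<and>
     bij_betw (face X) (squares X) (cube_faces (norm (side_vec X)))"

text \<open>A net of a cube composed of lattice units with corners in the family \<open>k + \<Lambda>\<close>.\<close>

definition lattice_unit_net :: "int \<Rightarrow> int \<Rightarrow> complex \<Rightarrow> net \<Rightarrow> bool" where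
  "lattice_unit_net a b k X \<longleftrightarrow>
     side_vec X = lattice_gen1 a b \<and> squares X \<subseteq> lattice_coset a b k \<and> cube_net X"

section \<open>Woven cubes\<close>

definition direct_isometry :: "(complex \<Rightarrow> complex) \<Rightarrow> bool" where
  "direct_isometry g \<longleftrightarrow> (\<exists>w t. norm w = 1 \<and> g = (\<lambda>z. w * z + t))"

text \<open>
  The faces from \<open>s\<close> and \<open>s'\<close> share an edge of the cube, and \<open>g\<close> is the isometry that unfolds
  the second face about this edge into the plane of the first: \<open>g\<close> brings the side
  of \<open>flat X s'\<close> glued to that edge onto the corresponding side of \<open>flat X s\<close>.
  Then \<open>flat X s \<inter> g ` flat X s'\<close> is the joined edge, seen in the plane of \<open>s\<close>.
\<close>

definition joined :: "net \<Rightarrow> complex \<Rightarrow> complex \<Rightarrow> (complex \<Rightarrow> complex) \<Rightarrow> bool" where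
  "joined X s s' g \<longleftrightarrow>
     s \<in> squares X \<and> s' \<in> squares X \<and> meet_along_side (face X s) (face X s') \<and>
     direct_isometry g \<and>
     (\<forall>x \<in> flat X s'. fold_map X s' x \<in> face X s \<longrightarrow> fold_map X s (g x) = fold_map X s' x)"

text \<open>Every strand cut by a joined edge continues straight across it as a strand, and every cell
  cut by a joined edge is completed to a cell woven in the same way on both sides.\<close>

definition woven_cube :: "weave \<Rightarrow> net \<Rightarrow> bool" where
  "woven_cube F X \<longleftrightarrow> cube_net X \<and>
     (\<forall>s s' g. joined X s s' g \<longrightarrow>
        (\<forall>t. interior (strip t) \<inter> flat X s \<inter> g ` flat X s' \<noteq> {} \<longrightarrow>
           (\<exists>t'. g ` strip t' = strip t)) \<and>
        (\<forall>i j. interior (cell i j) \<inter> flat X s \<inter> g ` flat X s' \<noteq> {} \<longrightarrow>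
           (\<exists>i' j'. g ` cell i' j' = cell i j \<and>
              g ` strip (top_strand F i' j') = strip (top_strand F i j))))"

text \<open>
  A piece \<open>(s, t)\<close> is the part of the strand \<open>t\<close> of the plane lying in the square \<open>s\<close>.
  A strand of the cube is a class of pieces linked by continuation across edges.
\<close>

definition pieces :: "net \<Rightarrow> (complex \<times> strand) set" where
  "pieces X = {(s, t). s \<in> squares X \<and> strip t \<inter> interior (flat X s) \<noteq> {}}"

definition continuation :: "net \<Rightarrow> ((complex \<times> strand) \<times> (complex \<times> strand)) set" where
  "continuation X =
     {((s, t), (s', t')). \<exists>g. joined X s s' g \<and>
        interior (strip t) \<inter> flat X s \<inter> g ` flat X s' \<noteq> {} \<and> g ` strip t' = strip t}"

definition cube_strands :: "net \<Rightarrow> (complex \<times> strand) set set" where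
  "cube_strands X = pieces X // (continuation X \<union> (continuation X)\<inverse>)\<^sup>*"

text \<open>The rotation \<open>R\<close> carries the part in the square \<open>s\<close> of a plane figure \<open>A\<close> to the part
  in the square \<open>s'\<close> of a plane figure \<open>A'\<close>, once the squares are in place on the cube.\<close>

definition carries ::
  "net \<Rightarrow> real^3^3 \<Rightarrow> complex \<Rightarrow> complex set \<Rightarrow> complex \<Rightarrow> complex set \<Rightarrow> bool" where
  "carries X R s A s' A' \<longleftrightarrow>
     s \<in> squares X \<and> s' \<in> squares X \<and>
     (\<lambda>x. R *v x) ` face X s = face X s' \<and>
     (\<lambda>x. R *v x) ` fold_map X s ` (A \<inter> flat X s) = fold_map X s' ` (A' \<inter> flat X s')"

definition cell_shows :: "net \<Rightarrow> complex \<Rightarrow> int \<Rightarrow> int \<Rightarrow> bool" where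
  "cell_shows X s i j \<longleftrightarrow> s \<in> squares X \<and> cell i j \<inter> interior (flat X s) \<noteq> {}"

definition weaving_symmetry :: "weave \<Rightarrow> net \<Rightarrow> real^3^3 \<Rightarrow> bool" where
  "weaving_symmetry F X R \<longleftrightarrow>
     (\<forall>s i j. cell_shows X s i j \<longrightarrow>
        (\<exists>s' i' j'. carries X R s (cell i j) s' (cell i' j') \<and>
           carries X R s (strip (top_strand F i j)) s' (strip (top_strand F i' j'))))"

definition faces_woven_alike :: "weave \<Rightarrow> net \<Rightarrow> bool" where
  "faces_woven_alike F X \<longleftrightarrow>
     (\<forall>s \<in> squares X. \<forall>s' \<in> squares X. \<exists>g. direct_isometry g \<and> g ` flat X s = flat X s' \<and>
        (\<forall>i j. cell_shows X s i j \<longrightarrow>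
           (\<exists>i' j'. g ` cell i j = cell i' j' \<and>
              g ` strip (top_strand F i j) = strip (top_strand F i' j'))))"

definition rotations_transitive_on_strands :: "net \<Rightarrow> bool" where
  "rotations_transitive_on_strands X \<longleftrightarrow>
     (\<forall>A \<in> cube_strands X. \<forall>B \<in> cube_strands X. \<exists>R.
        cube_rotation (norm (side_vec X)) R \<and>
        (\<forall>(s, t) \<in> A. \<exists>(s', t') \<in> B. carries X R s (strip t) s' (strip t')) \<and>
        (\<forall>(s', t') \<in> B. \<exists>(s, t) \<in> A. carries X R s (strip t) s' (strip t')))"

text \<open>The nontrivial rotational symmetries (with or without reversal of sides) of the fabric with
  centre in the net are the quarter-turns, and their powers, at corners and centres of faces
  and the half-turns at middles of sides, all without reversal.\<close>

definition only_expected_centres :: "weave \<Rightarrow> net \<Rightarrow> bool" where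
  "only_expected_centres F X \<longleftrightarrow>
     (\<forall>x \<in> (\<Union>s \<in> squares X. flat X s). \<forall>w e. norm w = 1 \<and> w \<noteq> 1 \<longrightarrow>
        ((rotation_about x w, e) \<in> symmetry_group F \<longleftrightarrow>
           \<not> e \<and>
           (\<exists>s \<in> squares X.
              (x = centre (side_vec X) s \<or> x \<in> corners (side_vec X) s) \<and> w ^ 4 = 1 \<or>
              x \<in> side_midpoints (side_vec X) s \<and> w = - 1)))"

definition isonemal_woven_cube :: "weave \<Rightarrow> net \<Rightarrow> bool" where
  "isonemal_woven_cube F X \<longleftrightarrow>
     woven_cube F X \<and>
     faces_woven_alike F X \<and>
     (\<forall>R. cube_rotation (norm (side_vec X)) R \<longrightarrow> weaving_symmetry F X R) \<and>
     rotations_transitive_on_strands X \<and>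
     only_expected_centres F X"

text \<open>The first condition says that the colouring of the strands of the net is a colouring of the
  strands of the cube.\<close>

definition perfectly_coloured_isonemal_woven_cube ::
  "weave \<Rightarrow> (strand \<Rightarrow> colour) \<Rightarrow> net \<Rightarrow> bool" where
  "perfectly_coloured_isonemal_woven_cube F \<kappa> X \<longleftrightarrow>
     isonemal_woven_cube F X \<and>
     (\<forall>((s, t), (s', t')) \<in> continuation X. \<kappa> t' = \<kappa> t) \<and>
     (\<forall>R. cube_rotation (norm (side_vec X)) R \<longrightarrow>
        (\<forall>s i j s' i' j'. cell_shows X s i j \<and> carries X R s (cell i j) s' (cell i' j') \<longrightarrow>
           \<kappa> (top_strand F i' j') = \<kappa> (top_strand F i j)) \<or>
        (\<forall>s i j s' i' j'. cell_shows X s i j \<and> carries X R s (cell i j) s' (cell i' j') \<longrightarrow>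
           \<kappa> (top_strand F i' j') \<noteq> \<kappa> (top_strand F i j)))"

end

(*
  Identify the symmetry group of F with the orientation-preserving motions of the plane that
  preserve k + Lambda.  Folding a net makes each lattice unit a face of the cube, and comparing
  faces by rotations of the cube, or by unfolding across a joined edge, always gives such a motion
  of the plane.  Hence the weaving fits together and admits every rotation of the cube.

  For the colours, the redundant blocks at the corners of the lattice units are alternately dark
  and pale along the sides of the units, and the vertices of the cube are likewise divided
  into two classes alternating along the edges.  As the net is connected, either all corners match
  the classes or all are opposite to them; so a motion coming from a rotation of the cube preserves
  the colours exactly when the rotation preserves the two classes of vertices, and continuation across an
  edge, which fixes the common vertices, preserves them.

  Transitivity on strands: the group is transitive on the strands of the plane, and rolling
  the cube along a strand of the plane traces out one strand of the cube.
*)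

theory Submission
  imports Defs
begin

section \<open>Gaussian integers and lattice squares\<close>

text \<open>A fold map is only assumed to be an isometry onto a face, and the \<open>g\<close> of
  \<open>joined\<close> only a direct isometry that is right on one edge; the main work is to make
  both discrete. In the coordinate \<open>(x - centre u s) / u\<close> every lattice square becomes
  the box \<open>half_box\<close>, and lengths force corners onto vertices; so a fold map is a
  standard placement on the upper face followed by an integer rotation matrix, the frame of the
  square. Frames with equal outward normals differ by a turn about that normal, which in the plane
  is multiplication by a Gaussian unit. For \<open>g\<close> the unit is found as a ratio of side
  vectors. Rolling needs places outside the net: the neighbour across a side may be missing there,
  although its face is covered by another square. The cube is therefore followed over the whole
  tiling, recording which face lies on each square. Oddness of \<open>a + b\<close> serves both
  halves of the argument: with coprimality it makes the lattice translations fine enough to reach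
  all strands, and it makes each side of a unit shift the striping by an odd number of
  pairs.\<close>

definition gauss_ints :: "complex set" where
  "gauss_ints = {z. Re z \<in> \<int> \<and> Im z \<in> \<int>}"

definition fourth_roots :: "complex set" where
  "fourth_roots = {1, \<i>, - 1, - \<i>}"

lemma gauss_ints_simps [simp, intro]:
  "0 \<in> gauss_ints" "1 \<in> gauss_ints" "\<i> \<in> gauss_ints"
  "x \<in> gauss_ints \<Longrightarrow> y \<in> gauss_ints \<Longrightarrow> x + y \<in> gauss_ints"
  "x \<in> gauss_ints \<Longrightarrow> y \<in> gauss_ints \<Longrightarrow> x - y \<in> gauss_ints"
  "x \<in> gauss_ints \<Longrightarrow> y \<in> gauss_ints \<Longrightarrow> x * y \<in> gauss_ints"
  "x \<in> gauss_ints \<Longrightarrow> - x \<in> gauss_ints"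
  "of_int m \<in> gauss_ints"
  by (auto simp: gauss_ints_def)

lemma gauss_intsE:
  assumes "z \<in> gauss_ints"
  obtains m n where "z = of_int m + of_int n * \<i>"
  using assms by (auto simp: gauss_ints_def complex_eq_iff elim!: Ints_cases)

lemma fourth_roots_gauss: "w \<in> fourth_roots \<Longrightarrow> w \<in> gauss_ints"
  by (auto simp: fourth_roots_def)

lemma fourth_roots_mult: "w \<in> fourth_roots \<Longrightarrow> v \<in> fourth_roots \<Longrightarrow> w * v \<in> fourth_roots"
  by (auto simp: fourth_roots_def)

lemma fourth_roots_1 [simp]: "1 \<in> fourth_roots"
  by (simp add: fourth_roots_def)

lemma fourth_roots_inverse: "w \<in> fourth_roots \<Longrightarrow> inverse w \<in> fourth_roots"
  by (auto simp: fourth_roots_def)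

lemma fourth_roots_cnj: "w \<in> fourth_roots \<Longrightarrow> cnj w \<in> fourth_roots"
  by (auto simp: fourth_roots_def)

lemma fourth_roots_norm: "w \<in> fourth_roots \<Longrightarrow> norm w = 1"
  by (auto simp: fourth_roots_def)

lemma fourth_roots_nonzero: "w \<in> fourth_roots \<Longrightarrow> w \<noteq> 0"
  by (auto simp: fourth_roots_def)

lemma fourth_roots_iff: "w \<in> fourth_roots \<longleftrightarrow> w ^ 4 = 1"
proof
  assume "w ^ 4 = 1"
  then have "(w - 1) * (w + 1) * ((w - \<i>) * (w + \<i>)) = 0"
    by (simp add: algebra_simps power4_eq_xxxx)
  then show "w \<in> fourth_roots"
    by (auto simp: fourth_roots_def eq_neg_iff_add_eq_0)
qed (auto simp: fourth_roots_def)

lemma Ints_sum_squares_1: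
  assumes "x \<in> \<int>" "y \<in> \<int>" "x\<^sup>2 + y\<^sup>2 = (1::real)"
  shows "(x = 0 \<and> (y = 1 \<or> y = -1)) \<or> (y = 0 \<and> (x = 1 \<or> x = -1))"
proof -
  obtain m n :: int where m: "x = of_int m" and n: "y = of_int n"
    using assms by (auto elim!: Ints_cases)
  have "(of_int (m\<^sup>2 + n\<^sup>2) :: real) = of_int 1"
    using assms m n by simp
  then have 1: "m\<^sup>2 + n\<^sup>2 = 1" unfolding of_int_eq_iff .
  have "\<bar>m\<bar> \<le> 1"
  proof (rule ccontr)
    assume "\<not> \<bar>m\<bar> \<le> 1"
    then have "2 ^ 2 \<le> \<bar>m\<bar>\<^sup>2" by (intro power_mono) auto
    then have "4 \<le> m\<^sup>2" by simp
    moreover have "n\<^sup>2 \<ge> 0" by simp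
    ultimately show False using 1 by linarith
  qed
  then have "m = -1 \<or> m = 0 \<or> m = 1" by linarith
  then show ?thesis using 1 m n by (auto simp: power2_eq_1_iff)
qed

text \<open>The equation \<open>x^2 + y^2 = 1\<close> has only four integer solutions. This is what
  makes discrete the a priori unknown rotation part of an unfolding and of a rotation fixing a
  face.\<close>

lemma fourth_rootsI:
  assumes "w \<in> gauss_ints" "norm w = 1"
  shows "w \<in> fourth_roots"
proof -
  have "(Re w)\<^sup>2 + (Im w)\<^sup>2 = 1"
    using assms(2) by (simp add: cmod_def)
  from Ints_sum_squares_1[OF _ _ this] assms(1) show ?thesis
    by (auto simp: fourth_roots_def gauss_ints_def complex_eq_iff)
qed

section \<open>Lattice squares in normalised coordinates\<close>

definition half_box :: "complex set" where
  "half_box = {z. \<bar>Re z\<bar> \<le> 1 / 2 \<and> \<bar>Im z\<bar> \<le> 1 / 2}"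

definition box_corners :: "complex set" where
  "box_corners = {z. \<bar>Re z\<bar> = 1 / 2 \<and> \<bar>Im z\<bar> = 1 / 2}"

lemma half_box_rotate: "w \<in> fourth_roots \<Longrightarrow> w * z \<in> half_box \<longleftrightarrow> z \<in> half_box"
  by (auto simp: fourth_roots_def half_box_def)

lemma box_corners_rotate: "w \<in> fourth_roots \<Longrightarrow> w * z \<in> box_corners \<longleftrightarrow> z \<in> box_corners"
  by (auto simp: fourth_roots_def box_corners_def)

lemma box_corners_half_box: "z \<in> box_corners \<Longrightarrow> z \<in> half_box"
  by (auto simp: half_box_def box_corners_def)

lemma centre_eq: "centre u s = s + u * (1 + \<i>) / 2"
  by (simp add: centre_def midpoint_def algebra_simps scaleR_conv_of_real)

lemma mem_corners:
  assumes "u \<noteq> 0"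
  shows "x \<in> corners u s \<longleftrightarrow> (x - centre u s) / u \<in> box_corners"
proof -
  define y where "y = (x - centre u s) / u"
  have x: "x = s + u * (y + (1 + \<i>) / 2)"
    using assms by (simp add: y_def centre_eq field_simps)
  have "corners u s = (\<lambda>z. s + u * z) ` {0, 1, 1 + \<i>, \<i>}"
    by (simp add: corners_def algebra_simps)
  moreover have "inj (\<lambda>z. s + u * z)"
    using assms by (simp add: inj_def)
  ultimately have "x \<in> corners u s \<longleftrightarrow> y + (1 + \<i>) / 2 \<in> {0, 1, 1 + \<i>, \<i>}"
    unfolding x using inj_image_mem_iff[of "\<lambda>z. s + u * z"] by (simp only:)
  also have "\<dots> \<longleftrightarrow> y \<in> box_corners"
    by (auto simp: box_corners_def complex_eq_iff)
  finally show ?thesis by (simp add: y_def)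
qed

text \<open>The coordinate \<open>(x - centre u s) / u\<close> sends every square with side
  \<open>u\<close> to one box. As the box is centred at 0, it is invariant under multiplication by
  Gaussian units, which is how the quarter-turns of a square act.\<close>

lemma mem_square:
  assumes "u \<noteq> 0"
  shows "x \<in> square u s \<longleftrightarrow> (x - centre u s) / u \<in> half_box"
proof -
  have "square u s = (\<lambda>y. centre u s + u * y) ` half_box"
  proof (rule subset_antisym)
    have "convex half_box"
      unfolding half_box_def convex_alt
    proof (clarsimp, intro conjI)
      fix x y :: complex and r :: real
      assume a: "\<bar>Re x\<bar> * 2 \<le> 1" "\<bar>Im x\<bar> * 2 \<le> 1" "\<bar>Re y\<bar> * 2 \<le> 1" "\<bar>Im y\<bar> * 2 \<le> 1" "0 \<le> r" "r \<le> 1"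
      have *: "\<bar>(1 - r) * p + r * q\<bar> * 2 \<le> 1" if "\<bar>p\<bar> * 2 \<le> 1" "\<bar>q\<bar> * 2 \<le> 1" for p q
      proof -
        have "\<bar>(1 - r) * p + r * q\<bar> \<le> (1 - r) * \<bar>p\<bar> + r * \<bar>q\<bar>"
          using a by (intro order_trans[OF abs_triangle_ineq]) (simp add: abs_mult)
        also have "\<dots> \<le> (1 - r) * (1/2) + r * (1/2)"
          using a that by (intro add_mono mult_left_mono) auto
        finally show ?thesis by (simp add: field_simps)
      qed
      show "\<bar>(1 - r) * Re x + r * Re y\<bar> * 2 \<le> 1" using * a by blast
      show "\<bar>(1 - r) * Im x + r * Im y\<bar> * 2 \<le> 1" using * a by blast
    qed
    then have "convex ((\<lambda>y. centre u s + u * y) ` half_box)"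
      using convex_translation[OF convex_linear_image, of "(*) u" half_box "centre u s"]
      by (simp add: image_image linear_times)
    moreover have "corners u s \<subseteq> (\<lambda>y. centre u s + u * y) ` half_box"
    proof
      fix x assume "x \<in> corners u s"
      then have "(x - centre u s) / u \<in> half_box"
        using assms mem_corners box_corners_half_box by blast
      then show "x \<in> (\<lambda>y. centre u s + u * y) ` half_box"
        using assms by (intro image_eqI[of _ _ "(x - centre u s) / u"]) auto
    qed
    ultimately show "square u s \<subseteq> (\<lambda>y. centre u s + u * y) ` half_box"
      unfolding square_def by (rule hull_minimal[rotated])
    show "(\<lambda>y. centre u s + u * y) ` half_box \<subseteq> square u s"
    proof clarify
      fix y assume y: "y \<in> half_box"
      \<comment> \<open>Bilinear coordinates: \<open>p\<close> interpolates along two opposite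
        sides, \<open>q\<close> between the two points so found, and convexity applies each
        time.\<close>
      define p q where "p = Re y + 1/2" and "q = Im y + 1/2"
      have pq: "0 \<le> p" "p \<le> 1" "0 \<le> q" "q \<le> 1"
        using y by (auto simp: half_box_def p_def q_def abs_le_iff)
      have ye: "y = of_real p + of_real q * \<i> - (1 + \<i>) / 2"
        by (simp add: p_def q_def complex_eq_iff)
      have c: "s \<in> square u s" "s + u \<in> square u s" "s + u + \<i> * u \<in> square u s" "s + \<i> * u \<in> square u s"
        unfolding square_def by (auto intro!: hull_inc simp: corners_def)
      have cv: "convex (square u s)" by (simp add: square_def)
      have "(1 - p) *\<^sub>R s + p *\<^sub>R (s + u) \<in> square u s"
        and "(1 - p) *\<^sub>R (s + \<i> * u) + p *\<^sub>R (s + u + \<i> * u) \<in> square u s"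
        using cv c pq unfolding convex_alt by blast+
      with cv pq have "(1 - q) *\<^sub>R ((1 - p) *\<^sub>R s + p *\<^sub>R (s + u))
          + q *\<^sub>R ((1 - p) *\<^sub>R (s + \<i> * u) + p *\<^sub>R (s + u + \<i> * u)) \<in> square u s"
        unfolding convex_alt by blast
      also have "(1 - q) *\<^sub>R ((1 - p) *\<^sub>R s + p *\<^sub>R (s + u))
          + q *\<^sub>R ((1 - p) *\<^sub>R (s + \<i> * u) + p *\<^sub>R (s + u + \<i> * u)) = centre u s + u * y"
        by (simp add: ye centre_eq scaleR_conv_of_real algebra_simps)
      finally show "centre u s + u * y \<in> square u s" .
    qed
  qed
  then show ?thesis using assms by (force simp: field_simps)
qed

lemma corners_subset_square: "corners u s \<subseteq> square u s"
  unfolding square_def by (rule hull_subset)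

section \<open>The symmetry group\<close>

definition lattice_points :: "complex \<Rightarrow> complex \<Rightarrow> complex set" where
  "lattice_points u k = {k + u * z | z. z \<in> gauss_ints}"

text \<open>For nonzero \<open>u\<close> these are the orientation-preserving isometries that
  preserve \<open>lattice_points u k\<close>: a turn about \<open>k\<close>, then a lattice
  translation.\<close>

definition lattice_motions :: "complex \<Rightarrow> complex \<Rightarrow> (complex \<Rightarrow> complex) set" where
  "lattice_motions u k = {(\<lambda>x. k + w * (x - k) + u * z) | w z. w \<in> fourth_roots \<and> z \<in> gauss_ints}"

text \<open>\<open>lattice_gen2\<close> is \<open>\<i>\<close> times \<open>lattice_gen1\<close>, so
  \<Lambda> consists of the Gaussian multiples of a single vector.\<close>

lemma lattice_coset_eq: "lattice_coset a b k = lattice_points (lattice_gen1 a b) k"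
proof -
  have g2: "lattice_gen2 a b = \<i> * lattice_gen1 a b"
    by (simp add: lattice_gen1_def lattice_gen2_def complex_eq_iff)
  show ?thesis
    unfolding lattice_coset_def lattice_points_def g2
  proof safe
    fix m n :: int
    show "\<exists>z. k + of_int m * lattice_gen1 a b + of_int n * (\<i> * lattice_gen1 a b) =
              k + lattice_gen1 a b * z \<and> z \<in> gauss_ints"
      by (rule exI[of _ "of_int m + of_int n * \<i>"]) (simp add: algebra_simps)
  next
    fix z assume "z \<in> gauss_ints"
    then obtain m n where "z = of_int m + of_int n * \<i>" by (rule gauss_intsE)
    then show "\<exists>m n. k + lattice_gen1 a b * z =
                k + of_int m * lattice_gen1 a b + of_int n * (\<i> * lattice_gen1 a b) \<and> True"
      by (intro exI[of _ m] exI[of _ n]) (simp add: algebra_simps)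
  qed
qed

lemma lattice_points_base [simp]: "k \<in> lattice_points u k"
  unfolding lattice_points_def by (force intro: exI[of _ 0])

lemma lattice_points_add:
  "x \<in> lattice_points u k \<Longrightarrow> z \<in> gauss_ints \<Longrightarrow> x + u * z \<in> lattice_points u k"
  unfolding lattice_points_def
  by (smt (verit) add.assoc distrib_left gauss_ints_simps(4) mem_Collect_eq)

lemma lattice_points_diff:
  assumes "x \<in> lattice_points u k" "y \<in> lattice_points u k"
  obtains z where "z \<in> gauss_ints" "y = x + u * z"
proof -
  obtain z z' where "z \<in> gauss_ints" "z' \<in> gauss_ints" "x = k + u * z" "y = k + u * z'"
    using assms by (auto simp: lattice_points_def)
  then show ?thesis using that[of "z' - z"] by (simp add: algebra_simps)
qed

lemma corners_lattice:
  assumes "s \<in> lattice_points u k" "x \<in> corners u s"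
  shows "x \<in> lattice_points u k"
proof -
  obtain z where "z \<in> gauss_ints" "x = s + u * z"
    using assms(2) by (auto simp: corners_def algebra_simps intro: that[of 0] that[of 1] that[of \<i>] that[of "1 + \<i>"])
  then show ?thesis using assms(1) lattice_points_add by blast
qed

text \<open>With a unit as rotation part, the translation part is a Gaussian multiple of
  \<open>u\<close> as soon as one lattice point goes to a lattice point. This serves where a motion
  is known only through a few points.\<close>

lemma lattice_motion_by_point:
  assumes "w \<in> fourth_roots" "x \<in> lattice_points u k" "g x \<in> lattice_points u k"
    and "\<And>y. g y = g x + w * (y - x)"
  shows "g \<in> lattice_motions u k"
proof -
  obtain z z' where z: "z \<in> gauss_ints" "z' \<in> gauss_ints" "x = k + u * z" "g x = k + u * z'"
    using assms(2,3) by (auto simp: lattice_points_def)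
  have "g y = k + w * (y - k) + u * (z' - w * z)" for y
    unfolding assms(4)[of y] z(4) unfolding z(3) by (simp add: algebra_simps)
  moreover have "z' - w * z \<in> gauss_ints"
    using z assms(1) fourth_roots_gauss by auto
  ultimately show ?thesis
    using assms(1) unfolding lattice_motions_def by blast
qed

lemma lattice_motion_moves:
  assumes "g \<in> lattice_motions u k"
  obtains w where "w \<in> fourth_roots" "\<And>x y. g y = g x + w * (y - x)"
proof -
  obtain w z where "w \<in> fourth_roots" "g = (\<lambda>x. k + w * (x - k) + u * z)"
    using assms by (auto simp: lattice_motions_def)
  then show ?thesis using that[of w] by (simp add: algebra_simps)
qed

lemma lattice_motion_point:
  assumes "g \<in> lattice_motions u k" "x \<in> lattice_points u k"
  shows "g x \<in> lattice_points u k"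
proof -
  obtain w z where g: "w \<in> fourth_roots" "z \<in> gauss_ints" "g = (\<lambda>x. k + w * (x - k) + u * z)"
    using assms by (auto simp: lattice_motions_def)
  obtain z' where z': "z' \<in> gauss_ints" "x = k + u * z'"
    using assms by (auto simp: lattice_points_def)
  have "g x = k + u * (w * z' + z)" using g z' by (simp add: algebra_simps)
  moreover have "w * z' + z \<in> gauss_ints" using g z' fourth_roots_gauss by auto
  ultimately show ?thesis unfolding lattice_points_def by blast
qed

lemma lattice_motion_comp:
  assumes "g \<in> lattice_motions u k" "h \<in> lattice_motions u k"
  shows "g \<circ> h \<in> lattice_motions u k"
proof -
  obtain v where v: "v \<in> fourth_roots" "\<And>x y. g y = g x + v * (y - x)"
    using lattice_motion_moves[OF assms(1)] by metis
  obtain w where w: "w \<in> fourth_roots" "\<And>x y. h y = h x + w * (y - x)"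
    using lattice_motion_moves[OF assms(2)] by metis
  show ?thesis
  proof (rule lattice_motion_by_point[of "v * w" k])
    show "(g \<circ> h) k \<in> lattice_points u k"
      by (simp add: assms lattice_motion_point)
    fix y show "(g \<circ> h) y = (g \<circ> h) k + v * w * (y - k)"
      using v(2)[of "h y" "h k"] w(2)[of y k] by simp
  qed (auto simp: v w fourth_roots_mult)
qed

lemma lattice_motion_inverse:
  assumes "g \<in> lattice_motions u k"
  obtains h where "h \<in> lattice_motions u k" "g \<circ> h = id" "h \<circ> g = id"
proof -
  obtain w z where g: "w \<in> fourth_roots" "z \<in> gauss_ints" "g = (\<lambda>x. k + w * (x - k) + u * z)"
    using assms by (auto simp: lattice_motions_def)
  note w0 = fourth_roots_nonzero[OF g(1)]
  define h where "h = (\<lambda>x. k + inverse w * (x - k) + u * (- inverse w * z))"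
  have "h \<in> lattice_motions u k"
    unfolding h_def lattice_motions_def
    using g fourth_roots_inverse fourth_roots_gauss by blast
  moreover have "g \<circ> h = id" "h \<circ> g = id"
    using w0 by (auto simp: g(3) h_def fun_eq_iff field_simps)
  ultimately show ?thesis using that by blast
qed

lemma lattice_motion_centre:
  assumes "g \<in> lattice_motions u k" "s \<in> lattice_points u k"
  obtains w s' where "w \<in> fourth_roots" "s' \<in> lattice_points u k"
    "g = (\<lambda>x. centre u s' + w * (x - centre u s))"
proof -
  obtain w where w: "w \<in> fourth_roots" "\<And>x y. g y = g x + w * (y - x)"
    using lattice_motion_moves[OF assms(1)] by metis
  \<comment> \<open>\<open>1 + \<i>\<close> divides \<open>w - 1\<close> for every unit
    \<open>w\<close>, and \<open>(1 + \<i>) / 2 = \<i> / (1 + \<i>)\<close>; so turning about the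
    centre instead of the first corner changes the target by a lattice vector only.\<close>
  define z where "z = (w - 1) * (1 + \<i>) / 2"
  have z: "z \<in> gauss_ints"
    using w(1) by (auto simp: z_def fourth_roots_def gauss_ints_def)
  have "g x = centre u (g s + u * z) + w * (x - centre u s)" for x
    using w(2)[of s x] by (simp add: centre_eq z_def algebra_simps add_divide_distrib diff_divide_distrib)
  then have "g = (\<lambda>x. centre u (g s + u * z) + w * (x - centre u s))"
    by blast
  moreover have "g s + u * z \<in> lattice_points u k"
    using z assms lattice_motion_point lattice_points_add by blast
  ultimately show ?thesis using that w(1) by blast
qed

lemma rotation_of_square:
  assumes "w \<in> fourth_roots" "s \<in> lattice_points u k" "s' \<in> lattice_points u k"
  shows "(\<lambda>x. centre u s' + w * (x - centre u s)) \<in> lattice_motions u k" (is "?g \<in> _")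
proof (rule lattice_motion_by_point[OF assms(1,2)])
  have "(1 - w) * (1 + \<i>) / 2 \<in> gauss_ints"
    using assms(1) by (auto simp: fourth_roots_def gauss_ints_def)
  moreover have "?g s = s' + u * ((1 - w) * (1 + \<i>) / 2)"
    by (simp add: centre_eq field_simps)
  ultimately show "?g s \<in> lattice_points u k"
    using assms lattice_points_add by metis
qed (simp add: algebra_simps)

lemma image_affine_eqI:
  fixes w :: complex
  assumes "w \<noteq> 0" "\<And>x. c' + w * (x - c) \<in> T \<longleftrightarrow> x \<in> S"
  shows "(\<lambda>x. c' + w * (x - c)) ` S = T"
proof
  show "(\<lambda>x. c' + w * (x - c)) ` S \<subseteq> T" using assms(2) by blast
  show "T \<subseteq> (\<lambda>x. c' + w * (x - c)) ` S"
  proof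
    fix y assume y: "y \<in> T"
    have *: "c' + w * ((c + (y - c') / w) - c) = y" using assms(1) by simp
    then have "c + (y - c') / w \<in> S" using assms(2) y by metis
    then show "y \<in> (\<lambda>x. c' + w * (x - c)) ` S" using * by (metis imageI)
  qed
qed

lemma rotate_square:
  assumes "u \<noteq> 0" "w \<in> fourth_roots"
  shows "(\<lambda>x. centre u s' + w * (x - centre u s)) ` square u s = square u s'"
    and "(\<lambda>x. centre u s' + w * (x - centre u s)) ` corners u s = corners u s'"
proof -
  have *: "(centre u s' + w * (x - centre u s) - centre u s') / u = w * ((x - centre u s) / u)" for x
    by simp
  show "(\<lambda>x. centre u s' + w * (x - centre u s)) ` square u s = square u s'"
    using assms by (intro image_affine_eqI)
      (simp_all only: fourth_roots_nonzero mem_square * half_box_rotate not_False_eq_True simp_thms)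
  show "(\<lambda>x. centre u s' + w * (x - centre u s)) ` corners u s = corners u s'"
    using assms by (intro image_affine_eqI)
      (simp_all only: fourth_roots_nonzero mem_corners * box_corners_rotate not_False_eq_True simp_thms)
qed

lemma lattice_motion_square:
  assumes "u \<noteq> 0" "g \<in> lattice_motions u k" "s \<in> lattice_points u k"
  obtains s' where "s' \<in> lattice_points u k" "g ` square u s = square u s'"
    "g ` corners u s = corners u s'"
proof -
  obtain w s' where "w \<in> fourth_roots" "s' \<in> lattice_points u k"
    "g = (\<lambda>x. centre u s' + w * (x - centre u s))"
    using lattice_motion_centre[OF assms(2,3)] by metis
  then show ?thesis using rotate_square[OF assms(1)] that by simp
qed

section \<open>The group generated by two quarter-turns\<close>

lemma bij_isometry_inv:
  assumes "bij g" "\<And>x y. dist (g x) (g y) = dist x y"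
  shows "dist (inv_into UNIV g x) (inv_into UNIV g y) = dist x y"
  using assms by (metis bij_inv_eq_iff)

lemma group_isometry_group: "group isometry_group"
proof (rule groupI)
  show "\<one>\<^bsub>isometry_group\<^esub> \<in> carrier isometry_group"
    by (simp add: isometry_group_def)
next
  fix x y assume "x \<in> carrier isometry_group" "y \<in> carrier isometry_group"
  then show "x \<otimes>\<^bsub>isometry_group\<^esub> y \<in> carrier isometry_group"
    by (auto simp: isometry_group_def bij_comp)
next
  fix x assume x: "x \<in> carrier isometry_group"
  obtain g e where [simp]: "x = (g, e)" by (cases x)
  have g: "bij g" "\<And>x y. dist (g x) (g y) = dist x y"
    using x by (auto simp: isometry_group_def)
  show "\<exists>y\<in>carrier isometry_group. y \<otimes>\<^bsub>isometry_group\<^esub> x = \<one>\<^bsub>isometry_group\<^esub>"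
    by (rule bexI[of _ "(inv_into UNIV g, e)"])
      (use g in \<open>auto simp: isometry_group_def bij_imp_bij_inv bij_isometry_inv bij_is_inj\<close>)
qed (auto simp: isometry_group_def split: prod.splits)

lemma lattice_motion_carrier:
  assumes "g \<in> lattice_motions u k"
  shows "(g, False) \<in> carrier isometry_group"
proof -
  obtain w where w: "w \<in> fourth_roots" "\<And>x y. g y = g x + w * (y - x)"
    using lattice_motion_moves[OF assms(1)] by metis
  obtain h where "g \<circ> h = id" "h \<circ> g = id"
    using lattice_motion_inverse[OF assms] by metis
  then have "bij g" by (rule o_bij[rotated])
  moreover have "dist (g x) (g y) = dist x y" for x y
    unfolding dist_norm using w(2)[of x y] fourth_roots_norm[OF w(1)] by (simp add: norm_mult)
  ultimately show ?thesis by (simp add: isometry_group_def)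
qed

lemma subgroup_lattice_motions:
  "subgroup {(g, False) | g. g \<in> lattice_motions u k} isometry_group"
proof (rule group.subgroupI[OF group_isometry_group])
  show "{(g, False) |g. g \<in> lattice_motions u k} \<subseteq> carrier isometry_group"
    using lattice_motion_carrier by blast
  have "k + 1 * (x - k) + u * 0 = x" for x by simp
  then show "{(g, False) |g. g \<in> lattice_motions u k} \<noteq> {}"
    unfolding lattice_motions_def by (auto simp: fourth_roots_def)
next
  fix x assume "x \<in> {(g, False) |g. g \<in> lattice_motions u k}"
  then obtain g where g: "x = (g, False)" "g \<in> lattice_motions u k" by auto
  then obtain h where h: "h \<in> lattice_motions u k" "g \<circ> h = id" "h \<circ> g = id"
    using lattice_motion_inverse by metis
  have "inv\<^bsub>isometry_group\<^esub> x = (h, False)"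
    using g h lattice_motion_carrier
    by (intro group.inv_equality[OF group_isometry_group]) (auto simp: isometry_group_def)
  then show "inv\<^bsub>isometry_group\<^esub> x \<in> {(g, False) |g. g \<in> lattice_motions u k}"
    using h by auto
next
  fix x y assume "x \<in> {(g, False) |g. g \<in> lattice_motions u k}"
    "y \<in> {(g, False) |g. g \<in> lattice_motions u k}"
  then show "x \<otimes>\<^bsub>isometry_group\<^esub> y \<in> {(g, False) |g. g \<in> lattice_motions u k}"
    by (auto simp: isometry_group_def lattice_motion_comp)
qed

text \<open>The quarter-turn about \<open>k'\<close> after the inverse of the one about
  \<open>k\<close> is a translation by a unit multiple of \<open>u\<close>. Conjugation by a
  quarter-turn multiplies translations by \<open>\<i>\<close>, so all Gaussian multiples of
  \<open>u\<close> arise. The sign \<open>r\<close> lets either family of centres play the part of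
  \<open>k\<close>.\<close>

lemma generate_quarter_turns:
  assumes uk: "u = r * (1 + \<i>) * (k' - k)" and r: "r \<in> {1, -1}"
  shows "generate isometry_group {(rotation_about k \<i>, False), (rotation_about k' \<i>, False)} =
    {(g, False) | g. g \<in> lattice_motions u k}" (is "generate _ ?H = ?D")
proof
  interpret group isometry_group by (rule group_isometry_group)
  have mult: "x \<otimes>\<^bsub>isometry_group\<^esub> y = (fst x \<circ> fst y, snd x \<noteq> snd y)" for x y
    by (simp add: isometry_group_def split: prod.splits)
  have rk: "rotation_about k \<i> = (\<lambda>x. k + \<i> * (x - k) + u * 0)"
    by (simp add: rotation_about_def fun_eq_iff)
  have rk': "rotation_about k' \<i> = (\<lambda>x. k + \<i> * (x - k) + u * (- r * \<i>))"
    using r unfolding uk by (auto simp: rotation_about_def fun_eq_iff algebra_simps)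
  have gi: "- r * \<i> \<in> gauss_ints" using r by auto
  have i4: "\<i> \<in> fourth_roots" by (simp add: fourth_roots_def)
  have "rotation_about k \<i> \<in> lattice_motions u k"
    unfolding lattice_motions_def rk using gauss_ints_simps(1) i4 by blast
  moreover have "rotation_about k' \<i> \<in> lattice_motions u k"
    unfolding lattice_motions_def rk' using gi i4 by blast
  ultimately have H: "?H \<subseteq> ?D" by auto
  show "generate isometry_group ?H \<subseteq> ?D"
    by (rule generate_subgroup_incl[OF H subgroup_lattice_motions])
  have Hc: "?H \<subseteq> carrier isometry_group"
    using H lattice_motion_carrier by blast
  note sub = generate_is_subgroup[OF Hc]
  define P where "P z \<longleftrightarrow> ((\<lambda>x. x + u * z, False) \<in> generate isometry_group ?H)" for z
  define R where "R w \<longleftrightarrow> ((\<lambda>x. k + w * (x - k), False) \<in> generate isometry_group ?H)" for w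
  have comp: "(g, False) \<in> generate isometry_group ?H \<Longrightarrow> (h, False) \<in> generate isometry_group ?H \<Longrightarrow>
      (g \<circ> h, False) \<in> generate isometry_group ?H" for g h
    using generate.eng[of "(g, False)" isometry_group ?H "(h, False)"] by (simp add: mult)
  have Ri: "R \<i>" unfolding R_def by (rule generate.incl) (simp add: rk)
  have Rm: "R (v * w)" if "R v" "R w" for v w
    using comp[of "\<lambda>x. k + v * (x - k)" "\<lambda>x. k + w * (x - k)"] that
    by (simp add: R_def comp_def mult.assoc)
  have R: "R w" if "w \<in> fourth_roots" for w
  proof -
    have "R (\<i> * \<i>)" "R (\<i> * \<i> * \<i>)" "R (\<i> * \<i> * \<i> * \<i>)" by (intro Rm Ri)+
    then show ?thesis using that Ri by (auto simp: fourth_roots_def)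
  qed
  have P0: "P 0" using generate.one[of isometry_group ?H] by (simp add: P_def isometry_group_def id_def)
  have Pa: "P (v + w)" if "P v" "P w" for v w
    using comp[of "\<lambda>x. x + u * v" "\<lambda>x. x + u * w"] that
    by (simp add: P_def comp_def algebra_simps)
  have Pr: "P (\<i> * v)" if "P v" for v
  proof -
    have 1: "(\<lambda>x. k + (- \<i>) * (x - k), False) \<in> generate isometry_group ?H"
      using R[of "- \<i>"] by (simp add: R_def fourth_roots_def)
    have 2: "(\<lambda>x. k + \<i> * (x - k), False) \<in> generate isometry_group ?H"
      using Ri by (simp add: R_def)
    have 3: "(\<lambda>x. k + \<i> * (x - k)) \<circ> (\<lambda>x. x + u * v) \<circ> (\<lambda>x. k + (- \<i>) * (x - k)) =
      (\<lambda>x. x + u * (\<i> * v))" by (auto simp: fun_eq_iff algebra_simps)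
    show ?thesis
      using comp[OF comp[OF 2 that[unfolded P_def]] 1] unfolding P_def 3 .
  qed
  have "P (- r * \<i>)"
  proof -
    have 1: "(rotation_about k' \<i>, False) \<in> generate isometry_group ?H"
      by (rule generate.incl) simp
    have 2: "(\<lambda>x. k + (- \<i>) * (x - k), False) \<in> generate isometry_group ?H"
      using R[of "- \<i>"] by (simp add: R_def fourth_roots_def)
    have 3: "rotation_about k' \<i> \<circ> (\<lambda>x. k + (- \<i>) * (x - k)) = (\<lambda>x. x + u * (- r * \<i>))"
      unfolding rk' by (auto simp: fun_eq_iff algebra_simps)
    show ?thesis using comp[OF 1 2] unfolding P_def 3 .
  qed
  \<comment> \<open>Repeated multiplication by \<open>\<i>\<close> runs through all units, so
    \<open>1\<close> and \<open>- 1\<close> are reached whatever the sign of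
    \<open>r\<close>.\<close>
  then have Pu: "P 1" "P (- 1)"
    using r Pr[of "- r * \<i>"] Pr[of "\<i> * (- r * \<i>)"] Pr[of "\<i> * (\<i> * (- r * \<i>))"] by auto
  have Pn: "P (of_nat n * v)" if "P v" for n v
    using that P0 Pa by (induction n) (auto simp: algebra_simps)
  have Pi: "P (of_int m)" for m
    using Pn[OF Pu(1), of "nat m"] Pn[OF Pu(2), of "nat (- m)"] by (cases "m \<ge> 0") auto
  have Pg: "P z" if z: "z \<in> gauss_ints" for z
  proof -
    obtain m n where "z = of_int m + of_int n * \<i>" using gauss_intsE[OF z] by metis
    then show ?thesis using Pa[OF Pi[of m] Pr[OF Pi[of n]]] by (simp add: mult.commute)
  qed
  show "?D \<subseteq> generate isometry_group ?H"
  proof clarify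
    fix g assume "g \<in> lattice_motions u k"
    then obtain w z where g: "w \<in> fourth_roots" "z \<in> gauss_ints" "g = (\<lambda>x. k + w * (x - k) + u * z)"
      by (auto simp: lattice_motions_def)
    then show "(g, False) \<in> generate isometry_group ?H"
      using comp[OF Pg[OF g(2), unfolded P_def] R[OF g(1), unfolded R_def]] by (simp add: comp_def)
  qed
qed

text \<open>Since \<open>lattice_gen1 a b = (1 + \<i>) * (d - c)\<close>, the two families of centres may be exchanged.\<close>

lemma symmetry_group_lattice_motions:
  assumes "species_33_4 F c d a b" "k = c \<or> k = d"
  shows "symmetry_group F = {(g, False) | g. g \<in> lattice_motions (lattice_gen1 a b) k}"
proof -
  have dc: "d - c = Complex (of_int (2 * a)) (of_int (2 * b))"
    and G: "symmetry_group F = group_33_4 c d"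
    using assms(1) by (auto simp: species_33_4_def)
  have u: "lattice_gen1 a b = (1 + \<i>) * (d - c)"
    unfolding dc by (simp add: lattice_gen1_def complex_eq_iff)
  show ?thesis
  proof (cases "k = c")
    case True
    then show ?thesis
      using generate_quarter_turns[of "lattice_gen1 a b" 1 d k] u by (simp add: G group_33_4_def)
  next
    case False
    then have k: "k = d" using assms(2) by simp
    have "lattice_gen1 a b = (- 1) * (1 + \<i>) * (c - k)" unfolding u k by (simp add: algebra_simps)
    from generate_quarter_turns[OF this] show ?thesis
      by (simp add: G group_33_4_def k insert_commute)
  qed
qed

lemma square_inject:
  assumes u: "u \<noteq> 0" and s: "s \<in> lattice_points u k" "s' \<in> lattice_points u k"
    and eq: "square u s = square u s'"
  shows "s = s'"
proof (rule ccontr)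
  assume ne: "s \<noteq> s'"
  obtain z where z: "z \<in> gauss_ints" "s = s' + u * z"
    using lattice_points_diff[OF s(2,1)] by metis
  have "centre u s' + u * (y / 2) \<in> square u s' \<longleftrightarrow> y / 2 \<in> half_box" for y
    using u by (simp add: mem_square)
  moreover have "centre u s' + u * (y / 2) \<in> square u s \<longleftrightarrow> y / 2 - z \<in> half_box" for y
  proof -
    have "(centre u s' + u * (y / 2) - centre u s) / u = y / 2 - z"
      using u by (simp add: z(2) centre_eq field_simps)
    then show ?thesis by (simp add: mem_square[OF u])
  qed
  ultimately have *: "y / 2 \<in> half_box \<longleftrightarrow> y / 2 - z \<in> half_box" for y using eq by blast
  \<comment> \<open>Two opposite corners of one square must lie in the other; they bound both parts
    of \<open>z\<close> from above and below.\<close>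
  have "\<bar>1 / 2 - Re z\<bar> \<le> 1 / 2" "\<bar>1 / 2 - Im z\<bar> \<le> 1 / 2" "\<bar>- 1 / 2 - Re z\<bar> \<le> 1 / 2" "\<bar>- 1 / 2 - Im z\<bar> \<le> 1 / 2"
    using *[of "1 + \<i>"] *[of "- 1 - \<i>"] by (simp_all add: half_box_def)
  then have "Re z = 0" "Im z = 0" by linarith+
  then have "z = 0" by (simp add: complex_eq_iff)
  then show False using ne z(2) by simp
qed

section \<open>Strands under motions of the lattice\<close>

lemma interior_strip:
  "interior (strip (Warp i)) = {z. of_int i < Re z \<and> Re z < of_int (i + 1)}"
  "interior (strip (Weft i)) = {z. of_int i < Im z \<and> Im z < of_int (i + 1)}"
proof -
  have "strip (Warp i) = {z. 1 \<bullet> z \<le> of_int (i + 1)} \<inter> {z. (- 1) \<bullet> z \<le> - of_int i}"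
    by auto
  then show "interior (strip (Warp i)) = {z. of_int i < Re z \<and> Re z < of_int (i + 1)}"
    by (simp only: interior_Int interior_halfspace_le[of "1::complex"] interior_halfspace_le[of "-1::complex"] one_neq_zero
        not_False_eq_True neg_equal_0_iff_equal) auto
  have "strip (Weft i) = {z. \<i> \<bullet> z \<le> of_int (i + 1)} \<inter> {z. (- \<i>) \<bullet> z \<le> - of_int i}"
    by auto
  then show "interior (strip (Weft i)) = {z. of_int i < Im z \<and> Im z < of_int (i + 1)}"
    by (simp only: interior_Int interior_halfspace_le[of "\<i>"] interior_halfspace_le[of "-\<i>"] complex_i_not_zero
        not_False_eq_True neg_equal_0_iff_equal) auto
qed

lemma convex_strip: "convex (strip t)"
  by (cases t)
    (use convex_halfspace_Re_le convex_halfspace_Re_ge convex_halfspace_Im_le convex_halfspace_Im_ge in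
      \<open>auto simp: Collect_conj_eq intro!: convex_Int\<close>)

lemma interior_cell: "z \<in> interior (cell i j) \<longleftrightarrow>
    of_int i < Re z \<and> Re z < of_int (i + 1) \<and> of_int j < Im z \<and> Im z < of_int (j + 1)"
  by (auto simp: cell_def interior_strip simp del: strip.simps)

text \<open>A convex set with inner points lies in the closure of its interior, and an open set
  meeting a closure meets the set itself. Pieces and shown cells are defined by closed strips and
  cells, whereas crossing a side and identifying a cell call for interior points.\<close>

lemma closure_interior_meets:
  fixes S T :: "complex set"
  assumes "convex S" "interior S \<noteq> {}" "S \<inter> interior T \<noteq> {}"
  shows "interior S \<inter> interior T \<noteq> {}"
proof -
  have "S \<subseteq> closure (interior S)"
    using convex_closure_interior[OF assms(1,2)] closure_subset by metis
  then have "closure (interior S) \<inter> interior T \<noteq> {}" using assms(3) by blast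
  then show ?thesis
    using open_Int_closure_eq_empty[of "interior T" "interior S"] by blast
qed

lemma strip_meets_interior:
  assumes "strip t \<inter> interior S \<noteq> {}"
  shows "interior (strip t) \<inter> interior S \<noteq> {}"
proof (rule closure_interior_meets[OF convex_strip _ assms])
  have "Complex (of_int i + 1 / 2) (of_int i + 1 / 2) \<in> interior (strip t)" if "t = Warp i \<or> t = Weft i" for i
    using that by (auto simp: interior_strip simp del: strip.simps)
  then show "interior (strip t) \<noteq> {}" by (cases t) blast+
qed

lemma cell_meets_interior:
  assumes "cell i j \<inter> interior S \<noteq> {}"
  shows "interior (cell i j) \<inter> interior S \<noteq> {}"
proof (rule closure_interior_meets[OF _ _ assms])
  show "convex (cell i j)" by (simp add: cell_def convex_Int convex_strip del: strip.simps)
  have "Complex (of_int i + 1 / 2) (of_int j + 1 / 2) \<in> interior (cell i j)"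
    by (auto simp: interior_cell)
  then show "interior (cell i j) \<noteq> {}" by blast
qed

text \<open>Strands are bounded by integer lines. As all corners of lattice units are Gaussian
  integers, no corner is interior to a strand, and a strand passes from unit to unit across sides
  only.\<close>

lemma interior_strip_gauss_ints: "interior (strip t) \<inter> gauss_ints = {}"
  by (cases t) (auto simp: interior_strip gauss_ints_def simp del: strip.simps elim!: Ints_cases)

lemma interior_cell_unique:
  assumes "z \<in> interior (cell i j)" "z \<in> cell i' j'"
  shows "i = i' \<and> j = j'"
  using assms unfolding interior_cell by (auto simp: cell_def)

lemma motion_inj: "g \<in> lattice_motions u k \<Longrightarrow> inj g"
  using lattice_motion_inverse[of g u k] by (metis inj_on_id inj_on_imageI2)

lemma interior_motion:
  assumes "g \<in> lattice_motions u k"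
  shows "interior (g ` S) = g ` interior S"
proof -
  obtain w z where g: "w \<in> fourth_roots" "g = (\<lambda>x. k + w * (x - k) + u * z)"
    using assms by (auto simp: lattice_motions_def)
  have *: "g ` A = (+) (k - w * k + u * z) ` (*) w ` A" for A
    by (auto simp: g(2) image_image algebra_simps)
  have "inj ((*) w)" using fourth_roots_nonzero[OF g(1)] by (auto simp: inj_def)
  then show ?thesis
    unfolding * interior_translation
    by (subst interior_injective_linear_image) (auto simp: linear_times)
qed

lemma motion_image_eqI:
  assumes "g \<in> lattice_motions u k" "\<And>x. g x \<in> T \<longleftrightarrow> x \<in> S"
  shows "g ` S = T"
proof -
  obtain h where h: "g \<circ> h = id"
    using lattice_motion_inverse[OF assms(1)] by metis
  have "y \<in> g ` S" if "y \<in> T" for y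
    using assms(2)[of "h y"] that pointfree_idE[OF h, of y] by (metis imageI)
  then show ?thesis using assms(2) by auto
qed

lemma motion_strip:
  assumes g: "g \<in> lattice_motions u k" and u: "u \<in> gauss_ints" and k: "k \<in> gauss_ints"
  obtains t' where "g ` strip t = strip t'"
proof -
  obtain w z where wz: "w \<in> fourth_roots" "z \<in> gauss_ints" "g = (\<lambda>x. k + w * (x - k) + u * z)"
    using g by (auto simp: lattice_motions_def)
  define r where "r = k - w * k + u * z"
  have "r \<in> gauss_ints" using wz u k fourth_roots_gauss by (auto simp: r_def)
  then obtain m n :: int where r: "Re r = of_int m" "Im r = of_int n"
    by (auto simp: gauss_ints_def elim!: Ints_cases)
  have gx: "g x = w * x + r" for x by (simp add: wz r_def algebra_simps)
  \<comment> \<open>Where the direction across the strand is reversed, the interval from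
    \<open>i\<close> to \<open>i + 1\<close> goes to the one from \<open>m - i - 1\<close> to
    \<open>m - i\<close>; hence the shift by one.\<close>
  define t' where "t' = (if w = 1 then (case t of Warp i \<Rightarrow> Warp (i + m) | Weft j \<Rightarrow> Weft (j + n))
    else if w = \<i> then (case t of Warp i \<Rightarrow> Weft (i + n) | Weft j \<Rightarrow> Warp (m - j - 1))
    else if w = - 1 then (case t of Warp i \<Rightarrow> Warp (m - i - 1) | Weft j \<Rightarrow> Weft (n - j - 1))
    else (case t of Warp i \<Rightarrow> Weft (n - i - 1) | Weft j \<Rightarrow> Warp (j + m)))"
  have "g x \<in> strip t' \<longleftrightarrow> x \<in> strip t" for x
    using wz(1) unfolding t'_def fourth_roots_def gx
    by (cases t) (auto simp: r complex_eq_iff)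
  then show ?thesis using that motion_image_eqI[OF g] by blast
qed

text \<open>As \<open>a - b\<close> and \<open>a + b\<close> are coprime, lattice translations shift
  the warps by every even number; the half-turn about \<open>k\<close> changes the parity of a warp
  index relative to \<open>k\<close>, and the quarter-turn makes warps of wefts. So every strand can
  be brought to the warp just right of \<open>k\<close>.\<close>

lemma strips_transitive:
  assumes u: "u = lattice_gen1 a b" and ab: "coprime a b" "odd (a + b)" and k: "k \<in> gauss_ints"
  obtains g where "g \<in> lattice_motions u k" "g ` strip t = strip t'"
proof -
  obtain p q :: int where pq: "Re k = of_int p" "Im k = of_int q"
    using k by (auto simp: gauss_ints_def elim!: Ints_cases)
  \<comment> \<open>A common divisor divides \<open>2 * a\<close> and \<open>2 * b\<close>, and it
    is odd because \<open>a + b\<close> is.\<close>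
  have "coprime (a - b) (a + b)"
  proof (rule coprimeI)
    fix c assume c: "c dvd a - b" "c dvd a + b"
    have "c dvd (a - b) + (a + b)" "c dvd (a + b) - (a - b)"
      using dvd_add[OF c] dvd_diff[OF c(2,1)] .
    then have "c dvd 2 * a" "c dvd 2 * b" by simp_all
    moreover have "odd c" using c(2) ab(2) dvd_trans by blast
    then have "coprime c 2" by simp
    ultimately have "c dvd a" "c dvd b" by (simp_all add: coprime_dvd_mult_right_iff)
    then show "is_unit c" using ab(1) coprime_common_divisor by blast
  qed
  then obtain x y where xy: "x * (a - b) + y * (a + b) = 1"
    using bezout_int[of "a - b" "a + b"] by auto
  have tr: "\<exists>g \<in> lattice_motions u k. g ` strip (Warp i) = strip (Warp p)" if ev: "even (i - p)" for i
  proof -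
    obtain m where "i - p = 2 * m" using ev by (rule evenE)
    then have m: "i = p + 2 * m" by simp
    \<comment> \<open>The Bezout coefficients scaled by \<open>m\<close>. The imaginary part enters
      \<open>Re (u * z)\<close> with a minus sign, hence the opposite signs here.\<close>
    define z :: complex where "z = of_int (- x * m) + of_int (y * m) * \<i>"
    define g where "g = (\<lambda>v. k + 1 * (v - k) + u * z)"
    have "z \<in> gauss_ints" unfolding z_def by (intro gauss_ints_simps)
    then have gl: "g \<in> lattice_motions u k"
      unfolding lattice_motions_def g_def using fourth_roots_1 by blast
    have "Re (u * z) = of_int (- 2 * m * (x * (a - b) + y * (a + b)))"
      by (simp add: u lattice_gen1_def z_def algebra_simps)
    then have "Re (u * z) = of_int (- 2 * m)" by (simp only: xy mult_1_right)
    then have "g v \<in> strip (Warp p) \<longleftrightarrow> v \<in> strip (Warp i)" for v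
      by (auto simp: g_def m)
    then show ?thesis using motion_image_eqI[OF gl] gl by blast
  qed
  have ug: "u \<in> gauss_ints" by (auto simp: u lattice_gen1_def gauss_ints_def)
  have warp: "\<exists>g \<in> lattice_motions u k. g ` strip (Warp i) = strip (Warp p)" for i
  proof (cases "even (i - p)")
    case False
    define g where "g = (\<lambda>v. k + (- 1) * (v - k) + u * 0)"
    have gl: "g \<in> lattice_motions u k"
      unfolding lattice_motions_def g_def fourth_roots_def by blast
    have "g v \<in> strip (Warp (2 * p - i - 1)) \<longleftrightarrow> v \<in> strip (Warp i)" for v
      by (auto simp: g_def pq)
    then have gi: "g ` strip (Warp i) = strip (Warp (2 * p - i - 1))"
      by (rule motion_image_eqI[OF gl])
    have "even (2 * p - i - 1 - p)" using False by simp
    then obtain h where "h \<in> lattice_motions u k" "h ` strip (Warp (2 * p - i - 1)) = strip (Warp p)"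
      using tr by blast
    then show ?thesis
      using gl gi by (intro bexI[of _ "h \<circ> g"]) (simp_all only: image_comp[symmetric] lattice_motion_comp)
  qed (use tr in blast)
  have all: "\<exists>g \<in> lattice_motions u k. g ` strip t = strip (Warp p)" for t
  proof (cases t)
    case (Weft j)
    define g where "g = (\<lambda>v. k + \<i> * (v - k) + u * 0)"
    have gl: "g \<in> lattice_motions u k"
      unfolding lattice_motions_def g_def fourth_roots_def by blast
    have "g v \<in> strip (Warp (p + q - j - 1)) \<longleftrightarrow> v \<in> strip (Weft j)" for v
      by (auto simp: g_def pq)
    then have gi: "g ` strip (Weft j) = strip (Warp (p + q - j - 1))"
      by (rule motion_image_eqI[OF gl])
    obtain h where "h \<in> lattice_motions u k" "h ` strip (Warp (p + q - j - 1)) = strip (Warp p)"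
      using warp by blast
    then show ?thesis unfolding Weft
      using gl gi by (intro bexI[of _ "h \<circ> g"]) (simp_all only: image_comp[symmetric] lattice_motion_comp)
  qed (use warp in blast)
  obtain g where g: "g \<in> lattice_motions u k" "g ` strip t = strip (Warp p)" using all by blast
  obtain h where h: "h \<in> lattice_motions u k" "h ` strip t' = strip (Warp p)" using all by blast
  obtain h' where h': "h' \<in> lattice_motions u k" "h' \<circ> h = id"
    using lattice_motion_inverse[OF h(1)] by metis
  have "(h' \<circ> g) ` strip t = h' ` h ` strip t'" using g(2) h(2) by (simp only: image_comp[symmetric])
  also have "\<dots> = strip t'" using h'(2) by (metis image_comp image_id id_apply)
  finally show ?thesis using that[of "h' \<circ> g"] g h' lattice_motion_comp by blast
qed

section \<open>Colours at the corners of lattice units\<close>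

text \<open>The warp just right of \<open>x\<close> stands for the whole block: at the centre of a
  redundant block all strands through the point share its colour.\<close>

definition corner_colour :: "(strand \<Rightarrow> colour) \<Rightarrow> complex \<Rightarrow> colour" where
  "corner_colour \<kappa> x = \<kappa> (Warp \<lfloor>Re x\<rfloor>)"

lemma redundant_block_colour:
  assumes "redundant_block_centre \<kappa> x" "x \<in> strip t"
  shows "\<kappa> t = corner_colour \<kappa> x"
proof -
  obtain i j where ij: "x = Complex (of_int (i + 1)) (of_int (j + 1))"
    "\<kappa> (Warp i) = \<kappa> (Warp (i + 1))" "\<kappa> (Weft j) = \<kappa> (Weft (j + 1))" "\<kappa> (Warp i) = \<kappa> (Weft j)"
    using assms(1) by (auto simp: redundant_block_centre_def)
  have "Re x = of_int (i + 1)" "Im x = of_int (j + 1)" by (simp_all add: ij(1))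
  then have "t \<in> {Warp i, Warp (i + 1), Weft j, Weft (j + 1)}" "\<lfloor>Re x\<rfloor> = i + 1"
    using assms(2) by (cases t; force)+
  then show ?thesis using ij(2-4) by (auto simp: corner_colour_def)
qed

text \<open>Because \<open>a + b\<close> and \<open>a - b\<close> are odd, every side of a unit
  shifts the warps by twice an odd number, that is, by an odd number of pairs of the
  striping.\<close>

lemma corner_colour_alternates:
  assumes "thick_striping \<kappa>" "odd (a + b)" "e \<in> fourth_roots"
  shows "corner_colour \<kappa> (x + lattice_gen1 a b * e) \<noteq> corner_colour \<kappa> x"
proof -
  obtain m where m: "odd m" "Re (x + lattice_gen1 a b * e) = Re x + of_int (2 * m)"
  proof -
    have "odd (a - b)" "odd (b - a)" "odd (- a - b)" using assms(2) by presburger+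
    then show ?thesis
      using assms(2,3) that[of "a - b"] that[of "b - a"] that[of "a + b"] that[of "- a - b"]
      by (auto simp: fourth_roots_def lattice_gen1_def)
  qed
  obtain p where p: "\<kappa> (Warp i) = (if even ((i - p) div 2) then Dark else Pale)" for i
    using assms(1) unfolding thick_striping_def by blast
  have "(\<lfloor>Re x\<rfloor> + 2 * m - p) div 2 = (\<lfloor>Re x\<rfloor> - p) div 2 + m" by linarith
  then show ?thesis
    using m(1) unfolding corner_colour_def m(2) floor_add_int[symmetric] p by auto
qed

text \<open>Under a perfect colouring \<open>g\<close> keeps all colours or reverses all, so one
  strand decides. A strand through \<open>x\<close> is taken, since its colour and that of its image
  can be read off at \<open>x\<close> and \<open>g x\<close>.\<close>

lemma motion_colour:
  assumes g: "(g, False) \<in> symmetry_group F" "g \<in> lattice_motions u k"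
    and \<kappa>: "perfect_colouring F \<kappa>" "\<forall>x \<in> lattice_points u k. redundant_block_centre \<kappa> x"
    and gauss: "u \<in> gauss_ints" "k \<in> gauss_ints"
    and x: "x \<in> lattice_points u k" and t: "g ` strip t = strip t'"
  shows "\<kappa> t' = \<kappa> t \<longleftrightarrow> corner_colour \<kappa> (g x) = corner_colour \<kappa> x"
proof -
  obtain s where s: "x \<in> strip s"
  proof -
    have "x \<in> strip (Warp \<lfloor>Re x\<rfloor>)" by simp
    then show ?thesis using that by blast
  qed
  obtain s' where s': "g ` strip s = strip s'" using motion_strip[OF g(2) gauss] by metis
  have "\<kappa> s = corner_colour \<kappa> x" using \<kappa>(2) s x redundant_block_colour by blast
  moreover have "g x \<in> strip s'" using s s' by blast
  then have "\<kappa> s' = corner_colour \<kappa> (g x)"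
    using \<kappa>(2) x g(2) lattice_motion_point redundant_block_colour by blast
  moreover have "(\<forall>t t'. g ` strip t = strip t' \<longrightarrow> \<kappa> t' = \<kappa> t) \<or>
        (\<forall>t t'. g ` strip t = strip t' \<longrightarrow> \<kappa> t' \<noteq> \<kappa> t)"
    using \<kappa>(1) g(1) unfolding perfect_colouring_def by blast
  then have "\<kappa> t' = \<kappa> t \<longleftrightarrow> \<kappa> s' = \<kappa> s"
    using t s' by blast
  ultimately show ?thesis by simp
qed

section \<open>Neighbouring squares\<close>

text \<open>In normalised coordinates a common point bounds the offset \<open>z\<close> of the
  squares by 1 in each direction. If both parts of \<open>z\<close> are nonzero the point must be a
  corner, hence a lattice point.\<close>

lemma meeting_squares:
  assumes u: "u \<noteq> 0" and s: "s \<in> lattice_points u k" "s' \<in> lattice_points u k"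
    and x: "x \<in> square u s" "x \<in> square u s'" "x \<notin> lattice_points u k"
  shows "s = s' \<or> (\<exists>e \<in> fourth_roots. s' = s + u * e)"
proof -
  obtain z where z: "z \<in> gauss_ints" "s' = s + u * z" using lattice_points_diff[OF s] by metis
  obtain m n :: int where mn: "Re z = of_int m" "Im z = of_int n"
    using z(1) by (auto simp: gauss_ints_def elim!: Ints_cases)
  define y where "y = (x - centre u s) / u"
  have "(x - centre u s') / u = y - z"
    using u by (simp add: y_def z(2) centre_eq field_simps)
  then have y: "y \<in> half_box" "y - z \<in> half_box"
    using x(1,2) unfolding mem_square[OF u] y_def by auto
  have "\<bar>Re z\<bar> \<le> 1" "\<bar>Im z\<bar> \<le> 1"
    using y unfolding half_box_def mem_Collect_eq minus_complex.simps by linarith+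
  then have "\<bar>m\<bar> \<le> 1" "\<bar>n\<bar> \<le> 1" using mn by linarith+
  then have mn': "m \<in> {-1, 0, 1}" "n \<in> {-1, 0, 1}" by auto
  have "m = 0 \<or> n = 0"
  proof (rule ccontr)
    assume "\<not> (m = 0 \<or> n = 0)"
    then have "y \<in> box_corners"
      using y mn mn' by (auto simp: half_box_def box_corners_def abs_le_iff)
    then have "x \<in> corners u s" using mem_corners[OF u] y_def by blast
    then show False using corners_lattice s(1) x(3) by blast
  qed
  then have "z = 0 \<or> z \<in> fourth_roots"
    using mn mn' by (auto simp: fourth_roots_def complex_eq_iff)
  then show ?thesis using z(2) by auto
qed

text \<open>A segment is uncountable while the lattice is countable, so some common point is not a
  lattice point and \<open>meeting_squares\<close> applies. The squares differ because a square does
  not lie on a line.\<close>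

lemma meet_along_side_squares:
  assumes u: "u \<noteq> 0" and s: "s \<in> lattice_points u k" "s' \<in> lattice_points u k"
    and m: "meet_along_side (square u s) (square u s')"
  obtains e where "e \<in> fourth_roots" "s' = s + u * e"
proof -
  obtain p q where pq: "p \<noteq> q" "square u s \<inter> square u s' = closed_segment p q"
    using m by (auto simp: meet_along_side_def)
  have ne: "s \<noteq> s'"
  proof
    assume "s = s'"
    then have "{s + u, s, s + \<i> * u} \<subseteq> closed_segment p q"
      using pq(2) hull_subset[of "corners u s" convex] by (auto simp: square_def corners_def)
    moreover have "collinear (closed_segment p q)" by (rule collinear_closed_segment)
    ultimately have "collinear {s + u, s, s + \<i> * u}" using collinear_subset by blast
    then have "collinear {0, u, \<i> * u}"
      by (simp add: collinear_3)
    then obtain c where "\<i> * u = c *\<^sub>R u"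
      using u by (auto simp: collinear_lemma)
    then have "\<i> = of_real c" using u by (simp add: scaleR_conv_of_real)
    then show False by (simp add: complex_eq_iff)
  qed
  have "lattice_points u k = (\<lambda>(m, n). k + u * (of_int m + of_int n * \<i>)) ` UNIV"
    by (auto simp: lattice_points_def elim!: gauss_intsE)
  then have "countable (lattice_points u k)" by (metis countable_image countableI_type)
  then have "\<not> closed_segment p q \<subseteq> lattice_points u k"
    using pq(1) uncountable_closed_segment countable_subset by blast
  then obtain x where "x \<in> square u s" "x \<in> square u s'" "x \<notin> lattice_points u k"
    using pq(2) by blast
  then show ?thesis using meeting_squares[OF u s] ne that by blast
qed

lemma adjacent_squares_share_corners:
  assumes e: "e \<in> fourth_roots" and u: "u \<noteq> 0"
  obtains x where "x \<in> corners u s" "x \<in> corners u (s + u * e)"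
proof -
  have "centre u s + u * e * (1 + \<i>) / 2 \<in> corners u s"
    "centre u s + u * e * (1 + \<i>) / 2 \<in> corners u (s + u * e)"
    using e u by (auto simp: mem_corners centre_eq box_corners_def fourth_roots_def add_divide_distrib diff_divide_distrib)
  then show ?thesis using that by blast
qed

lemma adjacent_squares_meet:
  assumes e: "e \<in> fourth_roots" and u: "u \<noteq> 0"
  shows "meet_along_side (square u s) (square u (s + u * e))"
proof -
  define c where "c = centre u s"
  define p q where "p = c + u * e * ((1 + \<i>) / 2)" and "q = c + u * e * ((1 - \<i>) / 2)"
  have "p - q = u * e * \<i>" by (simp add: p_def q_def algebra_simps add_divide_distrib diff_divide_distrib)
  then have "p \<noteq> q" using u fourth_roots_nonzero[OF e] by auto
  have "x \<in> square u s \<inter> square u (s + u * e) \<longleftrightarrow> x \<in> closed_segment p q" for x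
  proof -
    define y where "y = (x - c) / (u * e)"
    have x: "x = c + u * e * y" using u fourth_roots_nonzero[OF e] by (simp add: y_def)
    have "x \<in> square u s \<longleftrightarrow> e * y \<in> half_box"
      unfolding mem_square[OF u] using u by (simp add: x c_def)
    also have "\<dots> \<longleftrightarrow> y \<in> half_box" by (rule half_box_rotate[OF e])
    finally have 1: "x \<in> square u s \<longleftrightarrow> y \<in> half_box" .
    have "x \<in> square u (s + u * e) \<longleftrightarrow> e * (y - 1) \<in> half_box"
      unfolding mem_square[OF u] using u by (simp add: x c_def centre_eq algebra_simps diff_divide_distrib add_divide_distrib)
    also have "\<dots> \<longleftrightarrow> y - 1 \<in> half_box" by (rule half_box_rotate[OF e])
    finally have 2: "x \<in> square u (s + u * e) \<longleftrightarrow> y - 1 \<in> half_box" .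
    have "y \<in> half_box \<and> y - 1 \<in> half_box \<longleftrightarrow> Re y = 1 / 2 \<and> \<bar>Im y\<bar> \<le> 1 / 2"
      by (auto simp: half_box_def abs_le_iff)
    also have "\<dots> \<longleftrightarrow> (\<exists>r. 0 \<le> r \<and> r \<le> 1 \<and> y = (1 - r) *\<^sub>R ((1 + \<i>) / 2) + r *\<^sub>R ((1 - \<i>) / 2))"
    proof
      assume "Re y = 1 / 2 \<and> \<bar>Im y\<bar> \<le> 1 / 2"
      then show "\<exists>r. 0 \<le> r \<and> r \<le> 1 \<and> y = (1 - r) *\<^sub>R ((1 + \<i>) / 2) + r *\<^sub>R ((1 - \<i>) / 2)"
        by (intro exI[of _ "1 / 2 - Im y"]) (auto simp: complex_eq_iff abs_le_iff field_simps)
    qed (auto simp: complex_eq_iff abs_le_iff field_simps)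
    also have "\<dots> \<longleftrightarrow> x \<in> closed_segment p q"
    proof -
      have "x = (1 - r) *\<^sub>R p + r *\<^sub>R q \<longleftrightarrow>
          u * e * y = u * e * ((1 - r) *\<^sub>R ((1 + \<i>) / 2) + r *\<^sub>R ((1 - \<i>) / 2))" for r
        by (simp add: x p_def q_def scaleR_conv_of_real algebra_simps)
      then have "x = (1 - r) *\<^sub>R p + r *\<^sub>R q \<longleftrightarrow>
          y = (1 - r) *\<^sub>R ((1 + \<i>) / 2) + r *\<^sub>R ((1 - \<i>) / 2)" for r
        using u fourth_roots_nonzero[OF e] by simp
      then show ?thesis unfolding in_segment by blast
    qed
    finally show ?thesis using 1 2 by blast
  qed
  then have "square u s \<inter> square u (s + u * e) = closed_segment p q" by blast
  then show ?thesis using \<open>p \<noteq> q\<close> unfolding meet_along_side_def by blast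
qed

text \<open>The squares are closed and locally finite, so those missing \<open>z\<close> stay away
  from it. This supplies the neighbourhoods for a connectedness argument along a strand.\<close>

lemma squares_near:
  assumes u: "u \<noteq> 0"
  obtains T where "open T" "z \<in> T"
    "\<And>x s. x \<in> T \<Longrightarrow> s \<in> lattice_points u k \<Longrightarrow> x \<in> square u s \<Longrightarrow> z \<in> square u s"
proof -
  define f where "f x = (x - k) / u" for x
  \<comment> \<open>The open interval between the nearest integers strictly below and strictly above
    \<open>r\<close>: any \<open>[m, m + 1]\<close> that meets it contains \<open>r\<close>.\<close>
  define I where "I r = {\<lceil>r\<rceil> - 1 <..< (of_int \<lfloor>r\<rfloor> + 1 :: real)}" for r :: real
  have near: "of_int m \<le> r \<and> r \<le> of_int m + 1"
    if "r' \<in> I r" "of_int m \<le> r'" "r' \<le> of_int m + 1" for r r' :: real and m :: int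
  proof -
    have "of_int m < (of_int (\<lfloor>r\<rfloor> + 1) :: real)" "of_int (\<lceil>r\<rceil> - 1) < (of_int (m + 1) :: real)"
      using that unfolding I_def by simp_all
    then have "m \<le> \<lfloor>r\<rfloor>" "\<lceil>r\<rceil> \<le> m + 1" unfolding of_int_less_iff by simp_all
    then show ?thesis by linarith
  qed
  define T where "T = (\<lambda>x. Re (f x)) -` I (Re (f z)) \<inter> (\<lambda>x. Im (f x)) -` I (Im (f z))"
  have cont: "continuous_on UNIV (\<lambda>x. Re (f x))" "continuous_on UNIV (\<lambda>x. Im (f x))"
    unfolding f_def using u by (intro continuous_intros; simp)+
  have "open T" unfolding T_def
    by (intro open_Int open_vimage cont) (auto simp: I_def)
  moreover have "z \<in> T" unfolding T_def I_def by simp linarith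
  moreover have "z \<in> square u s" if x: "x \<in> T" "s \<in> lattice_points u k" "x \<in> square u s" for x s
  proof -
    obtain v where v: "v \<in> gauss_ints" "s = k + u * v" using x(2) by (auto simp: lattice_points_def)
    obtain m n :: int where mn: "Re v = of_int m" "Im v = of_int n"
      using v(1) by (auto simp: gauss_ints_def elim!: Ints_cases)
    have c: "(y - centre u s) / u = f y - v - (1 + \<i>) / 2" for y
      using u by (simp add: f_def v(2) centre_eq field_simps)
    have abs: "\<bar>r - of_int l - 1 / 2\<bar> \<le> 1 / 2 \<longleftrightarrow> of_int l \<le> r \<and> r \<le> of_int l + 1" for r :: real and l
      by linarith
    then have *: "y \<in> square u s \<longleftrightarrow> (of_int m \<le> Re (f y) \<and> Re (f y) \<le> of_int m + 1) \<and>
        (of_int n \<le> Im (f y) \<and> Im (f y) \<le> of_int n + 1)" for y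
      using abs[of "Re (f y)" m] abs[of "Im (f y)" n] unfolding mem_square[OF u] c
      by (simp add: half_box_def mn)
    show ?thesis using x(1,3) near unfolding * T_def by blast
  qed
  ultimately show ?thesis using that by blast
qed

lemma squares_cover:
  assumes u: "u \<noteq> 0"
  obtains s where "s \<in> lattice_points u k" "x \<in> square u s"
proof -
  define y where "y = (x - k) / u"
  define v :: complex where "v = of_int \<lfloor>Re y\<rfloor> + of_int \<lfloor>Im y\<rfloor> * \<i>"
  have "v \<in> gauss_ints" by (auto simp: v_def)
  then have "k + u * v \<in> lattice_points u k" by (auto simp: lattice_points_def)
  moreover have "x \<in> square u (k + u * v)"
  proof -
    have c: "(x - centre u (k + u * v)) / u = y - v - (1 + \<i>) / 2"
      using u by (simp add: y_def centre_eq field_simps)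
    have *: "\<bar>r - of_int \<lfloor>r\<rfloor> - 1 / 2\<bar> \<le> 1 / 2" for r :: real by linarith
    have "y - v - (1 + \<i>) / 2 \<in> half_box"
      unfolding half_box_def mem_Collect_eq using *[of "Re y"] *[of "Im y"] by (simp add: v_def)
    then show ?thesis unfolding mem_square[OF u] c .
  qed
  ultimately show ?thesis using that by blast
qed

section \<open>Rotations of the cube\<close>

declare transpose_matrix_vector [simp del]

definition axes :: "(real^3) set" where
  "axes = {axis i r | i r. r = 1 \<or> r = - 1}"

text \<open>Indexed by the outward normal instead of a coordinate and its value, so that rotations
  act on the index.\<close>

definition cube_face :: "real \<Rightarrow> real^3 \<Rightarrow> (real^3) set" where
  "cube_face l n = {x \<in> cube l. x \<bullet> n = l / 2}"

definition cube_vertices :: "real \<Rightarrow> (real^3) set" where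
  "cube_vertices l = {x. \<forall>i. \<bar>x $ i\<bar> = l / 2}"

text \<open>The 24 rotations of a cube, described independently of its size;
  \<open>cube_rotation_iff\<close> makes the connection.\<close>

definition cube_matrices :: "(real^3^3) set" where
  "cube_matrices = {M. rotation_matrix M \<and> (\<forall>i j. M $ i $ j \<in> \<int>)}"

lemma cube_faces_eq: "cube_faces l = cube_face l ` axes"
proof -
  have "cube_face l (axis i 1) = {x \<in> cube l. x $ i = l / 2}" for i
    by (simp add: cube_face_def inner_axis)
  moreover have "cube_face l (axis i (- 1)) = {x \<in> cube l. x $ i = - l / 2}" for i
    by (auto simp: cube_face_def inner_axis)
  moreover have "S \<in> cube_faces l \<longleftrightarrow>
      (\<exists>i. S = {x \<in> cube l. x $ i = l / 2} \<or> S = {x \<in> cube l. x $ i = - l / 2})" for S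
    unfolding cube_faces_def by blast
  moreover have "S \<in> cube_face l ` axes \<longleftrightarrow>
      (\<exists>i. S = cube_face l (axis i 1) \<or> S = cube_face l (axis i (- 1)))" for S
    unfolding axes_def by blast
  ultimately show ?thesis by (simp add: set_eq_iff)
qed

lemma axes_norm: "n \<in> axes \<Longrightarrow> n \<bullet> n = 1"
  by (auto simp: axes_def inner_axis)

lemma axes_inner: "n \<in> axes \<Longrightarrow> m \<in> axes \<Longrightarrow> n = m \<or> n = - m \<or> n \<bullet> m = 0"
  by (auto simp: axes_def inner_axis_axis axis_eq_axis) (auto simp: axis_def vec_eq_iff)

lemma axes_in_face:
  assumes "n \<in> axes" "l \<ge> 0"
  shows "(l / 2) *\<^sub>R n \<in> cube_face l n"
  using assms axes_norm[OF assms(1)] by (auto simp: cube_face_def cube_def axes_def axis_def)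

lemma cube_face_inject:
  assumes "n \<in> axes" "m \<in> axes" "l > 0" "cube_face l n = cube_face l m"
  shows "n = m"
proof -
  have "(l / 2) *\<^sub>R n \<in> cube_face l m" using axes_in_face[of n l] assms by auto
  then have "n \<bullet> m = 1" using assms(3) by (simp add: cube_face_def)
  then show ?thesis
    using axes_inner[OF assms(1,2)] axes_norm[OF assms(2)] by auto
qed

section \<open>Integer rotation matrices as signed permutations\<close>

lemma prod_UNIV_3: "prod f (UNIV :: 3 set) = f 1 * f 2 * f 3"
  unfolding UNIV_3 by (simp add: ac_simps)

lemma integer_unit_vector:
  fixes v :: "real^3"
  assumes "norm v = 1" "\<And>i. v $ i \<in> \<int>"
  shows "v \<in> axes"
proof -
  have s: "(v $ 1)\<^sup>2 + (v $ 2)\<^sup>2 + (v $ 3)\<^sup>2 = 1"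
    using assms(1) by (simp add: norm_eq_1 inner_vec_def sum_3 power2_eq_square)
  have "1 \<le> (v $ i)\<^sup>2" if ni: "v $ i \<noteq> 0" for i
  proof -
    have "\<bar>v $ i\<bar> \<ge> 1" using Ints_nonzero_abs_ge1[OF assms(2) ni] .
    then have "1 ^ 2 \<le> \<bar>v $ i\<bar> ^ 2" by (intro power_mono) auto
    then show ?thesis by simp
  qed
  moreover have "(v $ i)\<^sup>2 \<ge> 0" for i by simp
  ultimately have z: "v $ i = 0 \<or> (v $ i)\<^sup>2 \<ge> 1" "(v $ i)\<^sup>2 \<ge> 0" for i by blast+
  have 2: "x\<^sup>2 = 1 \<longleftrightarrow> x = 1 \<or> x = -1" for x :: real by (rule power2_eq_1_iff)
  consider "v $ 1 \<noteq> 0" "(v $ 1)\<^sup>2 = 1" "v $ 2 = 0" "v $ 3 = 0" | "v $ 2 \<noteq> 0" "(v $ 2)\<^sup>2 = 1" "v $ 1 = 0" "v $ 3 = 0"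
    | "v $ 3 \<noteq> 0" "(v $ 3)\<^sup>2 = 1" "v $ 1 = 0" "v $ 2 = 0"
    using s z[of 1] z[of 2] z[of 3] by fastforce
  then obtain i where i: "(v $ i)\<^sup>2 = 1" "\<And>j. j \<noteq> i \<Longrightarrow> v $ j = 0"
    by (cases; metis exhaust_3)
  have "v = axis i (v $ i)"
    using i(2) by (auto simp: vec_eq_iff axis_def)
  then show ?thesis using i(1) unfolding 2 axes_def by blast
qed

text \<open>Each row is an integer unit vector, hence a signed axis, and orthogonality keeps
  different rows on different axes.\<close>

lemma cube_matrix_signed_permutation:
  assumes "M \<in> cube_matrices"
  obtains \<pi> c where "bij \<pi>" "\<And>i. c i = 1 \<or> c i = (- 1 :: real)"
    "\<And>y i. (M *v y) $ i = c i * y $ \<pi> i"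
proof -
  have o: "orthogonal_matrix M" and z: "\<And>i j. M $ i $ j \<in> \<int>"
    using assms by (auto simp: cube_matrices_def rotation_matrix_def)
  have r: "norm (M $ i) = 1" "i \<noteq> j \<Longrightarrow> M $ i \<bullet> M $ j = 0" for i j
    using o unfolding orthogonal_matrix_orthonormal_rows by (auto simp: row_def orthogonal_def)
  have "\<exists>j r. (r = 1 \<or> r = - 1) \<and> M $ i = axis j r" for i
    using integer_unit_vector[OF r(1) z, of i] unfolding axes_def by auto
  then obtain \<pi> c where p: "\<And>i. c i = 1 \<or> c i = (- 1 :: real)" "\<And>i. M $ i = axis (\<pi> i) (c i)"
    by metis
  have "inj \<pi>"
  proof (rule injI, rule ccontr)
    fix i j assume "\<pi> i = \<pi> j" "i \<noteq> j"
    then show False using r(2)[of i j] p(1)[of i] p(1)[of j] by (auto simp: p(2) inner_axis_axis)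
  qed
  then have "bij \<pi>" by (simp add: finite_UNIV_inj_surj bij_def)
  moreover have "(M *v y) $ i = c i * y $ \<pi> i" for y i
    by (simp add: matrix_vector_mul_component p(2) inner_axis')
  ultimately show ?thesis using that p(1) by blast
qed

lemma cube_matrix_abs:
  assumes "M \<in> cube_matrices"
  shows "\<exists>\<pi>. \<forall>y i. \<bar>(M *v y) $ i\<bar> = \<bar>y $ \<pi> i\<bar>"
proof -
  obtain \<pi> c where p: "\<And>i. c i = 1 \<or> c i = (- 1 :: real)" "\<And>y i. (M *v y) $ i = c i * y $ \<pi> i"
    using cube_matrix_signed_permutation[OF assms] by metis
  have "\<bar>(M *v y) $ i\<bar> = \<bar>y $ \<pi> i\<bar>" for y i
    using p(1)[of i] by (auto simp: p(2))
  then show ?thesis by blast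
qed

lemma cube_matrices_mult:
  assumes "M \<in> cube_matrices" "N \<in> cube_matrices"
  shows "M ** N \<in> cube_matrices"
proof -
  have "rotation_matrix (M ** N)"
    using assms by (auto simp: cube_matrices_def rotation_matrix_def orthogonal_matrix_mul det_mul)
  moreover have "(M ** N) $ i $ j \<in> \<int>" for i j
    using assms by (auto simp: cube_matrices_def matrix_matrix_mult_def sum_3)
  ultimately show ?thesis by (simp add: cube_matrices_def)
qed

lemma cube_matrices_transpose: "M \<in> cube_matrices \<Longrightarrow> transpose M \<in> cube_matrices"
  by (auto simp: cube_matrices_def rotation_matrix_def det_transpose) (simp add: transpose_def)

lemma cube_matrix_transpose:
  assumes "M \<in> cube_matrices"
  shows "transpose M *v (M *v x) = x" "M *v (transpose M *v x) = x"
  using assms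
  by (simp_all add: cube_matrices_def rotation_matrix_def orthogonal_matrix_def matrix_vector_mul_assoc)

lemma cube_matrix_mult_transpose:
  assumes "M \<in> cube_matrices"
  shows "M ** transpose M = mat 1" "transpose M ** M = mat 1"
  using assms by (simp_all add: cube_matrices_def rotation_matrix_def orthogonal_matrix_def)

lemma cube_matrix_inner:
  assumes "M \<in> cube_matrices"
  shows "(M *v x) \<bullet> (M *v y) = x \<bullet> y"
  using cube_matrix_transpose(1)[OF assms, of x]
  by (simp add: dot_lmul_matrix[symmetric] transpose_matrix_vector)

lemma cube_matrix_cube:
  assumes "M \<in> cube_matrices"
  shows "M *v x \<in> cube l \<longleftrightarrow> x \<in> cube l"
proof -
  have *: "M *v x \<in> cube l" if x: "x \<in> cube l" and M: "M \<in> cube_matrices" for M x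
  proof -
    obtain \<pi> where "\<forall>y i. \<bar>(M *v y) $ i\<bar> = \<bar>y $ \<pi> i\<bar>"
      using cube_matrix_abs[OF M] by blast
    then show ?thesis using x by (simp add: cube_def)
  qed
  show ?thesis
    using *[OF _ assms] *[OF _ cube_matrices_transpose[OF assms], of "M *v x"] cube_matrix_transpose[OF assms]
    by auto
qed

lemma image_eq_by_inverse:
  assumes "\<And>y. g (h y) = y" "\<And>x. g x \<in> T \<longleftrightarrow> x \<in> S"
  shows "g ` S = T"
proof
  show "g ` S \<subseteq> T" using assms(2) by blast
  show "T \<subseteq> g ` S"
  proof
    fix y assume "y \<in> T"
    then have "h y \<in> S" using assms(1)[of y] assms(2)[of "h y"] by simp
    then show "y \<in> g ` S" using assms(1)[of y] by (intro image_eqI[of _ _ "h y"]) simp_all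
  qed
qed

lemma cube_matrix_face:
  assumes "M \<in> cube_matrices"
  shows "(\<lambda>x. M *v x) ` cube_face l n = cube_face l (M *v n)"
  by (rule image_eq_by_inverse[where h = "\<lambda>x. transpose M *v x"])
    (simp_all add: cube_face_def cube_matrix_cube cube_matrix_inner cube_matrix_transpose assms)

lemma cube_matrix_axes:
  assumes "M \<in> cube_matrices" "n \<in> axes"
  shows "M *v n \<in> axes"
proof (rule integer_unit_vector)
  show "norm (M *v n) = 1"
    using assms by (simp add: norm_eq_1 cube_matrix_inner axes_norm)
  obtain \<pi> c where p: "\<And>i. c i = 1 \<or> c i = (- 1 :: real)" "\<And>y i. (M *v y) $ i = c i * y $ \<pi> i"
    using cube_matrix_signed_permutation[OF assms(1)] by metis
  show "(M *v n) $ i \<in> \<int>" for i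
  proof -
    have "c i \<in> \<int>" using p(1)[of i] by auto
    moreover have "n $ \<pi> i \<in> \<int>" using assms(2) by (auto simp: axes_def axis_def)
    ultimately show ?thesis by (simp add: p(2))
  qed
qed

text \<open>Permuting the coordinates leaves their product alone, so only the product of the signs
  remains. The rotations with \<open>t = - 1\<close> are those exchanging the two inscribed
  tetrahedra, that is, the two classes of vertices.\<close>

lemma cube_matrix_prod:
  assumes "M \<in> cube_matrices"
  obtains t where "t = 1 \<or> t = (- 1 :: real)" "\<And>y. (\<Prod>i\<in>UNIV. (M *v y) $ i) = t * (\<Prod>i\<in>UNIV. y $ i)"
proof -
  obtain \<pi> c where p: "bij \<pi>" "\<And>i. c i = 1 \<or> c i = (- 1 :: real)" "\<And>y i. (M *v y) $ i = c i * y $ \<pi> i"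
    using cube_matrix_signed_permutation[OF assms(1)] by metis
  have "(\<Prod>i\<in>UNIV. (M *v y) $ i) = (\<Prod>i\<in>UNIV. c i) * (\<Prod>i\<in>UNIV. y $ i)" for y
    unfolding p(3) prod.distrib using prod.reindex_bij_betw[OF p(1), of "\<lambda>i. y $ i"] by simp
  moreover have "\<bar>\<Prod>i\<in>UNIV. c i\<bar> = 1"
  proof -
    have "\<bar>c i\<bar> = 1" for i using p(2)[of i] by auto
    then show ?thesis by (simp add: abs_prod)
  qed
  then have "(\<Prod>i\<in>UNIV. c i) = 1 \<or> (\<Prod>i\<in>UNIV. c i) = - 1" by linarith
  ultimately show ?thesis using that by blast
qed

lemma cube_matrix_vertices:
  assumes "M \<in> cube_matrices"
  shows "M *v x \<in> cube_vertices l \<longleftrightarrow> x \<in> cube_vertices l"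
proof -
  have *: "M *v x \<in> cube_vertices l" if x: "x \<in> cube_vertices l" and M: "M \<in> cube_matrices" for M x
  proof -
    obtain \<pi> where "\<forall>y i. \<bar>(M *v y) $ i\<bar> = \<bar>y $ \<pi> i\<bar>"
      using cube_matrix_abs[OF M] by blast
    then show ?thesis using x by (simp add: cube_vertices_def)
  qed
  show ?thesis
    using *[OF _ assms] *[OF _ cube_matrices_transpose[OF assms], of "M *v x"] cube_matrix_transpose[OF assms]
    by auto
qed

lemma difference_of_halves:
  fixes x y l :: real
  assumes "\<bar>x\<bar> = l / 2" "\<bar>y\<bar> = l / 2" "l > 0"
  shows "(x - y) / l \<in> \<int>"
proof -
  have "x - y = 0 \<or> x - y = l \<or> x - y = - l" using assms by linarith
  then show ?thesis using assms(3) by auto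
qed

text \<open>Vertices are the points of the cube farthest from its centre, so a rotation preserving
  the cube sends vertices to vertices. Each column of the matrix is a difference of two such images
  divided by \<open>l\<close>, hence integral.\<close>

lemma cube_rotation_iff:
  assumes "l > 0"
  shows "cube_rotation l M \<longleftrightarrow> M \<in> cube_matrices"
proof
  assume "M \<in> cube_matrices"
  moreover from this have "(\<lambda>x. M *v x) ` cube l = cube l"
    by (intro image_eq_by_inverse[where h = "\<lambda>x. transpose M *v x"])
      (simp_all add: cube_matrix_cube cube_matrix_transpose)
  ultimately show "cube_rotation l M"
    by (simp add: cube_rotation_def cube_matrices_def)
next
  assume c: "cube_rotation l M"
  then have o: "orthogonal_matrix M" and mc: "x \<in> cube l \<Longrightarrow> M *v x \<in> cube l" for x
    by (auto simp: cube_rotation_def rotation_matrix_def)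
  have inner: "(M *v x) \<bullet> (M *v y) = x \<bullet> y" for x y
    using o unfolding orthogonal_matrix_def
    by (simp add: dot_lmul_matrix[symmetric] transpose_matrix_vector[symmetric] matrix_vector_mul_assoc)
  have vertex: "\<bar>(M *v x) $ i\<bar> = l / 2" if x: "x \<in> cube_vertices l" for x i
  proof -
    have sq: "(y $ j)\<^sup>2 \<le> (l / 2)\<^sup>2" if "y \<in> cube l" for y j
      using that assms by (simp add: cube_def abs_le_square_iff[symmetric])
    have "x \<in> cube l" using x by (auto simp: cube_def cube_vertices_def)
    then have 1: "((M *v x) $ j)\<^sup>2 \<le> (l / 2)\<^sup>2" for j by (intro sq mc)
    have 2: "(x $ j)\<^sup>2 = (l / 2)\<^sup>2" for j
      using x by (metis (mono_tags, lifting) cube_vertices_def mem_Collect_eq power2_abs)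
    have 3: "y \<bullet> y = (y $ 1)\<^sup>2 + (y $ 2)\<^sup>2 + (y $ 3)\<^sup>2" for y :: "real^3"
      by (simp add: inner_vec_def sum_3 power2_eq_square)
    \<comment> \<open>Each of the three squares is at most \<open>l / 2\<close> squared and together
      they reach the maximum, so each attains it.\<close>
    have "((M *v x) $ 1)\<^sup>2 + ((M *v x) $ 2)\<^sup>2 + ((M *v x) $ 3)\<^sup>2 = (l / 2)\<^sup>2 + (l / 2)\<^sup>2 + (l / 2)\<^sup>2"
      using inner[of x x] unfolding 3 2 .
    then have "((M *v x) $ 1)\<^sup>2 = (l / 2)\<^sup>2" "((M *v x) $ 2)\<^sup>2 = (l / 2)\<^sup>2" "((M *v x) $ 3)\<^sup>2 = (l / 2)\<^sup>2"
      using 1[of 1] 1[of 2] 1[of 3] by linarith+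
    then have "((M *v x) $ i)\<^sup>2 = (l / 2)\<^sup>2" by (metis exhaust_3)
    then have "(M *v x) $ i = l / 2 \<or> (M *v x) $ i = - (l / 2)" by (simp only: power2_eq_iff)
    then show ?thesis using assms by auto
  qed
  have "M $ i $ j \<in> \<int>" for i j
  proof -
    define x y :: "real^3" where "x = (\<chi> k. l / 2)" and "y = (\<chi> k. if k = j then - l / 2 else l / 2)"
    have v: "x \<in> cube_vertices l" "y \<in> cube_vertices l"
      using assms by (auto simp: cube_vertices_def x_def y_def)
    have "axis j l = x - y" by (auto simp: vec_eq_iff axis_def x_def y_def)
    then have "M *v axis j l = M *v x - M *v y" by (simp add: matrix_vector_mult_diff_distrib)
    moreover have "(M *v axis j l) $ i = M $ i $ j * l"
      by (simp add: matrix_vector_mul_component inner_axis)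
    ultimately have "M $ i $ j * l = (M *v x) $ i - (M *v y) $ i" by simp
    then have "M $ i $ j = ((M *v x) $ i - (M *v y) $ i) / l" using assms by (simp add: field_simps)
    then show ?thesis using difference_of_halves vertex v assms by simp
  qed
  then show "M \<in> cube_matrices" using c by (simp add: cube_rotation_def cube_matrices_def)
qed

text \<open>The net square with centre \<open>c\<close> and side \<open>u\<close>, scaled by \<open>x \<mapsto> (x - c) / u\<close>, is placed on the
  upper face of the cube with edge \<open>l\<close>.\<close>

definition top_face :: "real \<Rightarrow> complex \<Rightarrow> real^3" where
  "top_face l z = vector [l * Re z, l * Im z, l / 2]"

definition up :: "real^3" where
  "up = axis 3 1"

text \<open>Multiplication by \<open>w\<close> on the two horizontal coordinates: for a unit
  \<open>w\<close>, the turn of the upper face about its centre.\<close>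

definition spin :: "complex \<Rightarrow> real^3^3" where
  "spin w = vector [vector [Re w, - Im w, 0], vector [Im w, Re w, 0], vector [0, 0, 1]]"

text \<open>\<open>tilt e\<close> turns the upper face down about its edge in the direction \<open>e\<close>, that is, onto the
  face with outward normal \<open>e\<close>.\<close>

definition tilt :: "complex \<Rightarrow> real^3^3" where
  "tilt e = spin e ** vector [vector [0, 0, 1], vector [0, 1, 0], vector [- 1, 0, 0]] ** spin (cnj e)"

lemma up_axes [simp]: "up \<in> axes"
  by (auto simp: up_def axes_def)

lemma inner_up: "x \<bullet> up = x $ 3"
  by (simp add: up_def inner_axis)

lemma up_component: "up $ 1 = 0" "up $ 2 = 0" "up $ 3 = 1"
  by (simp_all add: up_def axis_def)

lemma top_face_image:
  assumes "l > 0"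
  shows "top_face l ` half_box = cube_face l up"
proof
  show "top_face l ` half_box \<subseteq> cube_face l up"
    using assms by (auto simp: half_box_def cube_face_def cube_def top_face_def inner_up forall_3 abs_mult)
  show "cube_face l up \<subseteq> top_face l ` half_box"
  proof
    fix x assume x: "x \<in> cube_face l up"
    have "\<bar>x $ 1\<bar> \<le> l / 2" "\<bar>x $ 2\<bar> \<le> l / 2" "x $ 3 = l / 2"
      using x by (auto simp: cube_face_def cube_def inner_up)
    then have "x = top_face l (Complex (x $ 1 / l) (x $ 2 / l))" "Complex (x $ 1 / l) (x $ 2 / l) \<in> half_box"
      using assms by (auto simp: top_face_def vec_eq_iff forall_3 half_box_def field_simps)
    then show "x \<in> top_face l ` half_box" by blast
  qed
qed

lemma inj_top_face: "l > 0 \<Longrightarrow> top_face l z = top_face l z' \<longleftrightarrow> z = z'"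
  by (auto simp: top_face_def vec_eq_iff forall_3 complex_eq_iff)

lemma dist_top_face:
  assumes "l > 0"
  shows "dist (top_face l z) (top_face l z') = l * dist z z'"
proof -
  have "(dist (top_face l z) (top_face l z'))\<^sup>2 = (l * dist z z')\<^sup>2"
    unfolding dist_norm power_mult_distrib cmod_power2 power2_norm_eq_inner
    by (simp add: inner_vec_def sum_3 top_face_def power2_eq_square algebra_simps)
  then show ?thesis using assms by (simp add: power2_eq_iff_nonneg)
qed

lemma top_face_vertex:
  assumes "l > 0"
  shows "top_face l z \<in> cube_vertices l \<longleftrightarrow> z \<in> box_corners"
  using assms by (auto simp: top_face_def cube_vertices_def box_corners_def forall_3 abs_mult)

lemma matrix_vector_3:
  fixes M :: "real^3^3"
  shows "(M *v x) $ i = M $ i $ 1 * x $ 1 + M $ i $ 2 * x $ 2 + M $ i $ 3 * x $ 3"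
  by (simp add: matrix_vector_mult_def sum_3)

lemma spin_cube_matrices:
  assumes "w \<in> fourth_roots"
  shows "spin w \<in> cube_matrices"
proof -
  have "(Re w)\<^sup>2 + (Im w)\<^sup>2 = 1" using assms by (auto simp: fourth_roots_def)
  moreover have "Re w \<in> \<int>" "Im w \<in> \<int>" using assms by (auto simp: fourth_roots_def)
  ultimately show ?thesis
    by (auto simp: cube_matrices_def rotation_matrix_def orthogonal_matrix spin_def det_3 forall_3
        vec_eq_iff matrix_matrix_mult_def transpose_def mat_def sum_3 power2_eq_square algebra_simps)
qed

lemma tilt_cube_matrices:
  assumes "e \<in> fourth_roots"
  shows "tilt e \<in> cube_matrices"
proof -
  have "vector [vector [0, 0, 1], vector [0, 1, 0], vector [- 1, 0, 0]] \<in> cube_matrices"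
    by (auto simp: cube_matrices_def rotation_matrix_def orthogonal_matrix det_3 forall_3
        vec_eq_iff matrix_matrix_mult_def transpose_def mat_def sum_3)
  then show ?thesis
    unfolding tilt_def using assms fourth_roots_cnj spin_cube_matrices by (intro cube_matrices_mult) auto
qed

lemma spin_top_face: "spin w *v top_face l z = top_face l (w * z)"
  by (simp add: vec_eq_iff forall_3 matrix_vector_3 spin_def top_face_def algebra_simps)

lemma spin_up: "spin w *v up = up"
  by (simp add: vec_eq_iff forall_3 matrix_vector_3 spin_def up_component)

lemma tilt_up: "tilt e *v up = vector [Re e, Im e, 0]"
  unfolding tilt_def matrix_vector_mul_assoc[symmetric] spin_up
  by (simp add: vec_eq_iff forall_3 matrix_vector_3 spin_def up_component)

lemma tilt_height: "(tilt e *v top_face l z) $ 3 = - l * Re (cnj e * z)"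
  unfolding tilt_def matrix_vector_mul_assoc[symmetric] spin_top_face
  by (simp add: matrix_vector_3 spin_def top_face_def algebra_simps)

text \<open>The tilted copy of the upper face is at height \<open>l / 2\<close> only along the edge
  it shares with the original, and there the point with coordinate \<open>z\<close> in the copy has
  coordinate \<open>z + e\<close> in the original. Crossing an edge is thus a shift by one square in
  the plane.\<close>

lemma tilt_edge:
  assumes "e \<in> fourth_roots" "l > 0" "(tilt e *v top_face l z) $ 3 = l / 2"
  shows "tilt e *v top_face l z = top_face l (z + e)"
proof -
  have "l * (Re (cnj e * z) + 1 / 2) = 0"
    using assms(3) unfolding tilt_height by (simp add: algebra_simps)
  then have "Re (cnj e * z) = - 1 / 2" using assms(2) by simp
  then show ?thesis
    using assms(1,2) unfolding tilt_def matrix_vector_mul_assoc[symmetric] spin_top_face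
    by (auto simp: vec_eq_iff forall_3 matrix_vector_3 spin_def top_face_def fourth_roots_def algebra_simps)
qed

lemma stabilizer_of_up:
  assumes M: "M \<in> cube_matrices" "M *v up = up"
  obtains w where "w \<in> fourth_roots" "M = spin w"
proof -
  have o: "orthogonal_matrix M" "det M = 1" and z: "\<And>i j. M $ i $ j \<in> \<int>"
    using M(1) by (auto simp: cube_matrices_def rotation_matrix_def)
  have c: "M $ 1 $ 3 = 0" "M $ 2 $ 3 = 0" "M $ 3 $ 3 = 1"
    using M(2) by (simp_all add: vec_eq_iff forall_3 matrix_vector_3 up_component)
  have r: "norm (M $ i) = 1" for i
    using o(1) unfolding orthogonal_matrix_orthonormal_rows by (auto simp: row_def)
  have s: "(M $ i $ 1)\<^sup>2 + (M $ i $ 2)\<^sup>2 + (M $ i $ 3)\<^sup>2 = 1" for i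
    using r[of i] by (simp add: norm_eq_1 inner_vec_def sum_3 power2_eq_square)
  have r3: "M $ 3 $ 1 = 0" "M $ 3 $ 2 = 0"
    using s[of 3] c by (simp_all add: sum_power2_eq_zero_iff)
  have d: "M $ 1 $ 1 * M $ 2 $ 2 - M $ 1 $ 2 * M $ 2 $ 1 = 1"
    using o(2) by (simp add: det_3 c r3)
  \<comment> \<open>The two unit rows contribute 2 and the determinant takes 2 away; the block is
    then multiplication by a complex number.\<close>
  have "(M $ 1 $ 1 - M $ 2 $ 2)\<^sup>2 + (M $ 1 $ 2 + M $ 2 $ 1)\<^sup>2 = 0"
    using s[of 1] s[of 2] d c by (simp add: power2_eq_square algebra_simps)
  then have e: "M $ 2 $ 2 = M $ 1 $ 1" "M $ 1 $ 2 = - M $ 2 $ 1"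
    by (simp_all add: sum_power2_eq_zero_iff)
  define w where "w = Complex (M $ 1 $ 1) (M $ 2 $ 1)"
  have "M = spin w"
    by (simp add: vec_eq_iff forall_3 spin_def w_def c r3 e)
  moreover have "w \<in> fourth_roots"
  proof (rule fourth_rootsI)
    show "w \<in> gauss_ints" by (simp add: gauss_ints_def w_def z)
    show "norm w = 1" using s[of 1] by (simp add: cmod_def w_def c e)
  qed
  ultimately show ?thesis using that by blast
qed

text \<open>Pulled back by \<open>M\<close> the axis is horizontal, and the horizontal axes are the
  four directions \<open>e\<close>. This finds the side along which two adjacent faces meet.\<close>

lemma perpendicular_axis:
  assumes "M \<in> cube_matrices" "n \<in> axes" "n \<bullet> (M *v up) = 0"
  obtains e where "e \<in> fourth_roots" "M *v (tilt e *v up) = n"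
proof -
  define m where "m = transpose M *v n"
  have m: "m \<in> axes" unfolding m_def using assms cube_matrix_axes cube_matrices_transpose by blast
  have n: "n = M *v m" unfolding m_def using cube_matrix_transpose assms by simp
  have "m $ 3 = 0" using assms cube_matrix_inner[OF assms(1), of m up] by (simp add: n inner_up)
  moreover define e where "e = Complex (m $ 1) (m $ 2)"
  ultimately have "m = tilt e *v up" by (simp add: tilt_up vec_eq_iff forall_3 e_def)
  moreover have "e \<in> fourth_roots"
  proof -
    obtain i r where "r = 1 \<or> r = (- 1 :: real)" "m = axis i r"
      using m by (auto simp: axes_def)
    then show ?thesis
      using exhaust_3[of i] \<open>m $ 3 = 0\<close>
      by (auto simp: e_def axis_def fourth_roots_def complex_eq_iff)
  qed
  ultimately show ?thesis using that n by blast
qed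

lemma faces_meet_along_side:
  assumes "M \<in> cube_matrices" "e \<in> fourth_roots" "l > 0"
  shows "meet_along_side (cube_face l (M *v up)) (cube_face l (M *v (tilt e *v up)))"
proof -
  define p q where "p = top_face l (e * Complex (1/2) (1/2))" and "q = top_face l (e * Complex (1/2) (-1/2))"
  have "cube_face l up \<inter> cube_face l (tilt e *v up) = closed_segment p q"
  proof -
    have 1: "x \<in> cube_face l up \<inter> cube_face l (tilt e *v up) \<longleftrightarrow>
        (\<exists>r. x = top_face l (e * Complex (1/2) r) \<and> \<bar>r\<bar> \<le> 1 / 2)" for x
    proof
      assume "\<exists>r. x = top_face l (e * Complex (1/2) r) \<and> \<bar>r\<bar> \<le> 1 / 2"
      then show "x \<in> cube_face l up \<inter> cube_face l (tilt e *v up)"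
        using assms(2,3) by (auto simp: cube_face_def cube_def top_face_def tilt_up inner_vec_def sum_3 forall_3
            up_component fourth_roots_def abs_mult)
    next
      assume x: "x \<in> cube_face l up \<inter> cube_face l (tilt e *v up)"
      then have "x \<in> top_face l ` half_box" using top_face_image[OF assms(3)] by blast
      then obtain z where z: "z \<in> half_box" "x = top_face l z" by blast
      define y where "y = cnj e * z"
      have ze: "z = e * y" "y \<in> half_box"
        using assms(2) z(1) by (auto simp: y_def fourth_roots_def half_box_def)
      have "Re y = 1 / 2"
        using x assms(2,3) by (auto simp: z(2) ze(1) cube_face_def top_face_def tilt_up inner_vec_def sum_3 fourth_roots_def)
      then have "y = Complex (1/2) (Im y)" by (simp add: complex_eq_iff)
      then show "\<exists>r. x = top_face l (e * Complex (1/2) r) \<and> \<bar>r\<bar> \<le> 1 / 2"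
        using ze z(2) by (metis (mono_tags, lifting) half_box_def mem_Collect_eq)
    qed
    have 2: "x \<in> closed_segment p q \<longleftrightarrow>
        (\<exists>r. x = top_face l (e * Complex (1/2) r) \<and> \<bar>r\<bar> \<le> 1 / 2)" for x
    proof -
      have *: "(1 - t) *\<^sub>R p + t *\<^sub>R q = top_face l (e * Complex (1/2) (1/2 - t))" for t
        by (simp add: p_def q_def top_face_def vec_eq_iff forall_3 algebra_simps)
      show ?thesis
      proof
        assume "x \<in> closed_segment p q"
        then obtain t where "0 \<le> t" "t \<le> 1" "x = (1 - t) *\<^sub>R p + t *\<^sub>R q"
          by (auto simp: in_segment)
        then show "\<exists>r. x = top_face l (e * Complex (1/2) r) \<and> \<bar>r\<bar> \<le> 1 / 2"
          unfolding * by (intro exI[of _ "1/2 - t"] conjI) (simp, linarith)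
      next
        assume "\<exists>r. x = top_face l (e * Complex (1/2) r) \<and> \<bar>r\<bar> \<le> 1 / 2"
        then obtain r where "x = top_face l (e * Complex (1/2) r)" "\<bar>r\<bar> \<le> 1 / 2" by blast
        then show "x \<in> closed_segment p q"
          using *[of "1/2 - r"] unfolding in_segment by (intro exI[of _ "1/2 - r"] conjI) (linarith, linarith, simp)
      qed
    qed
    show ?thesis using 1 2 by blast
  qed
  moreover have "inj (\<lambda>x. M *v x)" using cube_matrix_transpose(1)[OF assms(1)] by (metis injI)
  ultimately have "cube_face l (M *v up) \<inter> cube_face l (M *v (tilt e *v up)) = (\<lambda>x. M *v x) ` closed_segment p q"
    unfolding cube_matrix_face[OF assms(1), symmetric] using image_Int by metis
  also have "\<dots> = closed_segment (M *v p) (M *v q)"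
    by (simp add: closed_segment_linear_image matrix_vector_mul_linear)
  finally have i: "cube_face l (M *v up) \<inter> cube_face l (M *v (tilt e *v up)) = closed_segment (M *v p) (M *v q)" .
  have "p \<noteq> q"
    using assms(2,3) unfolding p_def q_def inj_top_face[OF assms(3)] by (auto simp: fourth_roots_def complex_eq_iff)
  then have "M *v p \<noteq> M *v q" using cube_matrix_transpose(1)[OF assms(1)] by metis
  then show ?thesis using i unfolding meet_along_side_def by blast
qed

section \<open>Folding a square onto a face of the cube\<close>

text \<open>The normal form to which \<open>fold_onto_face\<close> brings every fold map, and the
  form in which the explicit net is folded.\<close>

definition placed :: "complex \<Rightarrow> real^3^3 \<Rightarrow> complex \<Rightarrow> complex \<Rightarrow> real^3" where
  "placed u M s x = M *v top_face (norm u) ((x - centre u s) / u)"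

lemma placed_face:
  assumes u: "u \<noteq> 0" and M: "M \<in> cube_matrices"
  shows "placed u M s ` square u s = cube_face (norm u) (M *v up)"
proof -
  have "(\<lambda>x. (x - centre u s) / u) ` square u s = half_box"
    by (rule image_eq_by_inverse[where h = "\<lambda>y. centre u s + u * y"]) (simp_all only: mem_square[OF u], simp add: u)
  moreover have "placed u M s ` square u s =
      (\<lambda>x. M *v x) ` top_face (norm u) ` (\<lambda>x. (x - centre u s) / u) ` square u s"
    by (simp add: placed_def image_image)
  ultimately show ?thesis
    using top_face_image[of "norm u"] u by (simp add: cube_matrix_face[OF M])
qed

text \<open>Distances determine inner products by polarisation, and the defect of linearity then has
  length 0. The fold maps of a net are given as isometries only, so their affine form has to be
  derived.\<close>

lemma isometry_plane_affine:
  fixes f :: "complex \<Rightarrow> real^3"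
  assumes "\<And>x y. dist (f x) (f y) = dist x y"
  shows "f x = f 0 + Re x *\<^sub>R (f 1 - f 0) + Im x *\<^sub>R (f \<i> - f 0)"
proof -
  define g where "g x = f x - f 0" for x
  have "dist (g x) (g y) = dist x y" for x y using assms by (simp add: g_def dist_norm)
  then have "norm (g x - g y) = norm (x - y)" "norm (g x) = norm x" for x y
    using assms[of x 0] by (simp_all add: dist_norm g_def)
  then have i: "g x \<bullet> g y = x \<bullet> y" for x y
    by (simp add: dot_norm_neg)
  have i': "g x \<bullet> g y = Re x * Re y + Im x * Im y" for x y
    by (simp add: i inner_complex_def)
  define d where "d = g x - Re x *\<^sub>R g 1 - Im x *\<^sub>R g \<i>"
  have "d \<bullet> d = 0"
    unfolding d_def inner_diff_left inner_diff_right inner_scaleR_left inner_scaleR_right i'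
    by (simp add: algebra_simps)
  then have "d = 0" by simp
  then show ?thesis by (simp add: d_def g_def algebra_simps)
qed

text \<open>A diagonal of a square of side \<open>l\<close> only fits into a face of the cube as a diagonal of that face.\<close>

lemma opposite_corners:
  fixes P Q :: "real^3"
  assumes l: "l > 0" and h: "\<bar>h\<bar> = l / 2"
    and P: "P \<in> cube l" "P $ i = h" and Q: "Q \<in> cube l" "Q $ i = h"
    and d: "(P - Q) \<bullet> (P - Q) = 2 * l\<^sup>2"
  shows "P \<in> cube_vertices l" "P + Q = axis i (2 * h)"
proof -
  have b: "\<bar>P $ j\<bar> \<le> l / 2" "\<bar>Q $ j\<bar> \<le> l / 2" for j using P Q by (auto simp: cube_def)
  then have "\<bar>P $ j - Q $ j\<bar> \<le> l" for j using b[of j] by linarith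
  then have sq: "(P $ j - Q $ j)\<^sup>2 \<le> l\<^sup>2" for j
    using l by (metis abs_le_square_iff abs_of_pos)
  have s: "(P $ 1 - Q $ 1)\<^sup>2 + (P $ 2 - Q $ 2)\<^sup>2 + (P $ 3 - Q $ 3)\<^sup>2 = 2 * l\<^sup>2"
    using d by (simp add: inner_vec_def sum_3 power2_eq_square)
  have z: "(P $ i - Q $ i)\<^sup>2 = 0" using P Q by simp
  have eq: "(P $ j - Q $ j)\<^sup>2 = l\<^sup>2" if "j \<noteq> i" for j
    using s z sq[of 1] sq[of 2] sq[of 3] that exhaust_3[of i] exhaust_3[of j] by auto
  have *: "\<bar>P $ j\<bar> = l / 2 \<and> P $ j + Q $ j = 0" if "j \<noteq> i" for j
  proof -
    have "P $ j - Q $ j = l \<or> P $ j - Q $ j = - l"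
      using eq[OF that] by (simp only: power2_eq_iff)
    then show ?thesis using b[of j] by linarith
  qed
  have "\<bar>P $ j\<bar> = l / 2" for j
    using *[of j] P(2) h by (cases "j = i") simp_all
  then show "P \<in> cube_vertices l" by (simp add: cube_vertices_def)
  show "P + Q = axis i (2 * h)" using * P(2) Q(2) by (auto simp: vec_eq_iff axis_def)
qed

text \<open>The diagonals of the square must become diagonals of the face, so corners go to vertices
  and the centre to the centre of the face. The images of the sides, divided by \<open>l\<close>,
  are then integral and orthonormal; with their cross product they form a rotation of the cube, and
  the condition on the obverse side makes that cross product the outward normal.\<close>

lemma fold_onto_face:
  fixes f :: "complex \<Rightarrow> real^3"
  assumes u: "u \<noteq> 0" and iso: "\<And>x y. dist (f x) (f y) = dist x y"
    and face: "f ` square u s \<in> cube_faces (norm u)"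
    and out: "cross3 (f 1 - f 0) (f \<i> - f 0) \<bullet> f (centre u s) > 0"
  shows "\<exists>M \<in> cube_matrices. \<forall>x. f x = M *v top_face (norm u) ((x - centre u s) / u)"
proof -
  define l where "l = norm u"
  have l: "l > 0" using u by (simp add: l_def)
  define c where "c = centre u s"
  define P where "P z = f (c + u * z)" for z
  define p q where "p = P 1 - P 0" and "q = P \<i> - P 0"
  have dP: "norm (P x - P y) = l * norm (x - y)" for x y
    using iso[of "c + u * x" "c + u * y"]
    by (simp add: P_def dist_norm l_def norm_mult flip: right_diff_distrib)
  have P: "P z = P 0 + Re z *\<^sub>R p + Im z *\<^sub>R q" for z
  proof -
    define a b where "a = f 1 - f 0" and "b = f \<i> - f 0"
    have f: "f x = f 0 + Re x *\<^sub>R a + Im x *\<^sub>R b" for x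
      unfolding a_def b_def by (rule isometry_plane_affine[OF iso])
    show ?thesis unfolding p_def q_def P_def
      unfolding f[of "c + u * z"] f[of "c + u * 0"] f[of "c + u * 1"] f[of "c + u * \<i>"]
      by (simp add: algebra_simps)
  qed
  have Pd: "P a - P b = (Re a - Re b) *\<^sub>R p + (Im a - Im b) *\<^sub>R q" for a b
    unfolding P[of a] P[of b] by (simp add: algebra_simps)
  obtain i h where h: "h = l / 2 \<or> h = - l / 2" and fc: "f ` square u s = {x \<in> cube l. x $ i = h}"
    using face by (auto simp: cube_faces_def l_def)
  have PF: "P z \<in> cube l" "P z $ i = h" if "z \<in> half_box" for z
  proof -
    have "c + u * z \<in> square u s" using that u by (simp add: mem_square c_def)
    then have "P z \<in> f ` square u s" by (simp add: P_def)
    then show "P z \<in> cube l" "P z $ i = h" unfolding fc by auto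
  qed
  have habs: "\<bar>h\<bar> = l / 2" using h l by auto
  have vert: "P z \<in> cube_vertices l" "P z + P (- z) = axis i (2 * h)" if z: "z \<in> box_corners" for z
  proof -
    have hb: "z \<in> half_box" "- z \<in> half_box" using z by (auto simp: half_box_def box_corners_def)
    have "z - - z = 2 * z" by simp
    then have "(norm (P z - P (- z)))\<^sup>2 = (l * (2 * norm z))\<^sup>2" unfolding dP by (simp add: norm_mult)
    moreover have "(norm z)\<^sup>2 = 1 / 2"
    proof -
      have "(Re z)\<^sup>2 = 1 / 4" "(Im z)\<^sup>2 = 1 / 4"
      proof -
        have 4: "x\<^sup>2 = 1 / 4" if "\<bar>x\<bar> = 1 / 2" for x :: real
        proof -
          have "x = 1 / 2 \<or> x = - 1 / 2" using that by linarith
          then show ?thesis by (elim disjE) (erule ssubst, simp add: power2_eq_square)+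
        qed
        show "(Re z)\<^sup>2 = 1 / 4" "(Im z)\<^sup>2 = 1 / 4" using z by (simp_all add: box_corners_def 4)
      qed
      then show ?thesis by (simp add: cmod_power2)
    qed
    ultimately have "(P z - P (- z)) \<bullet> (P z - P (- z)) = 2 * l\<^sup>2"
      by (simp add: power2_norm_eq_inner power_mult_distrib)
    from opposite_corners[OF l habs PF[OF hb(1)] PF[OF hb(2)] this]
    show "P z \<in> cube_vertices l" "P z + P (- z) = axis i (2 * h)" by auto
  qed
  define z1 z2 z3 where "z1 = Complex (1/2) (1/2)" and "z2 = Complex (-1/2) (1/2)" and "z3 = Complex (1/2) (-1/2)"
  have zc: "z1 \<in> box_corners" "z2 \<in> box_corners" "z3 \<in> box_corners"
    by (auto simp: box_corners_def z1_def z2_def z3_def)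
  have pd: "p = P z1 - P z2" and qd: "q = P z1 - P z3"
    by (simp_all add: Pd z1_def z2_def z3_def)
  have "P z1 + P (- z1) = P 0 + P 0"
    unfolding P[of z1] P[of "- z1"] by simp
  then have P0: "P 0 = axis i h"
    using vert(2)[OF zc(1)] by (auto simp: vec_eq_iff axis_def split: if_splits)
  have norms: "norm p = l" "norm q = l" "norm (p + q) = l * sqrt 2"
  proof -
    show "norm p = l" "norm q = l" unfolding p_def q_def dP by simp_all
    have "p + q = P (1 + \<i>) - P 0" unfolding P[of "1 + \<i>"] by simp
    then show "norm (p + q) = l * sqrt 2" by (simp add: dP cmod_def)
  qed
  have pq: "p \<bullet> p = l\<^sup>2" "q \<bullet> q = l\<^sup>2" "p \<bullet> q = 0"
  proof -
    show 1: "p \<bullet> p = l\<^sup>2" "q \<bullet> q = l\<^sup>2" using norms by (simp_all add: norm_eq_square l less_imp_le)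
    have "(p + q) \<bullet> (p + q) = (l * sqrt 2)\<^sup>2"
      using norms(3) power2_norm_eq_inner by metis
    then show "p \<bullet> q = 0" using 1 by (simp add: inner_add inner_commute power_mult_distrib)
  qed
  have pi: "p $ i = 0" "q $ i = 0"
    unfolding pd qd using PF(2) zc box_corners_half_box by simp_all
  define p' q' n where "p' = (1 / l) *\<^sub>R p" and "q' = (1 / l) *\<^sub>R q" and "n = cross3 p' q'"
  have int: "p' $ j \<in> \<int>" "q' $ j \<in> \<int>" for j
    using difference_of_halves[of "P z1 $ j" l "P z2 $ j"] difference_of_halves[of "P z1 $ j" l "P z3 $ j"]
      vert(1)[OF zc(1)] vert(1)[OF zc(2)] vert(1)[OF zc(3)] l
    by (auto simp: p'_def q'_def pd qd cube_vertices_def)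
  have on: "p' \<bullet> p' = 1" "q' \<bullet> q' = 1" "p' \<bullet> q' = 0" "q' \<bullet> p' = 0"
    using pq l by (simp_all add: p'_def q'_def inner_commute power2_eq_square)
  have nn: "p' \<bullet> n = 0" "q' \<bullet> n = 0" "n \<bullet> p' = 0" "n \<bullet> q' = 0"
    by (simp_all add: n_def dot_cross_self inner_commute)
  have n1: "n \<bullet> n = 1"
    using norm_cross[of p' q'] by (simp add: n_def on power2_norm_eq_inner)
  define N :: "real^3^3" where "N = vector [p', q', n]"
  have "orthogonal_matrix N"
    unfolding orthogonal_matrix_orthonormal_rows N_def
    by (auto simp: row_def forall_3 norm_eq_1 orthogonal_def on nn n1)
  moreover have "det N = n \<bullet> n"
    by (simp add: N_def n_def det_3 cross3_def inner_vec_def sum_3 algebra_simps)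
  moreover have "N $ a $ b \<in> \<int>" for a b
  proof -
    have "n $ b \<in> \<int>"
      using int exhaust_3[of b] by (auto simp: n_def cross3_def)
    then show ?thesis using exhaust_3[of a] int by (auto simp: N_def)
  qed
  ultimately have N: "N \<in> cube_matrices"
    by (simp add: cube_matrices_def rotation_matrix_def n1)
  define M where "M = transpose N"
  have M: "M \<in> cube_matrices" using N cube_matrices_transpose by (simp add: M_def)
  have Mv: "M *v v = v $ 1 *\<^sub>R p' + v $ 2 *\<^sub>R q' + v $ 3 *\<^sub>R n" for v
    by (simp add: vec_eq_iff matrix_vector_3 M_def N_def transpose_def algebra_simps)
  have Nv: "N *v v = vector [p' \<bullet> v, q' \<bullet> v, n \<bullet> v]" for v
    by (simp add: vec_eq_iff forall_3 matrix_vector_mul_component N_def)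
  \<comment> \<open>The centre of the face has no component along the sides, so it is a multiple of
    \<open>n\<close>; its length \<open>l / 2\<close> leaves only the sign open.\<close>
  have P0n: "P 0 = (n \<bullet> P 0) *\<^sub>R n"
  proof -
    have "P 0 = M *v (N *v P 0)" using cube_matrix_transpose(1)[OF N] by (simp add: M_def)
    also have "N *v P 0 = vector [0, 0, n \<bullet> P 0]"
      unfolding Nv using pi by (simp add: P0 p'_def q'_def inner_axis)
    finally show ?thesis by (simp add: Mv)
  qed
  have "(n \<bullet> P 0)\<^sup>2 = P 0 \<bullet> P 0" by (subst (2 3) P0n) (simp add: n1 power2_eq_square)
  also have "P 0 \<bullet> P 0 = h\<^sup>2" by (simp add: P0 inner_axis_axis power2_eq_square)
  also have "\<dots> = (l / 2)\<^sup>2" using habs by (metis power2_abs)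
  finally have nP: "n \<bullet> P 0 = l / 2 \<or> n \<bullet> P 0 = - (l / 2)" by (simp only: power2_eq_iff)
  have fP: "f x = P ((x - c) / u)" for x using u by (simp add: P_def)
  \<comment> \<open>The obverse side is prescribed through the directions \<open>1\<close> and
    \<open>\<i>\<close>, not through the sides of the square. Passing between them is multiplication
    by \<open>1 / u\<close>, which scales the cross product by a nonnegative factor.\<close>
  have pos: "n \<bullet> P 0 > 0"
  proof -
    define v where "v = 1 / u"
    define \<alpha> \<beta> where "\<alpha> = Re v" and "\<beta> = Im v"
    have "(1 - c) / u - (0 - c) / u = v" "(\<i> - c) / u - (0 - c) / u = \<i> * v"
      by (simp_all add: v_def diff_divide_distrib)
    then have r: "Re ((1 - c) / u) - Re ((0 - c) / u) = \<alpha>" "Im ((1 - c) / u) - Im ((0 - c) / u) = \<beta>"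
      "Re ((\<i> - c) / u) - Re ((0 - c) / u) = - \<beta>" "Im ((\<i> - c) / u) - Im ((0 - c) / u) = \<alpha>"
      unfolding \<alpha>_def \<beta>_def minus_complex.simps[symmetric] by simp_all
    have "f 1 - f 0 = \<alpha> *\<^sub>R p + \<beta> *\<^sub>R q" "f \<i> - f 0 = (- \<beta>) *\<^sub>R p + \<alpha> *\<^sub>R q"
      unfolding fP by (simp_all only: Pd r)
    moreover have "cross3 (\<alpha> *\<^sub>R p + \<beta> *\<^sub>R q) ((- \<beta>) *\<^sub>R p + \<alpha> *\<^sub>R q) = (\<alpha>\<^sup>2 + \<beta>\<^sup>2) *\<^sub>R cross3 p q"
      by (simp add: cross3_def vec_eq_iff forall_3 algebra_simps power2_eq_square)
    ultimately have "cross3 (f 1 - f 0) (f \<i> - f 0) = (\<alpha>\<^sup>2 + \<beta>\<^sup>2) *\<^sub>R cross3 p q" by simp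
    also have "cross3 p q = l\<^sup>2 *\<^sub>R n"
      using l by (simp add: n_def p'_def q'_def cross_mult_left cross_mult_right power2_eq_square)
    finally have "cross3 (f 1 - f 0) (f \<i> - f 0) = ((\<alpha>\<^sup>2 + \<beta>\<^sup>2) * l\<^sup>2) *\<^sub>R n" by simp
    moreover have "f (centre u s) = P 0" by (simp add: P_def c_def)
    ultimately have "((\<alpha>\<^sup>2 + \<beta>\<^sup>2) * l\<^sup>2) * (n \<bullet> P 0) > 0" using out by simp
    moreover have "(\<alpha>\<^sup>2 + \<beta>\<^sup>2) * l\<^sup>2 \<ge> 0" by simp
    ultimately show ?thesis by (metis linorder_not_less mult_nonneg_nonpos)
  qed
  then have "P 0 = (l / 2) *\<^sub>R n" using nP P0n l by auto
  then have "P z = M *v top_face l z" for z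
    unfolding P[of z] Mv using l by (simp add: top_face_def p'_def q'_def)
  then show ?thesis using M fP unfolding l_def c_def by metis
qed

section \<open>Frames of a net of lattice squares, and their comparison by plane motions\<close>

locale lattice_net =
  fixes u k :: complex and X :: net
  assumes u: "u \<noteq> 0" and side_vec: "side_vec X = u"
    and squares: "squares X \<subseteq> lattice_points u k" and cube_net: "cube_net X"
begin

definition l :: real where "l = norm u"

text \<open>Records which face \<open>s\<close> covers and also in which of four positions it is
  laid there. The choice is meaningful for squares of the net, by
  \<open>fold_onto_face\<close>.\<close>

definition frame :: "complex \<Rightarrow> real^3^3" where
  "frame s = (SOME M. M \<in> cube_matrices \<and>
     (\<forall>x. fold_map X s x = M *v top_face l ((x - centre u s) / u)))"

lemma l_pos: "l > 0"
  using u by (simp add: l_def)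

lemma bij_face: "bij_betw (face X) (squares X) (cube_faces l)"
  using cube_net by (simp add: cube_net_def side_vec l_def)

lemma square_lattice: "s \<in> squares X \<Longrightarrow> s \<in> lattice_points u k"
  using squares by blast

lemma frame:
  assumes "s \<in> squares X"
  shows "frame s \<in> cube_matrices" "fold_map X s x = frame s *v top_face l ((x - centre u s) / u)"
proof -
  have "face X s \<in> cube_faces (norm u)"
    using bij_betwE[OF bij_face] assms by (simp add: l_def)
  then have "fold_map X s ` square u s \<in> cube_faces (norm u)" by (simp add: face_def side_vec)
  moreover have "dist (fold_map X s x) (fold_map X s y) = dist x y" for x y
    using cube_net assms by (auto simp: cube_net_def)
  moreover have "cross3 (fold_map X s 1 - fold_map X s 0) (fold_map X s \<i> - fold_map X s 0)
          \<bullet> fold_map X s (centre u s) > 0"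
    using cube_net assms by (auto simp: cube_net_def side_vec)
  ultimately have "\<exists>M. M \<in> cube_matrices \<and> (\<forall>x. fold_map X s x = M *v top_face l ((x - centre u s) / u))"
    using fold_onto_face[OF u] unfolding l_def by blast
  from someI_ex[OF this] show "frame s \<in> cube_matrices" "fold_map X s x = frame s *v top_face l ((x - centre u s) / u)"
    unfolding frame_def by blast+
qed

lemma dist_fold: "s \<in> squares X \<Longrightarrow> dist (fold_map X s x) (fold_map X s y) = dist x y"
  using cube_net by (auto simp: cube_net_def)

lemma fold_inject: "s \<in> squares X \<Longrightarrow> fold_map X s x = fold_map X s y \<longleftrightarrow> x = y"
  using dist_fold[of s x y] by auto

lemma face_eq:
  assumes "s \<in> squares X"
  shows "face X s = cube_face l (frame s *v up)"
proof -
  have "fold_map X s = placed u (frame s) s"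
    using frame(2)[OF assms] by (simp add: placed_def l_def fun_eq_iff)
  then show ?thesis
    using placed_face[OF u frame(1)[OF assms]] by (simp add: face_def side_vec l_def)
qed

lemma square_with_normal:
  assumes "n \<in> axes"
  obtains s where "s \<in> squares X" "frame s *v up = n"
proof -
  have "cube_face l n \<in> face X ` squares X"
    using assms bij_betw_imp_surj_on[OF bij_face] by (simp add: cube_faces_eq)
  then obtain s where s: "s \<in> squares X" "face X s = cube_face l n" by auto
  then have "frame s *v up = n"
    using face_eq[OF s(1)] cube_face_inject[OF cube_matrix_axes[OF frame(1)[OF s(1)] up_axes] assms l_pos] by simp
  then show ?thesis using that s by blast
qed

lemma face_inject: "s \<in> squares X \<Longrightarrow> s' \<in> squares X \<Longrightarrow> face X s = face X s' \<Longrightarrow> s = s'"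
  using bij_betw_imp_inj_on[OF bij_face] by (simp add: inj_on_eq_iff)

lemma fold_in_face: "s \<in> squares X \<Longrightarrow> fold_map X s x \<in> face X s \<longleftrightarrow> x \<in> square u s"
  by (auto simp: face_def side_vec fold_inject)

lemma fold_vertex:
  assumes "s \<in> squares X"
  shows "fold_map X s x \<in> cube_vertices l \<longleftrightarrow> x \<in> corners u s"
  by (simp add: frame[OF assms] cube_matrix_vertices top_face_vertex[OF l_pos] mem_corners[OF u])

text \<open>\<open>h\<close> is the rotation \<open>R\<close> seen in the plane, conjugated by the
  two fold maps. As lattice motions are the symmetries of the fabric, claims about rotations of the
  cube reduce to such \<open>h\<close>.\<close>

definition transports :: "real^3^3 \<Rightarrow> complex \<Rightarrow> complex \<Rightarrow> (complex \<Rightarrow> complex) \<Rightarrow> bool" where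
  "transports R s s' h \<longleftrightarrow> s \<in> squares X \<and> s' \<in> squares X \<and> h \<in> lattice_motions u k \<and>
     h ` square u s = square u s' \<and> h ` corners u s = corners u s' \<and>
     (\<forall>x. fold_map X s' (h x) = R *v fold_map X s x)"

lemma transportsI:
  assumes s: "s \<in> squares X" "s' \<in> squares X" and w: "w \<in> fourth_roots"
    and R: "frame s' ** spin w = R ** frame s"
  shows "transports R s s' (\<lambda>x. centre u s' + w * (x - centre u s))" (is "transports R s s' ?h")
proof -
  have "fold_map X s' (?h x) = R *v fold_map X s x" for x
  proof -
    have "(?h x - centre u s') / u = w * ((x - centre u s) / u)" by simp
    then have "fold_map X s' (?h x) = (frame s' ** spin w) *v top_face l ((x - centre u s) / u)"
      unfolding frame(2)[OF s(2)] by (simp add: spin_top_face flip: matrix_vector_mul_assoc)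
    then show ?thesis unfolding R frame(2)[OF s(1)] by (simp flip: matrix_vector_mul_assoc)
  qed
  then show ?thesis
    unfolding transports_def using s w rotate_square[OF u w] rotation_of_square square_lattice by simp
qed

text \<open>The face to which \<open>R\<close> carries that of \<open>s\<close> is covered by some
  \<open>s'\<close>. Comparing \<open>frame s'\<close> with \<open>R ** frame s\<close> leaves a
  rotation fixing \<open>up\<close>, hence a turn of the square by a unit.\<close>

lemma transport_exists:
  assumes R: "R \<in> cube_matrices" and s: "s \<in> squares X"
  obtains s' h where "transports R s s' h"
proof -
  have "R *v (frame s *v up) \<in> axes"
    using cube_matrix_axes R frame(1)[OF s] up_axes by blast
  then obtain s' where s': "s' \<in> squares X" "frame s' *v up = R *v (frame s *v up)"
    by (rule square_with_normal)
  define N where "N = transpose (frame s') ** (R ** frame s)"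
  have "N \<in> cube_matrices"
    unfolding N_def using R frame(1) s s'(1) by (intro cube_matrices_mult cube_matrices_transpose)
  moreover have "N *v up = transpose (frame s') *v (frame s' *v up)"
    by (simp add: N_def s'(2) flip: matrix_vector_mul_assoc)
  then have "N *v up = up" by (simp add: cube_matrix_transpose(1)[OF frame(1)[OF s'(1)]])
  ultimately obtain w where w: "w \<in> fourth_roots" "N = spin w" by (rule stabilizer_of_up)
  have "frame s' ** spin w = frame s' ** transpose (frame s') ** (R ** frame s)"
    unfolding w(2)[symmetric] N_def by (simp add: matrix_mul_assoc)
  also have "\<dots> = R ** frame s"
    by (simp add: cube_matrix_mult_transpose[OF frame(1)[OF s'(1)]])
  finally show ?thesis using transportsI[OF s s'(1) w(1)] that by blast
qed

text \<open>The equation between frames can also be solved for \<open>R\<close>. In this direction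
  it turns a symmetry that moves strands of the plane into a rotation that moves strands of the
  cube.\<close>

lemma transport_extends:
  assumes s: "s \<in> squares X" "s' \<in> squares X" and h: "h \<in> lattice_motions u k" "h ` square u s = square u s'"
  obtains R where "R \<in> cube_matrices" "transports R s s' h"
proof -
  obtain w s'' where w: "w \<in> fourth_roots" "s'' \<in> lattice_points u k"
    "h = (\<lambda>x. centre u s'' + w * (x - centre u s))"
    using lattice_motion_centre[OF h(1) square_lattice[OF s(1)]] by metis
  have "square u s'' = square u s'"
    using rotate_square(1)[OF u w(1), of s'' s] h(2) w(3) by simp
  then have "s'' = s'" using square_inject[OF u w(2) square_lattice[OF s(2)]] by blast
  define R where "R = frame s' ** spin w ** transpose (frame s)"
  have "R \<in> cube_matrices"
    unfolding R_def using frame(1) s w(1) spin_cube_matrices by (intro cube_matrices_mult cube_matrices_transpose)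
  moreover have "frame s' ** spin w = R ** frame s"
    unfolding R_def matrix_mul_assoc[symmetric] cube_matrix_mult_transpose[OF frame(1)[OF s(1)]]
    by simp
  ultimately show ?thesis using that transportsI[OF s w(1)] w(3) \<open>s'' = s'\<close> by blast
qed

text \<open>The two ends of the joined edge are corners of lattice squares both before and after
  \<open>g\<close>, so \<open>g\<close> takes a side vector to a side vector; their ratio, a
  Gaussian unit, is its rotation part. The common vertex \<open>x\<close> is returned because
  colours will be compared there.\<close>

lemma joined_motion:
  assumes j: "joined X s s' g"
  obtains x where "g \<in> lattice_motions u k" "x \<in> corners u s'" "g x \<in> corners u s"
    "fold_map X s (g x) = fold_map X s' x"
proof -
  have s: "s \<in> squares X" "s' \<in> squares X" and dg: "direct_isometry g"
    and meet: "meet_along_side (face X s) (face X s')"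
    and gx: "\<And>x. x \<in> square u s' \<Longrightarrow> fold_map X s' x \<in> face X s \<Longrightarrow> fold_map X s (g x) = fold_map X s' x"
    using j by (auto simp: joined_def side_vec)
  define n m where "n = frame s *v up" and "m = frame s' *v up"
  have nm: "n \<in> axes" "m \<in> axes" unfolding n_def m_def using cube_matrix_axes frame(1) s up_axes by blast+
  have fs: "face X s = cube_face l n" "face X s' = cube_face l m" using face_eq s n_def m_def by simp_all
  have "n \<noteq> - m"
  proof
    assume nm': "n = - m"
    obtain y where "y \<in> face X s" "y \<in> face X s'"
      using meet unfolding meet_along_side_def by (metis IntD1 IntD2 ends_in_segment(1))
    then show False using l_pos by (simp add: fs cube_face_def nm')
  qed
  then consider "n = m" | "n \<bullet> m = 0" using axes_inner[OF nm] by blast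
  then obtain x y where xy: "x \<in> corners u s'" "y \<in> corners u s'" "norm (x - y) = norm u"
    "fold_map X s' x \<in> face X s" "fold_map X s' y \<in> face X s"
  proof cases
    \<comment> \<open>A face meeting itself is not ruled out here; any side of the square then
      serves.\<close>
    case 1
    then have "face X s' = face X s" by (simp add: fs)
    moreover have c: "s' \<in> corners u s'" "s' + u \<in> corners u s'" by (auto simp: corners_def)
    then have "fold_map X s' s' \<in> face X s'" "fold_map X s' (s' + u) \<in> face X s'"
      by (simp_all only: fold_in_face[OF s(2)] corners_subset_square[THEN subsetD])
    ultimately show ?thesis using that[of "s' + u" s'] c by simp
  next
    case 2
    then have "m \<bullet> (frame s *v up) = 0" by (simp add: n_def inner_commute)
    then obtain e where e: "e \<in> fourth_roots" "frame s *v (tilt e *v up) = m"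
      using perpendicular_axis[OF frame(1)[OF s(1)] nm(2)] by metis
    \<comment> \<open>At \<open>1 / 2\<close> and \<open>- 1 / 2\<close> these are the ends of the
      common edge, seen on the upper face before \<open>frame s\<close> is applied.\<close>
    define y where "y r = top_face l (e * Complex (1 / 2) r)" for r
    have "y r \<in> cube_vertices l \<and> y r \<in> cube_face l up \<inter> cube_face l (tilt e *v up)"
      if "r = 1 / 2 \<or> r = - 1 / 2" for r
      using e(1) l_pos that
      by (auto simp: y_def cube_vertices_def cube_face_def cube_def top_face_def tilt_up inner_vec_def sum_3 forall_3
            up_component fourth_roots_def abs_mult)
    then have "frame s *v y r \<in> cube_vertices l \<and> frame s *v y r \<in> face X s \<and> frame s *v y r \<in> face X s'"
      if "r = 1 / 2 \<or> r = - 1 / 2" for r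
      using that unfolding fs n_def e(2)[symmetric] cube_matrix_vertices[OF frame(1)[OF s(1)]]
        cube_matrix_face[OF frame(1)[OF s(1)], symmetric] by blast
    moreover have "\<exists>x. x \<in> corners u s' \<and> fold_map X s' x = v" if "v \<in> cube_vertices l" "v \<in> face X s'" for v
      using that fold_vertex[OF s(2)] by (auto simp: face_def)
    ultimately have "\<exists>x. x \<in> corners u s' \<and> fold_map X s' x = frame s *v y r \<and> fold_map X s' x \<in> face X s"
      if "r = 1 / 2 \<or> r = - 1 / 2" for r
      using that by metis
    from this[of "1 / 2"] this[of "- 1 / 2"] obtain x x' where
      x: "x \<in> corners u s'" "fold_map X s' x = frame s *v y (1 / 2)" "fold_map X s' x \<in> face X s"
      and x': "x' \<in> corners u s'" "fold_map X s' x' = frame s *v y (- 1 / 2)" "fold_map X s' x' \<in> face X s"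
      by auto
    have "dist x x' = dist (frame s *v y (1 / 2)) (frame s *v y (- 1 / 2))"
      using dist_fold[OF s(2), of x x'] x(2) x'(2) by simp
    also have "\<dots> = dist (y (1 / 2)) (y (- 1 / 2))"
      unfolding dist_norm norm_eq_sqrt_inner matrix_vector_mult_diff_distrib[symmetric]
      by (simp add: cube_matrix_inner[OF frame(1)[OF s(1)]])
    also have "\<dots> = l * norm (e * \<i>)"
    proof -
      have "e * Complex (1 / 2) (1 / 2) - e * Complex (1 / 2) (- 1 / 2) = e * \<i>"
        by (simp add: complex_eq_iff algebra_simps)
      then show ?thesis unfolding y_def dist_top_face[OF l_pos] by (simp only: dist_norm)
    qed
    also have "\<dots> = norm u" using fourth_roots_norm[OF e(1)] by (simp add: l_def norm_mult)
    finally show ?thesis using that x x' by (simp add: dist_norm)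
  qed
  have gc: "g v \<in> corners u s \<and> fold_map X s (g v) = fold_map X s' v"
    if v: "v \<in> corners u s'" "fold_map X s' v \<in> face X s" for v
  proof -
    have "v \<in> square u s'" using v(1) corners_subset_square by blast
    then have "fold_map X s (g v) = fold_map X s' v" using gx v by blast
    then show ?thesis using v(1) fold_vertex[OF s(1)] fold_vertex[OF s(2)] by metis
  qed
  obtain w t where wt: "norm w = 1" "\<And>z. g z = w * z + t" using dg by (auto simp: direct_isometry_def)
  have lat: "x \<in> lattice_points u k" "y \<in> lattice_points u k" "g x \<in> lattice_points u k" "g y \<in> lattice_points u k"
    using xy gc s square_lattice corners_lattice by blast+
  obtain z where z: "z \<in> gauss_ints" "x = y + u * z" using lattice_points_diff[OF lat(2,1)] by metis
  obtain z' where z': "z' \<in> gauss_ints" "g x = g y + u * z'" using lattice_points_diff[OF lat(4,3)] by metis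
  have zz: "z' = w * z" using z'(2) u by (simp add: wt(2) z(2) algebra_simps)
  have nz: "norm z = 1" using xy(3) u by (simp add: z(2) norm_mult)
  then have "z \<in> fourth_roots" "z' \<in> fourth_roots"
    using z(1) z'(1) wt(1) by (auto intro!: fourth_rootsI simp: zz norm_mult)
  moreover have "w = z' * inverse z" proof -
    have "z \<noteq> 0" using nz by auto
    then show ?thesis by (simp add: zz)
  qed
  ultimately have "w \<in> fourth_roots" using fourth_roots_mult fourth_roots_inverse by blast
  then have "g \<in> lattice_motions u k"
    using lattice_motion_by_point[of w x u k g] lat wt(2) by (simp add: algebra_simps)
  then show ?thesis using that xy gc by blast
qed

text \<open>The face across the side \<open>e\<close> has normal
  \<open>frame s *v (tilt e *v up)\<close> and is covered by some square, wherever that lies in the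
  net. Unfolded, it occupies the place \<open>s + u * e\<close> of the tiling, whether or not the
  net has a square there.\<close>

lemma joined_exists:
  assumes s: "s \<in> squares X" and e: "e \<in> fourth_roots"
  obtains s' g where "joined X s s' g" "g ` square u s' = square u (s + u * e)"
proof -
  note F = frame(1)[OF s]
  have T: "tilt e \<in> cube_matrices" using e by (rule tilt_cube_matrices)
  have "frame s *v (tilt e *v up) \<in> axes"
    using cube_matrix_axes F T up_axes by blast
  then obtain s' where s': "s' \<in> squares X" "frame s' *v up = frame s *v (tilt e *v up)"
    by (rule square_with_normal)
  define N where "N = transpose (frame s ** tilt e) ** frame s'"
  have FT: "frame s ** tilt e \<in> cube_matrices" using F T by (rule cube_matrices_mult)
  have "N \<in> cube_matrices"
    unfolding N_def by (rule cube_matrices_mult[OF cube_matrices_transpose[OF FT] frame(1)[OF s'(1)]])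
  moreover have "N *v up = transpose (frame s ** tilt e) *v ((frame s ** tilt e) *v up)"
    by (simp add: N_def s'(2) flip: matrix_vector_mul_assoc)
  then have "N *v up = up" unfolding cube_matrix_transpose(1)[OF FT] .
  ultimately obtain w where w: "w \<in> fourth_roots" "N = spin w" by (rule stabilizer_of_up)
  have "frame s ** tilt e ** spin w = (frame s ** tilt e ** transpose (frame s ** tilt e)) ** frame s'"
    unfolding w(2)[symmetric] N_def by (simp only: matrix_mul_assoc)
  then have fs': "frame s' = frame s ** tilt e ** spin w"
    by (simp add: cube_matrix_mult_transpose(1)[OF FT])
  define g where "g x = centre u (s + u * e) + w * (x - centre u s')" for x
  have gi: "g ` square u s' = square u (s + u * e)"
    unfolding g_def[abs_def] by (rule rotate_square(1)[OF u w(1)])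
  have "joined X s s' g"
    unfolding joined_def
  proof (intro conjI ballI impI)
    show "meet_along_side (face X s) (face X s')"
      unfolding face_eq[OF s] face_eq[OF s'(1)] s'(2) by (rule faces_meet_along_side[OF F e l_pos])
    show "direct_isometry g"
      unfolding direct_isometry_def g_def[abs_def] using fourth_roots_norm[OF w(1)]
      by (intro exI[of _ w] exI[of _ "centre u (s + u * e) - w * centre u s'"]) (simp add: algebra_simps)
    fix x assume x: "x \<in> flat X s'" "fold_map X s' x \<in> face X s"
    define z where "z = w * ((x - centre u s') / u)"
    have f: "fold_map X s' x = frame s *v (tilt e *v top_face l z)"
      unfolding frame(2)[OF s'(1)] fs' by (simp add: z_def spin_top_face flip: matrix_vector_mul_assoc)
    have "(frame s *v (tilt e *v top_face l z)) \<bullet> (frame s *v up) = l / 2"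
      using x(2) unfolding f face_eq[OF s] by (simp add: cube_face_def)
    then have "(tilt e *v top_face l z) $ 3 = l / 2"
      unfolding cube_matrix_inner[OF F] inner_up .
    then have "fold_map X s' x = frame s *v top_face l (z + e)"
      unfolding f using tilt_edge[OF e l_pos] by simp
    moreover have "(g x - centre u s) / u = z + e"
      using u by (simp add: g_def z_def centre_eq field_simps)
    ultimately show "fold_map X s (g x) = fold_map X s' x" by (simp add: frame(2)[OF s])
  qed (use s s' in auto)
  then show ?thesis using that gi by blast
qed

end

section \<open>Nets cut from a striped fabric\<close>

locale striped_net = lattice_net u k X for u k :: complex and X :: net +
  fixes F :: weave and \<kappa> :: "strand \<Rightarrow> colour" and a b :: int
  assumes u_eq: "u = lattice_gen1 a b" and ab: "coprime a b" "odd (a + b)" and k: "k \<in> gauss_ints"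
    and symmetries: "symmetry_group F = {(g, False) | g. g \<in> lattice_motions u k}"
    and striping: "thick_striping \<kappa>" and perfect: "perfect_colouring F \<kappa>"
    and redundant: "\<forall>x \<in> lattice_points u k. redundant_block_centre \<kappa> x"
begin

lemma u_gauss: "u \<in> gauss_ints"
  by (auto simp: u_eq lattice_gen1_def gauss_ints_def)

lemma motion_strip_exists: "g \<in> lattice_motions u k \<Longrightarrow> \<exists>t'. g ` strip t = strip t'"
  using motion_strip[OF _ u_gauss k] by metis

lemma motion_cell:
  assumes "g \<in> lattice_motions u k"
  obtains i' j' where "g ` cell i j = cell i' j'" "g ` strip (top_strand F i j) = strip (top_strand F i' j')"
proof -
  have "(g, False) \<in> symmetry_group F" using symmetries assms by blast
  then have "\<exists>i' j'. g ` cell i j = cell i' j' \<and> g ` strip (top_strand F i j) = strip (top_strand F i' j')"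
    by (auto simp: symmetry_group_def)
  then show ?thesis using that by blast
qed

lemma motion_recolours:
  assumes "g \<in> lattice_motions u k" "x \<in> lattice_points u k" "g ` strip t = strip t'"
  shows "\<kappa> t' = \<kappa> t \<longleftrightarrow> corner_colour \<kappa> (g x) = corner_colour \<kappa> x"
  using motion_colour[OF _ assms(1) perfect redundant u_gauss k assms(2,3)] symmetries assms(1) by blast

subsection \<open>Corner colours and the two classes of vertices of the cube\<close>

text \<open>The vertices of a cube fall into two classes, told apart by the sign of the product of the
  coordinates; neighbouring vertices lie in different classes.\<close>

definition agrees :: "complex \<Rightarrow> complex \<Rightarrow> bool" where
  "agrees s x \<longleftrightarrow> (corner_colour \<kappa> x = Dark \<longleftrightarrow> (\<Prod>i\<in>UNIV. fold_map X s x $ i) > 0)"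

text \<open>Around the square the corner colours alternate, and so do the signs of the products of
  coordinates: up to the sign \<open>t\<close> of the frame, the product is
  \<open>Re z * Im z\<close> times a positive constant.\<close>

lemma agrees_within:
  assumes s: "s \<in> squares X" and x: "x \<in> corners u s"
  shows "agrees s x \<longleftrightarrow> agrees s s"
proof -
  obtain t where t: "t = 1 \<or> t = (- 1 :: real)"
    "\<And>y. (\<Prod>i\<in>UNIV. (frame s *v y) $ i) = t * (\<Prod>i\<in>UNIV. y $ i)"
    by (rule cube_matrix_prod[OF frame(1)[OF s]]) blast
  define v where "v z = t * (Re z * Im z) * (l ^ 3 / 2)" for z
  have f: "(\<Prod>i\<in>UNIV. fold_map X s (centre u s + u * z) $ i) = v z" for z
  proof -
    have "fold_map X s (centre u s + u * z) = frame s *v top_face l z"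
      using u by (simp add: frame(2)[OF s])
    then have "(\<Prod>i\<in>UNIV. fold_map X s (centre u s + u * z) $ i) = t * (\<Prod>i\<in>UNIV. top_face l z $ i)"
      by (simp only: t(2))
    then show ?thesis by (simp add: prod_UNIV_3 top_face_def v_def power3_eq_cube)
  qed
  have pos: "v z > 0 \<longleftrightarrow> t * (Re z * Im z) > 0" for z
    using l_pos by (simp add: v_def zero_less_mult_iff)
  have co: "s = centre u s + u * Complex (-1/2) (-1/2)" "s + u = centre u s + u * Complex (1/2) (-1/2)"
    "s + u + \<i> * u = centre u s + u * Complex (1/2) (1/2)" "s + \<i> * u = centre u s + u * Complex (-1/2) (1/2)"
    by (simp_all add: centre_eq complex_eq_iff algebra_simps add_divide_distrib diff_divide_distrib)
  have alt: "corner_colour \<kappa> (x + u * e) \<noteq> corner_colour \<kappa> x" if "e \<in> fourth_roots" for x e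
    using corner_colour_alternates[OF striping ab(2) that] by (simp add: u_eq)
  have dark: "c = Dark \<longleftrightarrow> c' \<noteq> Dark" if "c \<noteq> c'" for c c' :: colour
    using that by (cases c; cases c') simp_all
  have "corner_colour \<kappa> (s + u) \<noteq> corner_colour \<kappa> s" "corner_colour \<kappa> (s + \<i> * u) \<noteq> corner_colour \<kappa> s"
    "corner_colour \<kappa> (s + u + \<i> * u) \<noteq> corner_colour \<kappa> (s + u)"
    using alt[of 1 s] alt[of \<i> s] alt[of \<i> "s + u"] by (simp_all add: fourth_roots_def mult.commute)
  note D = this[THEN dark]
  have P: "(\<Prod>i\<in>UNIV. fold_map X s s $ i) > 0 \<longleftrightarrow> t > 0"
    "(\<Prod>i\<in>UNIV. fold_map X s (s + u) $ i) > 0 \<longleftrightarrow> t < 0"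
    "(\<Prod>i\<in>UNIV. fold_map X s (s + u + \<i> * u) $ i) > 0 \<longleftrightarrow> t > 0"
    "(\<Prod>i\<in>UNIV. fold_map X s (s + \<i> * u) $ i) > 0 \<longleftrightarrow> t < 0"
    by (subst co, simp only: f pos, simp)+
  have "agrees s (s + u) \<longleftrightarrow> agrees s s" "agrees s (s + u + \<i> * u) \<longleftrightarrow> agrees s s"
    "agrees s (s + \<i> * u) \<longleftrightarrow> agrees s s"
    unfolding agrees_def P D using t(1) by auto
  then show ?thesis using x unfolding corners_def by auto
qed

text \<open>Squares meeting along a side have a common corner at which folding glues them, so both
  give it the same colour and the same vertex.\<close>

lemma agrees_next:
  assumes s: "s \<in> squares X" "s' \<in> squares X" and meet: "meet_along_side (flat X s) (flat X s')"
  shows "agrees s s \<longleftrightarrow> agrees s' s'"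
proof -
  obtain e where e: "e \<in> fourth_roots" "s' = s + u * e"
    using meet_along_side_squares[OF u square_lattice[OF s(1)] square_lattice[OF s(2)]] meet side_vec by auto
  obtain x where x: "x \<in> corners u s" "x \<in> corners u s'"
    using adjacent_squares_share_corners[OF e(1) u, of s] e(2) by auto
  then have "x \<in> flat X s \<inter> flat X s'" using corners_subset_square side_vec by auto
  then have "fold_map X s x = fold_map X s' x"
    using cube_net s meet unfolding cube_net_def by blast
  then have "agrees s x \<longleftrightarrow> agrees s' x" by (simp add: agrees_def)
  then show ?thesis using agrees_within[OF s(1) x(1)] agrees_within[OF s(2) x(2)] by blast
qed

lemma agrees_everywhere:
  assumes s: "s \<in> squares X" "s' \<in> squares X" and x: "x \<in> corners u s" "y \<in> corners u s'"
  shows "agrees s x \<longleftrightarrow> agrees s' y"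
proof -
  have "(s, s') \<in> {(p, q). p \<in> squares X \<and> q \<in> squares X \<and> meet_along_side (flat X p) (flat X q)}\<^sup>*"
    using cube_net s unfolding cube_net_def by blast
  then have "agrees s s \<longleftrightarrow> agrees s' s'"
    by (induction rule: rtrancl_induct) (use agrees_next in auto)
  then show ?thesis using agrees_within s x by blast
qed

lemma vertex_prod_nonzero:
  assumes "s \<in> squares X" "x \<in> corners u s"
  shows "(\<Prod>i\<in>UNIV. fold_map X s x $ i) \<noteq> 0"
proof -
  have "\<bar>fold_map X s x $ i\<bar> = l / 2" for i
    using fold_vertex assms by (auto simp: cube_vertices_def)
  then have "fold_map X s x $ i \<noteq> 0" for i using l_pos by (metis abs_zero half_gt_zero less_irrefl)
  then show ?thesis by simp
qed

text \<open>Agreement is uniform over the net, so comparing two colours amounts to comparing the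
  signs of two products. The corners may be far apart in the net: only their places on the cube
  enter.\<close>

lemma corner_colour_eq_iff:
  assumes s: "s \<in> squares X" "s' \<in> squares X" and x: "x \<in> corners u s" "y \<in> corners u s'"
    and t: "t = 1 \<or> t = (- 1 :: real)"
    and p: "(\<Prod>i\<in>UNIV. fold_map X s' y $ i) = t * (\<Prod>i\<in>UNIV. fold_map X s x $ i)"
  shows "corner_colour \<kappa> y = corner_colour \<kappa> x \<longleftrightarrow> t = 1"
proof -
  have "agrees s x \<longleftrightarrow> agrees s' y" using agrees_everywhere s x .
  moreover have "(\<Prod>i\<in>UNIV. fold_map X s x $ i) \<noteq> 0" using vertex_prod_nonzero s x by blast
  then have "(0 < (\<Prod>i\<in>UNIV. fold_map X s' y $ i) \<longleftrightarrow> 0 < (\<Prod>i\<in>UNIV. fold_map X s x $ i)) \<longleftrightarrow> t = 1"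
    using t by (auto simp: p)
  ultimately have "(corner_colour \<kappa> y = Dark \<longleftrightarrow> corner_colour \<kappa> x = Dark) \<longleftrightarrow> t = 1"
    unfolding agrees_def by blast
  then show ?thesis using colour.exhaust by metis
qed

lemma continuation_colour:
  assumes "joined X s s' g" "g ` strip t' = strip t"
  shows "\<kappa> t' = \<kappa> t"
proof -
  obtain x where g: "g \<in> lattice_motions u k" and x: "x \<in> corners u s'" "g x \<in> corners u s"
    "fold_map X s (g x) = fold_map X s' x"
    by (rule joined_motion[OF assms(1)])
  have s: "s \<in> squares X" "s' \<in> squares X" using assms(1) by (auto simp: joined_def)
  have "corner_colour \<kappa> (g x) = corner_colour \<kappa> x"
    using corner_colour_eq_iff[OF s(2,1) x(1,2), of 1] x(3) by simp
  then show ?thesis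
    using motion_recolours[OF g corners_lattice[OF square_lattice[OF s(2)] x(1)] assms(2)] by simp
qed

subsection \<open>Rotations of the cube as motions of the plane\<close>

lemma transports_carries:
  assumes "transports R s s' h"
  shows "carries X R s A s' (h ` A)"
proof -
  have s: "s \<in> squares X" "s' \<in> squares X" and h: "h \<in> lattice_motions u k" "h ` square u s = square u s'"
    and R: "\<And>x. R *v fold_map X s x = fold_map X s' (h x)"
    using assms by (auto simp: transports_def)
  have "(\<lambda>x. R *v x) ` fold_map X s ` B = fold_map X s' ` h ` B" for B
    by (simp add: image_image R)
  moreover have "h ` (A \<inter> square u s) = h ` A \<inter> square u s'"
    by (simp add: image_Int[OF motion_inj[OF h(1)]] h(2))
  ultimately show ?thesis
    using s h(2) by (simp add: carries_def face_def side_vec)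
qed

text \<open>\<open>carries\<close> compares only the parts of figures inside the squares. As the
  cell meets the interior of its square, that part determines the cell, and the face determines the
  square; hence the target is the one given by the transporting motion.\<close>

lemma carried_cells:
  assumes R: "R \<in> cube_matrices" and show_cell: "cell_shows X s i j"
    and c: "carries X R s (cell i j) s' (cell i' j')"
  obtains h where "transports R s s' h" "h ` cell i j = cell i' j'"
    "h ` strip (top_strand F i j) = strip (top_strand F i' j')"
proof -
  have s: "s \<in> squares X" "s' \<in> squares X" using c by (auto simp: carries_def)
  obtain s'' h where h: "transports R s s'' h" by (rule transport_exists[OF R s(1)])
  note hc = transports_carries[OF h]
  have "face X s'' = face X s'" using hc c unfolding carries_def by metis
  then have "s'' = s'" using face_inject h s unfolding transports_def by blast
  with h have h: "transports R s s' h" by simp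
  note hc = transports_carries[OF h]
  have hl: "h \<in> lattice_motions u k" and hs: "h ` square u s = square u s'"
    using h by (auto simp: transports_def)
  obtain p q where pq: "h ` cell i j = cell p q" "h ` strip (top_strand F i j) = strip (top_strand F p q)"
    by (rule motion_cell[OF hl])
  have "fold_map X s' ` (cell p q \<inter> square u s') = fold_map X s' ` (cell i' j' \<inter> square u s')"
    using hc[of "cell i j"] c unfolding carries_def pq(1) side_vec by metis
  then have "cell p q \<inter> square u s' = cell i' j' \<inter> square u s'"
    using fold_inject[OF s(2)] by (simp add: inj_image_eq_iff inj_def)
  moreover have "interior (cell p q) \<inter> interior (square u s') \<noteq> {}"
  proof -
    have "h ` interior (cell i j) \<inter> h ` interior (square u s) \<noteq> {}"
      using cell_meets_interior[of i j "square u s"] show_cell by (auto simp: cell_shows_def side_vec)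
    then show ?thesis
      unfolding interior_motion[OF hl, symmetric] pq(1) hs .
  qed
  then obtain z where "z \<in> interior (cell p q)" "z \<in> square u s'" using interior_subset by blast
  moreover have "z \<in> cell p q" using \<open>z \<in> interior (cell p q)\<close> interior_subset by blast
  ultimately have "p = i' \<and> q = j'" using interior_cell_unique by blast
  then show ?thesis using that h pq by blast
qed

lemma rotation_recolours:
  assumes R: "R \<in> cube_matrices"
  obtains p where "\<And>s i j s' i' j'. cell_shows X s i j \<Longrightarrow> carries X R s (cell i j) s' (cell i' j') \<Longrightarrow>
    \<kappa> (top_strand F i' j') = \<kappa> (top_strand F i j) \<longleftrightarrow> p"
proof -
  obtain t where t: "t = 1 \<or> t = (- 1 :: real)"
    "\<And>y. (\<Prod>i\<in>UNIV. (R *v y) $ i) = t * (\<Prod>i\<in>UNIV. y $ i)"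
    by (rule cube_matrix_prod[OF R]) blast
  have "\<kappa> (top_strand F i' j') = \<kappa> (top_strand F i j) \<longleftrightarrow> t = 1"
    if cs: "cell_shows X s i j" and ca: "carries X R s (cell i j) s' (cell i' j')" for s i j s' i' j'
  proof -
    obtain h where h: "transports R s s' h" "h ` strip (top_strand F i j) = strip (top_strand F i' j')"
      by (rule carried_cells[OF R cs ca])
    have s: "s \<in> squares X" "s' \<in> squares X" and hl: "h \<in> lattice_motions u k"
      and hc: "h ` corners u s = corners u s'" and hR: "\<And>x. fold_map X s' (h x) = R *v fold_map X s x"
      using h(1) by (auto simp: transports_def)
    have c: "s \<in> corners u s" by (simp add: corners_def)
    have "corner_colour \<kappa> (h s) = corner_colour \<kappa> s \<longleftrightarrow> t = 1"
      using hc c by (intro corner_colour_eq_iff[OF s c _ t(1)]) (auto simp: hR t(2))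
    then show ?thesis
      using motion_recolours[OF hl square_lattice[OF s(1)] h(2)] by simp
  qed
  then show ?thesis using that by blast
qed

lemma transports_inverse:
  assumes R: "R \<in> cube_matrices" and h: "transports R s s' h"
  obtains h' where "transports (transpose R) s' s h'" "h' \<circ> h = id" "h \<circ> h' = id"
proof -
  have s: "s \<in> squares X" "s' \<in> squares X" and hl: "h \<in> lattice_motions u k"
    and hs: "h ` square u s = square u s'" "h ` corners u s = corners u s'"
    and hR: "\<And>x. fold_map X s' (h x) = R *v fold_map X s x"
    using h by (auto simp: transports_def)
  obtain h' where h': "h' \<in> lattice_motions u k" "h \<circ> h' = id" "h' \<circ> h = id"
    by (rule lattice_motion_inverse[OF hl])
  have "fold_map X s (h' x) = transpose R *v fold_map X s' x" for x
    using hR[of "h' x"] pointfree_idE[OF h'(2), of x] cube_matrix_transpose(1)[OF R] by simp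
  moreover have "h' ` h ` A = A" for A using h'(3) by (simp add: image_comp)
  ultimately have "transports (transpose R) s' s h'"
    unfolding transports_def using s h'(1) hs by metis
  then show ?thesis using that h' by blast
qed

subsection \<open>Strands of the cube\<close>

definition linked :: "((complex \<times> strand) \<times> (complex \<times> strand)) set" where
  "linked = (continuation X \<union> (continuation X)\<inverse>)\<^sup>*"

lemma linked_sym: "(p, q) \<in> linked \<Longrightarrow> (q, p) \<in> linked"
  unfolding linked_def by (rule symD[OF sym_rtrancl[OF sym_Un_converse]])

lemma linked_trans: "(p, q) \<in> linked \<Longrightarrow> (q, r) \<in> linked \<Longrightarrow> (p, r) \<in> linked"
  unfolding linked_def by (rule rtrancl_trans)

text \<open>The unfolding for the rotated pair of faces is the conjugate
  \<open>h1 \<circ> g \<circ> g2\<close>, where \<open>g2\<close> inverts \<open>h2\<close>. So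
  rotations respect continuation and, along chains, act on the strands of the cube.\<close>

lemma transports_continuation:
  assumes R: "R \<in> cube_matrices" and h: "transports R s1 s1' h1" "transports R s2 s2' h2"
    and t: "h1 ` strip t1 = strip t1'" "h2 ` strip t2 = strip t2'"
    and c: "((s1, t1), (s2, t2)) \<in> continuation X"
  shows "((s1', t1'), (s2', t2')) \<in> continuation X"
proof -
  obtain g where g: "joined X s1 s2 g" "interior (strip t1) \<inter> square u s1 \<inter> g ` square u s2 \<noteq> {}"
    "g ` strip t2 = strip t1"
    using c by (auto simp: continuation_def side_vec)
  obtain g2 where g2: "transports (transpose R) s2' s2 g2" "g2 \<circ> h2 = id" "h2 \<circ> g2 = id"
    by (rule transports_inverse[OF R h(2)])
  have hl: "h1 \<in> lattice_motions u k" and hR: "\<And>x. fold_map X s1' (h1 x) = R *v fold_map X s1 x"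
    and hR2: "\<And>x. fold_map X s2' (h2 x) = R *v fold_map X s2 x"
    and s: "s1' \<in> squares X" "s2' \<in> squares X" and hs: "h1 ` square u s1 = square u s1'" "h2 ` square u s2 = square u s2'"
    and s12: "s1 \<in> squares X" "s2 \<in> squares X"
    using h by (auto simp: transports_def)
  have gl: "g \<in> lattice_motions u k" by (rule joined_motion[OF g(1)])
  have g2l: "g2 \<in> lattice_motions u k" using g2(1) by (simp add: transports_def)
  define g' where "g' = h1 \<circ> g \<circ> g2"
  have gi: "g' ` h2 ` A = h1 ` g ` A" for A
    using g2(2) by (auto simp: g'_def image_iff fun_eq_iff)
  have g'l: "g' \<in> lattice_motions u k"
    unfolding g'_def using hl gl g2l lattice_motion_comp by blast
  have "joined X s1' s2' g'"
    unfolding joined_def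
  proof (intro conjI ballI impI)
    show "s1' \<in> squares X" "s2' \<in> squares X" using s by auto
    obtain p q where pq: "p \<noteq> q" "face X s1 \<inter> face X s2 = closed_segment p q"
      using g(1) by (auto simp: joined_def meet_along_side_def)
    have inj: "inj (\<lambda>x. R *v x)" using cube_matrix_transpose(1)[OF R] by (metis injI)
    have "face X s1' \<inter> face X s2' = (\<lambda>x. R *v x) ` (face X s1 \<inter> face X s2)"
      using transports_carries[OF h(1)] transports_carries[OF h(2)] image_Int[OF inj]
      unfolding carries_def by metis
    also have "\<dots> = closed_segment (R *v p) (R *v q)"
      unfolding pq(2) by (simp add: closed_segment_linear_image matrix_vector_mul_linear)
    finally show "meet_along_side (face X s1') (face X s2')"
      using pq(1) injD[OF inj, of p q] unfolding meet_along_side_def by blast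
    obtain w where "w \<in> fourth_roots" "\<And>x y. g' y = g' x + w * (y - x)"
      by (rule lattice_motion_moves[OF g'l]) blast
    then have "norm w = 1" "g' = (\<lambda>z. w * z + g' 0)"
      using fourth_roots_norm by (auto simp: fun_eq_iff) (metis add.commute diff_zero)
    then show "direct_isometry g'" unfolding direct_isometry_def by blast
  next
    fix x assume x: "x \<in> flat X s2'" "fold_map X s2' x \<in> face X s1'"
    have x2: "h2 (g2 x) = x" using pointfree_idE[OF g2(3)] .
    obtain y where y: "y \<in> square u s2" "x = h2 y" using x(1) hs(2) side_vec by auto
    have gy: "g2 x = y" using y(2) pointfree_idE[OF g2(2)] by simp
    have "R *v fold_map X s2 y \<in> (\<lambda>x. R *v x) ` face X s1"
      using x(2) transports_carries[OF h(1)] unfolding y(2) hR2 carries_def by blast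
    then have "fold_map X s2 y \<in> face X s1"
      using cube_matrix_transpose(1)[OF R] by (metis imageE)
    then have "fold_map X s1 (g y) = fold_map X s2 y"
      using g(1) y(1) unfolding joined_def side_vec by blast
    moreover have "g' x = h1 (g y)" by (simp only: g'_def o_apply gy)
    ultimately show "fold_map X s1' (g' x) = fold_map X s2' x"
      by (simp only: hR) (simp only: y(2) hR2)
  qed
  moreover have "interior (strip t1') \<inter> flat X s1' \<inter> g' ` flat X s2' \<noteq> {}"
  proof -
    have "h1 ` (interior (strip t1) \<inter> square u s1 \<inter> g ` square u s2) \<noteq> {}" using g(2) by blast
    then have "h1 ` interior (strip t1) \<inter> h1 ` square u s1 \<inter> h1 ` g ` square u s2 \<noteq> {}" by blast
    then show ?thesis
      unfolding interior_motion[OF hl, symmetric] t(1) hs(1) gi[symmetric] hs(2) side_vec .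
  qed
  moreover have "g' ` strip t2' = strip t1'"
    unfolding t(2)[symmetric] gi g(3) by (rule t(1))
  ultimately show ?thesis unfolding continuation_def by blast
qed

lemma continuation_squares:
  assumes "((s1, t1), (s2, t2)) \<in> continuation X"
  shows "s1 \<in> squares X" "s2 \<in> squares X"
  using assms by (auto simp: continuation_def joined_def)

lemma transports_linked:
  assumes R: "R \<in> cube_matrices" and h: "transports R s1 s1' h1" "h1 ` strip t1 = strip t1'"
    and "((s1, t1), (s2, t2)) \<in> linked"
  obtains s2' h2 t2' where "transports R s2 s2' h2" "h2 ` strip t2 = strip t2'"
    "((s1', t1'), (s2', t2')) \<in> linked"
proof -
  have "\<exists>s2' h2 t2'. transports R (fst p) s2' h2 \<and> h2 ` strip (snd p) = strip t2' \<and>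
    ((s1', t1'), (s2', t2')) \<in> linked" if "((s1, t1), p) \<in> linked" for p
    using that unfolding linked_def
  proof (induction rule: rtrancl_induct)
    case base
    then show ?case using h by auto
  next
    case (step p q)
    obtain s t where p: "p = (s, t)" by (cases p)
    obtain r v where q: "q = (r, v)" by (cases q)
    obtain s' h t' where s': "transports R s s' h" "h ` strip t = strip t'"
      "((s1', t1'), (s', t')) \<in> (continuation X \<union> (continuation X)\<inverse>)\<^sup>*"
      using step.IH unfolding p fst_conv snd_conv by blast
    have "r \<in> squares X" using step(2) continuation_squares unfolding p q by blast
    then obtain r' h' where r': "transports R r r' h'" using transport_exists[OF R] by metis
    then have "h' \<in> lattice_motions u k" by (simp add: transports_def)
    then obtain v' where v': "h' ` strip v = strip v'" using motion_strip_exists by blast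
    \<comment> \<open>Chains use continuation in both directions; for a converse step the two
      transports exchange roles.\<close>
    have "((s', t'), (r', v')) \<in> continuation X \<union> (continuation X)\<inverse>"
      using step(2) transports_continuation[OF R s'(1) r' s'(2) v'] transports_continuation[OF R r' s'(1) v' s'(2)]
      unfolding p q by blast
    then have "((s1', t1'), (r', v')) \<in> (continuation X \<union> (continuation X)\<inverse>)\<^sup>*"
      using s'(3) rtrancl_into_rtrancl by metis
    then show ?case using r' v' unfolding q fst_conv snd_conv by blast
  qed
  from this[OF assms(4)] show ?thesis using that by auto
qed

text \<open>The lattice squares to which the cube can be rolled, starting with the piece \<open>p\<close> and
  following the strand \<open>t\<close> of the plane.\<close>

definition rolled :: "complex \<times> strand \<Rightarrow> strand \<Rightarrow> complex \<Rightarrow> bool" where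
  "rolled p t q \<longleftrightarrow> (\<exists>s1 t1 g. (p, (s1, t1)) \<in> linked \<and> s1 \<in> squares X \<and> g \<in> lattice_motions u k \<and>
     g ` square u s1 = square u q \<and> g ` strip t1 = strip t)"

text \<open>After one more roll the cube lies on the plane by \<open>g \<circ> g2\<close>, with
  \<open>g2\<close> the unfolding over the side that the strand crosses. The pieces are linked
  because the crossing point \<open>z\<close> is interior to the strand.\<close>

lemma rolled_step:
  assumes q: "q \<in> lattice_points u k" and e: "e \<in> fourth_roots" and r: "rolled p t q"
    and z: "z \<in> interior (strip t)" "z \<in> square u q" "z \<in> square u (q + u * e)"
  shows "rolled p t (q + u * e)"
proof -
  obtain s1 t1 g where g: "(p, (s1, t1)) \<in> linked" "s1 \<in> squares X" "g \<in> lattice_motions u k"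
     "g ` square u s1 = square u q" "g ` strip t1 = strip t"
    using r unfolding rolled_def by blast
  obtain w q' where w: "w \<in> fourth_roots" "q' \<in> lattice_points u k" "g = (\<lambda>x. centre u q' + w * (x - centre u s1))"
    by (rule lattice_motion_centre[OF g(3) square_lattice[OF g(2)]])
  have "square u q' = square u q" using rotate_square(1)[OF u w(1), of q' s1] g(4) w(3) by simp
  then have "q' = q" using square_inject[OF u w(2) q] by blast
  \<comment> \<open>The direction \<open>e\<close> as seen in the square \<open>s1\<close> of the
    net, before \<open>g\<close> turns it by \<open>w\<close>.\<close>
  define e' where "e' = inverse w * e"
  have e': "e' \<in> fourth_roots" using e w(1) by (simp add: e'_def fourth_roots_mult fourth_roots_inverse)
  have ew: "e = w * e'" using fourth_roots_nonzero[OF w(1)] by (simp add: e'_def)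
  have g_shift: "g ` square u (s1 + u * e') = square u (q + u * e)"
  proof -
    have "g = (\<lambda>x. centre u (q + u * e) + w * (x - centre u (s1 + u * e')))"
      unfolding w(3) \<open>q' = q\<close> ew by (auto simp: fun_eq_iff centre_eq algebra_simps)
    then show ?thesis using rotate_square(1)[OF u w(1)] by simp
  qed
  obtain s2 g2 where g2: "joined X s1 s2 g2" "g2 ` square u s2 = square u (s1 + u * e')"
    by (rule joined_exists[OF g(2) e'])
  have g2l: "g2 \<in> lattice_motions u k" by (rule joined_motion[OF g2(1)])
  obtain h2 where h2: "h2 \<in> lattice_motions u k" "g2 \<circ> h2 = id" "h2 \<circ> g2 = id"
    by (rule lattice_motion_inverse[OF g2l])
  obtain t2 where "h2 ` strip t1 = strip t2" using motion_strip_exists[OF h2(1)] by blast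
  then have t2: "g2 ` strip t2 = strip t1" using h2(2) by (metis image_comp image_id id_apply)
  obtain y where y: "y \<in> interior (strip t1)" "g y = z"
    using z(1) unfolding g(5)[symmetric] interior_motion[OF g(3)] by blast
  have ginj: "inj g" by (rule motion_inj[OF g(3)])
  have "y \<in> square u s1" "y \<in> square u (s1 + u * e')"
    using z(2,3) unfolding y(2)[symmetric] g(4)[symmetric] g_shift[symmetric]
    by (simp_all add: inj_image_mem_iff[OF ginj])
  then have "y \<in> interior (strip t1) \<inter> flat X s1 \<inter> g2 ` flat X s2"
    using y(1) g2(2) by (simp add: side_vec)
  then have "interior (strip t1) \<inter> flat X s1 \<inter> g2 ` flat X s2 \<noteq> {}" by blast
  then have "((s1, t1), (s2, t2)) \<in> continuation X"
    using g2(1) t2 by (simp add: continuation_def) blast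
  then have "(p, (s2, t2)) \<in> linked"
    using g(1) unfolding linked_def by (blast intro: rtrancl_into_rtrancl)
  moreover have "s2 \<in> squares X" using g2(1) by (simp add: joined_def)
  moreover have "g \<circ> g2 \<in> lattice_motions u k" using g(3) g2l by (rule lattice_motion_comp)
  moreover have "(g \<circ> g2) ` square u s2 = square u (q + u * e)"
    unfolding image_comp[symmetric] g2(2) g_shift ..
  moreover have "(g \<circ> g2) ` strip t2 = strip t"
    unfolding image_comp[symmetric] t2 g(5) ..
  ultimately show ?thesis unfolding rolled_def by blast
qed

lemma rolled_across:
  assumes q: "q \<in> lattice_points u k" "q' \<in> lattice_points u k" and r: "rolled p t q"
    and z: "z \<in> interior (strip t)" "z \<in> square u q" "z \<in> square u q'"
  shows "rolled p t q'"
proof -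
  have "z \<notin> lattice_points u k"
  proof
    assume "z \<in> lattice_points u k"
    then have "z \<in> gauss_ints" using u_gauss k by (auto simp: lattice_points_def)
    then show False using z(1) interior_strip_gauss_ints by blast
  qed
  then have "q = q' \<or> (\<exists>e \<in> fourth_roots. q' = q + u * e)"
    using meeting_squares[OF u q z(2,3)] by blast
  then show ?thesis using rolled_step[OF q(1) _ r z(1,2)] z(3) r by blast
qed

text \<open>Since no corner of a lattice square lies inside a strip, the squares containing a point of the
  open strip are equal or adjacent; so being rolled is locally constant along the strip.\<close>

lemma rolled_along:
  assumes q: "q \<in> lattice_points u k" "q' \<in> lattice_points u k" and r: "rolled p t q"
    and z: "z \<in> interior (strip t)" "z \<in> square u q" and z': "z' \<in> interior (strip t)" "z' \<in> square u q'"
  shows "rolled p t q'"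
proof -
  \<comment> \<open>All squares containing \<open>y\<close> are taken together, because a point on a
    common side belongs to two of them.\<close>
  define P where "P y \<longleftrightarrow> (\<forall>v \<in> lattice_points u k. y \<in> square u v \<longrightarrow> rolled p t v)" for y
  have "P z'"
  proof (rule connected_induction_simple[of "interior (strip t)" z z' P])
    show "connected (interior (strip t))"
      by (intro convex_connected convex_interior convex_strip)
    show "P z" unfolding P_def using rolled_across[OF q(1) _ r z] by blast
  next
    fix y assume y: "y \<in> interior (strip t)"
    obtain T where T: "open T" "y \<in> T"
      "\<And>x s. x \<in> T \<Longrightarrow> s \<in> lattice_points u k \<Longrightarrow> x \<in> square u s \<Longrightarrow> y \<in> square u s"
      by (rule squares_near[OF u, of y k]) blast
    have "P x'" if x: "x \<in> T" "x' \<in> T" "P x" for x x'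
    proof -
      obtain v where v: "v \<in> lattice_points u k" "x \<in> square u v" by (rule squares_cover[OF u])
      then have "rolled p t v" "y \<in> square u v" using x T(3) by (auto simp: P_def)
      then show ?thesis unfolding P_def using rolled_across[OF v(1) _ _ y] T(3) x(2) by blast
    qed
    then show "\<exists>T. openin (top_of_set (interior (strip t))) T \<and> y \<in> T \<and> (\<forall>x\<in>T. \<forall>x'\<in>T. P x \<longrightarrow> P x')"
      using T y by (intro exI[of _ "interior (strip t) \<inter> T"]) (auto intro: openin_open_Int)
  qed (use z z' in auto)
  then show ?thesis using q(2) z'(2) by (simp add: P_def)
qed

text \<open>A symmetry \<open>g\<close> of the plane takes \<open>t\<close> to \<open>t'\<close> but
  puts \<open>s\<close> on a square \<open>q\<close> that may lie far from the net. Rolling the cube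
  from \<open>s'\<close> to \<open>q\<close> along \<open>t'\<close> shows which face comes to lie
  on \<open>q\<close>; undoing that placement \<open>f\<close> gives a motion from \<open>s\<close>
  back into the net, which extends to a rotation.\<close>

lemma pieces_transitive:
  assumes p: "(s, t) \<in> pieces X" "(s', t') \<in> pieces X"
  obtains R s1 t1 h where "R \<in> cube_matrices" "transports R s s1 h" "h ` strip t = strip t1"
    "((s', t'), (s1, t1)) \<in> linked"
proof -
  have s: "s \<in> squares X" "s' \<in> squares X" using p by (auto simp: pieces_def)
  have "interior (strip t) \<inter> interior (square u s) \<noteq> {}" "interior (strip t') \<inter> interior (square u s') \<noteq> {}"
    using p strip_meets_interior by (auto simp: pieces_def side_vec)
  then obtain z z' where z: "z \<in> interior (strip t)" "z \<in> square u s" and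
    z': "z' \<in> interior (strip t')" "z' \<in> square u s'" using interior_subset by blast
  obtain g where g: "g \<in> lattice_motions u k" "g ` strip t = strip t'"
    by (rule strips_transitive[OF u_eq ab k])
  obtain q where q: "q \<in> lattice_points u k" "g ` square u s = square u q"
    using lattice_motion_square[OF u g(1) square_lattice[OF s(1)]] by metis
  have "id \<in> lattice_motions u k"
    using lattice_motion_by_point[of 1 k u k id] by simp
  then have "rolled (s', t') t' s'"
    unfolding rolled_def using s(2) by (intro exI[of _ s'] exI[of _ t'] exI[of _ id]) (simp add: linked_def)
  moreover have "g z \<in> interior (strip t')" "g z \<in> square u q"
    using z unfolding g(2)[symmetric] q(2)[symmetric] interior_motion[OF g(1)] by blast+
  ultimately have "rolled (s', t') t' q"
    using rolled_along[OF square_lattice[OF s(2)] q(1) _ z'] by blast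
  then obtain s1 t1 f where f: "((s', t'), (s1, t1)) \<in> linked" "s1 \<in> squares X" "f \<in> lattice_motions u k"
     "f ` square u s1 = square u q" "f ` strip t1 = strip t'"
    unfolding rolled_def by blast
  obtain f' where f': "f' \<in> lattice_motions u k" "f \<circ> f' = id" "f' \<circ> f = id"
    by (rule lattice_motion_inverse[OF f(3)])
  have ff: "f' ` f ` A = A" for A using f'(3) by (simp add: image_comp)
  have h: "f' \<circ> g \<in> lattice_motions u k" using f'(1) g(1) by (rule lattice_motion_comp)
  have hs: "(f' \<circ> g) ` square u s = square u s1" "(f' \<circ> g) ` strip t = strip t1"
    unfolding image_comp[symmetric] q(2) g(2) f(4,5)[symmetric] ff by simp_all
  obtain R where "R \<in> cube_matrices" "transports R s s1 (f' \<circ> g)"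
    by (rule transport_extends[OF s(1) f(2) h hs(1)])
  then show ?thesis using that hs(2) f(1) by blast
qed

lemma strands_transitive: "rotations_transitive_on_strands X"
  unfolding rotations_transitive_on_strands_def
proof (intro ballI)
  fix A B assume "A \<in> cube_strands X" "B \<in> cube_strands X"
  then obtain p q where pq: "p \<in> pieces X" "A = linked `` {p}" "q \<in> pieces X" "B = linked `` {q}"
    by (auto simp: cube_strands_def quotient_def linked_def)
  obtain s t where p: "p = (s, t)" by (cases p)
  obtain s' t' where q: "q = (s', t')" by (cases q)
  obtain R s1 t1 h where R: "R \<in> cube_matrices" and h: "transports R s s1 h" "h ` strip t = strip t1"
    and l1: "((s', t'), (s1, t1)) \<in> linked"
    using pieces_transitive pq(1,3) unfolding p q by metis
  have RT: "transpose R \<in> cube_matrices" by (rule cube_matrices_transpose[OF R])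
  obtain h' where h': "transports (transpose R) s1 s h'" "h' \<circ> h = id" "h \<circ> h' = id"
    by (rule transports_inverse[OF R h(1)])
  have h't: "h' ` strip t1 = strip t" unfolding h(2)[symmetric] image_comp h'(2) by simp
  show "\<exists>R. cube_rotation (norm (side_vec X)) R \<and>
        (\<forall>(s, t) \<in> A. \<exists>(s', t') \<in> B. carries X R s (strip t) s' (strip t')) \<and>
        (\<forall>(s', t') \<in> B. \<exists>(s, t) \<in> A. carries X R s (strip t) s' (strip t'))"
  proof (intro exI[of _ R] conjI ballI)
    show "cube_rotation (norm (side_vec X)) R"
      using R cube_rotation_iff[OF l_pos] by (simp add: side_vec l_def)
  next
    fix x assume x: "x \<in> A"
    obtain s2 t2 where x2: "x = (s2, t2)" by (cases x)
    have "((s, t), (s2, t2)) \<in> linked" using x by (simp add: pq(2) p x2)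
    then obtain s2' h2 t2' where 2: "transports R s2 s2' h2" "h2 ` strip t2 = strip t2'"
      "((s1, t1), (s2', t2')) \<in> linked"
      using transports_linked[OF R h] by metis
    have "(s2', t2') \<in> B" using linked_trans[OF l1 2(3)] by (simp add: pq(4) q)
    moreover have "carries X R s2 (strip t2) s2' (strip t2')"
      using transports_carries[OF 2(1), of "strip t2"] by (simp add: 2(2))
    ultimately show "case x of (s, t) \<Rightarrow> \<exists>(s', t') \<in> B. carries X R s (strip t) s' (strip t')"
      unfolding x2 by blast
  next
    fix x assume x: "x \<in> B"
    obtain s2 t2 where x2: "x = (s2, t2)" by (cases x)
    have "((s', t'), (s2, t2)) \<in> linked" using x by (simp add: pq(4) q x2)
    then have "((s1, t1), (s2, t2)) \<in> linked" using linked_trans linked_sym l1 by blast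
    then obtain s2' h2 t2' where 2: "transports (transpose R) s2 s2' h2" "h2 ` strip t2 = strip t2'"
      "((s, t), (s2', t2')) \<in> linked"
      using transports_linked[OF RT h'(1) h't] by metis
    have "(s2', t2') \<in> A" using 2(3) by (simp add: pq(2) p)
    moreover obtain f where f: "transports R s2' s2 f" "f \<circ> h2 = id"
      using transports_inverse[OF RT 2(1)] by (metis transpose_transpose)
    have "f ` strip t2' = strip t2" unfolding 2(2)[symmetric] image_comp f(2) by simp
    then have "carries X R s2' (strip t2') s2 (strip t2)"
      using transports_carries[OF f(1), of "strip t2'"] by simp
    ultimately show "case x of (s', t') \<Rightarrow> \<exists>(s, t) \<in> A. carries X R s (strip t) s' (strip t')"
      unfolding x2 by blast
  qed
qed

end

section \<open>Centres of rotation\<close>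

text \<open>Rewritten about \<open>k\<close>, the rotation has translation part
  \<open>(1 - w) * (x - k)\<close>, which has to be a Gaussian multiple of \<open>u\<close>.\<close>

lemma rotation_about_motion:
  assumes u: "u \<noteq> 0"
  shows "rotation_about x w \<in> lattice_motions u k \<longleftrightarrow>
    w \<in> fourth_roots \<and> (1 - w) * ((x - k) / u) \<in> gauss_ints"
proof
  assume "rotation_about x w \<in> lattice_motions u k"
  then obtain v z where v: "v \<in> fourth_roots" "z \<in> gauss_ints"
    "rotation_about x w = (\<lambda>x. k + v * (x - k) + u * z)"
    by (auto simp: lattice_motions_def)
  then have eq: "x + w * (y - x) = k + v * (y - k) + u * z" for y
    by (metis rotation_about_def)
  have "w = v" using eq[of 0] eq[of 1] by (simp add: algebra_simps)
  moreover have "u * z = (1 - w) * (x - k)"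
    using eq[of k] by (simp add: algebra_simps)
  then have "(1 - w) * ((x - k) / u) = z" using u by (simp add: field_simps)
  ultimately show "w \<in> fourth_roots \<and> (1 - w) * ((x - k) / u) \<in> gauss_ints" using v by simp
next
  assume a: "w \<in> fourth_roots \<and> (1 - w) * ((x - k) / u) \<in> gauss_ints"
  have "rotation_about x w y = k + w * (y - k) + u * ((1 - w) * ((x - k) / u))" for y
  proof -
    have "u * ((1 - w) * ((x - k) / u)) = (1 - w) * (x - k)" using u by simp
    then show ?thesis by (simp add: rotation_about_def algebra_simps)
  qed
  then show "rotation_about x w \<in> lattice_motions u k"
    unfolding lattice_motions_def using a by blast
qed

lemma mem_side_midpoints:
  assumes "u \<noteq> 0"
  shows "x \<in> side_midpoints u s \<longleftrightarrow> (x - centre u s) / u \<in> {1 / 2, - 1 / 2, \<i> / 2, - \<i> / 2}"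
proof -
  define y where "y = (x - centre u s) / u"
  have x: "x = centre u s + u * y" using assms by (simp add: y_def)
  have inj: "centre u s + u * a = centre u s + u * b \<longleftrightarrow> a = b" for a b using assms by simp
  have "side_midpoints u s = (\<lambda>z. centre u s + u * z) ` {- \<i> / 2, 1 / 2, \<i> / 2, - 1 / 2}"
    by (simp add: side_midpoints_def midpoint_def centre_eq scaleR_conv_of_real algebra_simps
        add_divide_distrib diff_divide_distrib)
  then have "x \<in> side_midpoints u s \<longleftrightarrow> y \<in> {- \<i> / 2, 1 / 2, \<i> / 2, - 1 / 2}"
    unfolding x by (simp only: image_iff inj bex_simps) blast
  then show ?thesis unfolding y_def by blast
qed

lemma half_integer_cases:
  assumes "2 * r \<in> \<int>" "\<bar>r - 1 / 2\<bar> \<le> (1 / 2 :: real)"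
  shows "r = 0 \<or> r = 1 / 2 \<or> r = 1"
proof -
  obtain n :: int where n: "2 * r = of_int n" using assms(1) by (auto elim: Ints_cases)
  then have "of_int 0 \<le> (of_int n :: real)" "of_int n \<le> (of_int 2 :: real)" using assms(2) by linarith+
  then have "0 \<le> n" "n \<le> 2" unfolding of_int_le_iff .
  then have "n = 0 \<or> n = 1 \<or> n = 2" by linarith
  then show ?thesis using n by auto
qed

text \<open>With \<open>p\<close> and \<open>q\<close> measured from the first corner, both between
  0 and 1, a half-turn asks for \<open>2 * p\<close> and \<open>2 * q\<close> to be integral. A
  quarter-turn asks for \<open>p + q\<close> and \<open>q - p\<close>, which excludes one half with
  one integer and so the middles of sides.\<close>

lemma centres_in_square:
  assumes z: "z \<in> half_box" and w: "w \<in> fourth_roots" "w \<noteq> 1"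
  shows "(1 - w) * (z + (1 + \<i>) / 2) \<in> gauss_ints \<longleftrightarrow>
    z = 0 \<or> z \<in> box_corners \<or> z \<in> {1 / 2, - 1 / 2, \<i> / 2, - \<i> / 2} \<and> w = - 1"
proof -
  define p q where "p = Re z + 1 / 2" and "q = Im z + 1 / 2"
  have zpq: "z + (1 + \<i>) / 2 = Complex p q" by (simp add: complex_eq_iff p_def q_def)
  have pq: "\<bar>p - 1 / 2\<bar> \<le> 1 / 2" "\<bar>q - 1 / 2\<bar> \<le> 1 / 2"
    using z by (simp_all add: half_box_def p_def q_def)
  have halves: "2 * p \<in> \<int> \<Longrightarrow> p = 0 \<or> p = 1 / 2 \<or> p = 1" "2 * q \<in> \<int> \<Longrightarrow> q = 0 \<or> q = 1 / 2 \<or> q = 1"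
    using half_integer_cases pq by blast+
  have half: "r * 2 \<noteq> 1" if r: "r \<in> \<int>" for r :: real
  proof
    assume "r * 2 = 1"
    moreover obtain n :: int where "r = of_int n" using r by (rule Ints_cases)
    ultimately have "of_int (n * 2) = (of_int 1 :: real)" by simp
    then have "n * 2 = 1" unfolding of_int_eq_iff .
    then show False by presburger
  qed
  have R: "z = 0 \<longleftrightarrow> p = 1 / 2 \<and> q = 1 / 2"
    "z \<in> box_corners \<longleftrightarrow> (p = 0 \<or> p = 1) \<and> (q = 0 \<or> q = 1)"
    "z \<in> {1 / 2, - 1 / 2, \<i> / 2, - \<i> / 2} \<longleftrightarrow> (p = 0 \<or> p = 1) \<and> q = 1 / 2 \<or> p = 1 / 2 \<and> (q = 0 \<or> q = 1)"
    by (auto simp: p_def q_def complex_eq_iff box_corners_def)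
  show ?thesis
  proof (cases "w = - 1")
    case True
    have "(1 - w) * (z + (1 + \<i>) / 2) \<in> gauss_ints \<longleftrightarrow> 2 * p \<in> \<int> \<and> 2 * q \<in> \<int>"
      unfolding zpq True by (simp add: gauss_ints_def)
    also have "\<dots> \<longleftrightarrow> (p = 0 \<or> p = 1 / 2 \<or> p = 1) \<and> (q = 0 \<or> q = 1 / 2 \<or> q = 1)"
    proof -
      have "2 * r \<in> \<int>" if "r = 0 \<or> r = 1 / 2 \<or> r = 1" for r :: real
        using that by (elim disjE) (erule ssubst, simp)+
      then show ?thesis using halves by blast
    qed
    finally show ?thesis unfolding R using True by blast
  next
    case False
    then have w': "w = \<i> \<or> w = - \<i>" using w by (auto simp: fourth_roots_def)
    have "(1 - w) * (z + (1 + \<i>) / 2) \<in> gauss_ints \<longleftrightarrow> p + q \<in> \<int> \<and> q - p \<in> \<int>"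
      unfolding zpq using w'
    proof
      assume "w = \<i>"
      then show "(1 - w) * Complex p q \<in> gauss_ints \<longleftrightarrow> p + q \<in> \<int> \<and> q - p \<in> \<int>"
        by (simp add: gauss_ints_def)
    next
      assume w: "w = - \<i>"
      have "p - q \<in> \<int> \<longleftrightarrow> q - p \<in> \<int>" using Ints_minus[of "p - q"] Ints_minus[of "q - p"] by auto
      then show "(1 - w) * Complex p q \<in> gauss_ints \<longleftrightarrow> p + q \<in> \<int> \<and> q - p \<in> \<int>"
        unfolding w by (simp add: gauss_ints_def conj_commute add.commute)
    qed
    also have "\<dots> \<longleftrightarrow> p = 1 / 2 \<and> q = 1 / 2 \<or> (p = 0 \<or> p = 1) \<and> (q = 0 \<or> q = 1)"
    proof
      assume i: "p + q \<in> \<int> \<and> q - p \<in> \<int>"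
      then have "(p + q) - (q - p) \<in> \<int>" "(p + q) + (q - p) \<in> \<int>" by (metis Ints_diff Ints_add)+
      then have "2 * p \<in> \<int>" "2 * q \<in> \<int>" by simp_all
      then show "p = 1 / 2 \<and> q = 1 / 2 \<or> (p = 0 \<or> p = 1) \<and> (q = 0 \<or> q = 1)"
        using halves i half by auto
    next
      assume "p = 1 / 2 \<and> q = 1 / 2 \<or> (p = 0 \<or> p = 1) \<and> (q = 0 \<or> q = 1)"
      moreover have "p + q \<in> \<int> \<and> q - p \<in> \<int>" if "p = 1 / 2 \<and> q = 1 / 2"
      proof -
        have "p + q = 1" "q - p = 0" using that by simp_all
        then show ?thesis by (simp only: Ints_0 Ints_1 simp_thms)
      qed
      ultimately show "p + q \<in> \<int> \<and> q - p \<in> \<int>" by auto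
    qed
    finally show ?thesis unfolding R using False by blast
  qed
qed

section \<open>The defining conditions of the perfectly coloured woven cube\<close>

context striped_net
begin

text \<open>The inverse \<open>h\<close> of an unfolding is again a symmetry of the fabric; the
  strand or cell on the far side is the image under \<open>h\<close>.\<close>

lemma woven: "woven_cube F X"
  unfolding woven_cube_def
proof (intro conjI allI impI)
  show "cube_net X" by (rule cube_net)
next
  fix s s' g t assume "joined X s s' g"
  then have gl: "g \<in> lattice_motions u k" by (rule joined_motion)
  obtain h where h: "h \<in> lattice_motions u k" "g \<circ> h = id" by (rule lattice_motion_inverse[OF gl])
  obtain t' where t': "h ` strip t = strip t'" using motion_strip_exists[OF h(1)] by blast
  have "g ` strip t' = strip t" unfolding t'[symmetric] image_comp h(2) by simp
  then show "\<exists>t'. g ` strip t' = strip t" by blast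
next
  fix s s' g i j assume "joined X s s' g"
  then have gl: "g \<in> lattice_motions u k" by (rule joined_motion)
  obtain h where h: "h \<in> lattice_motions u k" "g \<circ> h = id" by (rule lattice_motion_inverse[OF gl])
  obtain i' j' where c: "h ` cell i j = cell i' j'"
    "h ` strip (top_strand F i j) = strip (top_strand F i' j')"
    by (rule motion_cell[OF h(1)])
  have "g ` cell i' j' = cell i j" "g ` strip (top_strand F i' j') = strip (top_strand F i j)"
    unfolding c[symmetric] image_comp h(2) by simp_all
  then show "\<exists>i' j'. g ` cell i' j' = cell i j \<and> g ` strip (top_strand F i' j') = strip (top_strand F i j)"
    by blast
qed

lemma woven_alike: "faces_woven_alike F X"
  unfolding faces_woven_alike_def
proof (intro ballI)
  fix s s' assume s: "s \<in> squares X" "s' \<in> squares X"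
  define g where "g = (\<lambda>x. centre u s' + 1 * (x - centre u s))"
  have gl: "g \<in> lattice_motions u k"
    unfolding g_def by (rule rotation_of_square) (simp_all add: s square_lattice)
  have "g = (\<lambda>z. 1 * z + (centre u s' - centre u s))" by (simp add: g_def fun_eq_iff)
  then have "direct_isometry g" unfolding direct_isometry_def using norm_one by blast
  moreover have "g ` flat X s = flat X s'"
    unfolding g_def side_vec by (rule rotate_square(1)[OF u]) simp
  ultimately show "\<exists>g. direct_isometry g \<and> g ` flat X s = flat X s' \<and>
        (\<forall>i j. cell_shows X s i j \<longrightarrow> (\<exists>i' j'. g ` cell i j = cell i' j' \<and>
              g ` strip (top_strand F i j) = strip (top_strand F i' j')))"
    using motion_cell[OF gl] by (intro exI[of _ g] conjI allI impI) metis+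
qed

lemma rotations_weaving_symmetries:
  assumes "R \<in> cube_matrices"
  shows "weaving_symmetry F X R"
  unfolding weaving_symmetry_def
proof (intro allI impI)
  fix s i j assume "cell_shows X s i j"
  then have s: "s \<in> squares X" by (simp add: cell_shows_def)
  obtain s' h where h: "transports R s s' h" by (rule transport_exists[OF assms s])
  then have "h \<in> lattice_motions u k" by (simp add: transports_def)
  then obtain i' j' where "h ` cell i j = cell i' j'" "h ` strip (top_strand F i j) = strip (top_strand F i' j')"
    by (rule motion_cell)
  then show "\<exists>s' i' j'. carries X R s (cell i j) s' (cell i' j') \<and>
           carries X R s (strip (top_strand F i j)) s' (strip (top_strand F i' j'))"
    using transports_carries[OF h] by metis
qed

lemma expected_centres: "only_expected_centres F X"
  unfolding only_expected_centres_def
proof (intro ballI allI impI)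
  fix x w e assume "x \<in> (\<Union>s\<in>squares X. flat X s)" and w: "cmod w = 1 \<and> w \<noteq> 1"
  then obtain s where s: "s \<in> squares X" "x \<in> square u s" by (auto simp: side_vec)
  \<comment> \<open>Any square of the net may account for \<open>x\<close> as a centre, corner or
    midpoint, and such a square contains \<open>x\<close>; hence the claim for every square
    containing it.\<close>
  have key: "rotation_about x w \<in> lattice_motions u k \<longleftrightarrow>
      (x = centre u s \<or> x \<in> corners u s) \<and> w ^ 4 = 1 \<or> x \<in> side_midpoints u s \<and> w = - 1"
    if s: "s \<in> squares X" "x \<in> square u s" for s
  proof (cases "w \<in> fourth_roots")
    case False
    then show ?thesis
      unfolding rotation_about_motion[OF u] by (auto simp: fourth_roots_iff)
  next
    case True
    define z where "z = (x - centre u s) / u"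
    obtain v where v: "v \<in> gauss_ints" "s = k + u * v"
      using square_lattice[OF s(1)] by (auto simp: lattice_points_def)
    have "(x - k) / u = v + (z + (1 + \<i>) / 2)"
      using u by (simp add: z_def v(2) centre_eq field_simps)
    then have "(1 - w) * ((x - k) / u) = (1 - w) * v + (1 - w) * (z + (1 + \<i>) / 2)"
      by (simp add: distrib_left)
    \<comment> \<open>Moving the square by a lattice vector changes the value by a Gaussian integer,
      so one model square settles all.\<close>
    moreover have "(1 - w) * v \<in> gauss_ints" using v(1) True fourth_roots_gauss by auto
    ultimately have "(1 - w) * ((x - k) / u) \<in> gauss_ints \<longleftrightarrow> (1 - w) * (z + (1 + \<i>) / 2) \<in> gauss_ints"
      using gauss_ints_simps(4,5) by (metis add_diff_cancel_left')
    moreover have "z \<in> half_box" using s(2) by (simp add: mem_square[OF u] z_def)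
    moreover have "z = 0 \<longleftrightarrow> x = centre u s" using u by (simp add: z_def)
    ultimately show ?thesis
      using centres_in_square[of z w] True w
      unfolding rotation_about_motion[OF u] mem_corners[OF u] mem_side_midpoints[OF u] z_def[symmetric]
        fourth_roots_iff[symmetric] by blast
  qed
  have c: "centre u s' \<in> square u s'" "corners u s' \<subseteq> square u s'" "side_midpoints u s' \<subseteq> square u s'" for s'
  proof -
    have "{1 / 2, - 1 / 2, \<i> / 2, - \<i> / 2} \<subseteq> half_box" by (simp add: half_box_def)
    then show "side_midpoints u s' \<subseteq> square u s'"
      unfolding subset_iff mem_square[OF u] mem_side_midpoints[OF u] by blast
    show "centre u s' \<in> square u s'" by (simp add: mem_square[OF u] half_box_def)
  qed (rule corners_subset_square)
  have "rotation_about x w \<in> lattice_motions u k \<longleftrightarrow> (\<exists>s \<in> squares X.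
      (x = centre u s \<or> x \<in> corners u s) \<and> w ^ 4 = 1 \<or> x \<in> side_midpoints u s \<and> w = - 1)"
    using key s c by blast
  then show "((rotation_about x w, e) \<in> symmetry_group F) = (\<not> e \<and>
           (\<exists>s\<in>squares X. (x = centre (side_vec X) s \<or> x \<in> corners (side_vec X) s) \<and> w ^ 4 = 1 \<or>
              x \<in> side_midpoints (side_vec X) s \<and> w = - 1))"
    unfolding symmetries side_vec by auto
qed

lemma isonemal: "isonemal_woven_cube F X"
  unfolding isonemal_woven_cube_def side_vec
  using woven woven_alike rotations_weaving_symmetries strands_transitive expected_centres
    cube_rotation_iff[OF l_pos] by (simp add: l_def)

lemma perfectly_coloured: "perfectly_coloured_isonemal_woven_cube F \<kappa> X"
  unfolding perfectly_coloured_isonemal_woven_cube_def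
proof (intro conjI allI impI)
  show "isonemal_woven_cube F X" by (rule isonemal)
  show "\<forall>((s, t), (s', t')) \<in> continuation X. \<kappa> t' = \<kappa> t"
    using continuation_colour by (auto simp: continuation_def)
  fix R assume "cube_rotation (norm (side_vec X)) R"
  then have "R \<in> cube_matrices" using cube_rotation_iff[OF l_pos] by (simp add: side_vec l_def)
  then obtain p where p: "\<And>s i j s' i' j'. cell_shows X s i j \<Longrightarrow>
      carries X R s (cell i j) s' (cell i' j') \<Longrightarrow>
      \<kappa> (top_strand F i' j') = \<kappa> (top_strand F i j) \<longleftrightarrow> p"
    by (rule rotation_recolours) blast
  show "(\<forall>s i j s' i' j'. cell_shows X s i j \<and> carries X R s (cell i j) s' (cell i' j') \<longrightarrow>
           \<kappa> (top_strand F i' j') = \<kappa> (top_strand F i j)) \<or>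
        (\<forall>s i j s' i' j'. cell_shows X s i j \<and> carries X R s (cell i j) s' (cell i' j') \<longrightarrow>
           \<kappa> (top_strand F i' j') \<noteq> \<kappa> (top_strand F i j))"
    using p by (cases p) blast+
qed

end

section \<open>A net of the cube\<close>

lemma placed_isometry:
  assumes "u \<noteq> 0" "M \<in> cube_matrices"
  shows "dist (placed u M s x) (placed u M s y) = dist x y"
proof -
  have "dist (M *v v) (M *v v') = dist v v'" for v v'
    unfolding dist_norm norm_eq_sqrt_inner matrix_vector_mult_diff_distrib[symmetric]
    by (simp add: cube_matrix_inner[OF assms(2)])
  then have "dist (placed u M s x) (placed u M s y) =
      norm u * norm ((x - centre u s) / u - (y - centre u s) / u)"
    using assms(1) by (simp add: placed_def dist_top_face flip: dist_norm)
  also have "(x - centre u s) / u - (y - centre u s) / u = (x - y) / u"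
    by (simp add: diff_divide_distrib)
  finally show ?thesis using assms(1) by (simp add: norm_divide dist_norm)
qed

text \<open>A rotation commutes with the cross product, so the sign is that of the model: the upper
  face at height \<open>l / 2\<close> with upward normal.\<close>

lemma placed_outward:
  assumes u: "u \<noteq> 0" and M: "M \<in> cube_matrices"
  shows "cross3 (placed u M s 1 - placed u M s 0) (placed u M s \<i> - placed u M s 0)
    \<bullet> placed u M s (centre u s) > 0"
proof -
  define l v where "l = norm u" and "v = 1 / u"
  have l: "l > 0" and v: "v \<noteq> 0" using u by (simp_all add: l_def v_def)
  define c where "c = (0 - centre u s) / u"
  have d: "(1 - centre u s) / u = c + v" "(\<i> - centre u s) / u = c + \<i> * v"
    by (simp_all add: c_def v_def diff_divide_distrib)
  have t: "top_face l (c + z) - top_face l c = vector [l * Re z, l * Im z, 0]" for z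
    by (simp add: top_face_def vec_eq_iff forall_3 algebra_simps)
  have "rotation_matrix M" using M by (simp add: cube_matrices_def)
  then have cr: "cross3 (placed u M s 1 - placed u M s 0) (placed u M s \<i> - placed u M s 0) =
      M *v cross3 (vector [l * Re v, l * Im v, 0]) (vector [l * - Im v, l * Re v, 0])"
    unfolding placed_def l_def[symmetric] d c_def[symmetric] matrix_vector_mult_diff_distrib[symmetric] t
    by (simp add: cross_rotation_matrix)
  have ce: "placed u M s (centre u s) = M *v vector [0, 0, l / 2]"
    by (simp add: placed_def l_def top_face_def)
  have "cross3 (placed u M s 1 - placed u M s 0) (placed u M s \<i> - placed u M s 0)
      \<bullet> placed u M s (centre u s) = l ^ 3 / 2 * ((Re v)\<^sup>2 + (Im v)\<^sup>2)"
    unfolding cr ce cube_matrix_inner[OF M]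
    by (simp add: inner_vec_def sum_3 cross3_def power2_eq_square power3_eq_cube algebra_simps)
  moreover have "(Re v)\<^sup>2 + (Im v)\<^sup>2 > 0" using v by (simp add: sum_power2_gt_zero_iff complex_eq_iff)
  then have "l ^ 3 / 2 * ((Re v)\<^sup>2 + (Im v)\<^sup>2) > 0" using l by simp
  ultimately show ?thesis by simp
qed

text \<open>On the common side the normalised coordinate has component 1 / 2 along \<open>e\<close>;
  this is the edge of \<open>tilt_edge\<close>, where both squares are folded to the same
  points.\<close>

lemma placed_tilted:
  assumes u: "u \<noteq> 0" and e: "e \<in> fourth_roots"
    and x: "x \<in> square u s" "x \<in> square u (s + u * e)"
  shows "placed u (M ** tilt e) (s + u * e) x = placed u M s x"
proof -
  define z where "z = (x - centre u s) / u"
  have "(x - centre u (s + u * e)) / u = z - e"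
    using u by (simp add: z_def centre_eq field_simps)
  moreover have "z \<in> half_box" "z - e \<in> half_box"
    using x calculation by (simp_all add: mem_square[OF u] z_def)
  then have "cnj e * z \<in> half_box" "cnj e * (z - e) \<in> half_box"
    using half_box_rotate[OF fourth_roots_cnj[OF e]] by blast+
  moreover have "cnj e * (z - e) = cnj e * z - 1"
    using e by (auto simp: fourth_roots_def algebra_simps)
  ultimately have "Re (cnj e * (z - e)) = - 1 / 2"
    unfolding half_box_def mem_Collect_eq by (simp only: minus_complex.simps one_complex.simps) linarith
  then have "(tilt e *v top_face (norm u) (z - e)) $ 3 = norm u / 2"
    unfolding tilt_height by simp
  then have "tilt e *v top_face (norm u) (z - e) = top_face (norm u) z"
    using tilt_edge[OF e, of "norm u" "z - e"] u by simp
  then show ?thesis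
    unfolding placed_def \<open>(x - centre u (s + u * e)) / u = z - e\<close> z_def[symmetric]
    by (simp flip: matrix_vector_mul_assoc)
qed

text \<open>A net in the shape of a Latin cross: the upper face in the middle, the lower face at distance 2.\<close>

definition cross_shape :: "complex set" where
  "cross_shape = {0, 1, \<i>, - 1, - \<i>, 2}"

text \<open>The frames obtained by rolling over sides from the middle square: one tilt for each arm,
  two in the direction \<open>1\<close> for the far end.\<close>

definition cross_frame :: "complex \<Rightarrow> real^3^3" where
  "cross_frame z = (if z = 0 then mat 1 else if z = 2 then tilt 1 ** tilt 1 else tilt z)"

definition cross_net :: "complex \<Rightarrow> complex \<Rightarrow> net" where
  "cross_net u k = \<lparr>side_vec = u, squares = (\<lambda>z. k + u * z) ` cross_shape,
     fold_map = (\<lambda>s. placed u (cross_frame ((s - k) / u)) s)\<rparr>"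

lemma cross_shape_cases: "z \<in> cross_shape \<longleftrightarrow> z = 0 \<or> z \<in> fourth_roots \<or> z = 2"
  by (auto simp: cross_shape_def fourth_roots_def)

lemma cross_frame_cube_matrices:
  assumes "z \<in> cross_shape"
  shows "cross_frame z \<in> cube_matrices"
proof -
  have "mat 1 \<in> cube_matrices"
  proof -
    have "(mat 1 :: real^3^3) $ i $ j \<in> \<int>" for i j by (simp add: mat_def)
    then show ?thesis by (simp add: cube_matrices_def rotation_matrix_def orthogonal_matrix_id)
  qed
  moreover have "2 \<noteq> (0 :: complex)" by simp
  ultimately show ?thesis
    using assms tilt_cube_matrices cube_matrices_mult fourth_roots_1
    unfolding cross_shape_cases cross_frame_def by auto
qed

text \<open>Each square but the middle one gets its frame by one tilt from its predecessor towards
  the middle. Of two adjacent squares either may be the predecessor, hence the two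
  alternatives.\<close>

lemma cross_frame_step:
  assumes "z \<in> cross_shape" "z + e \<in> cross_shape" "e \<in> fourth_roots"
  shows "cross_frame (z + e) = cross_frame z ** tilt e \<or> cross_frame z = cross_frame (z + e) ** tilt (- e)"
proof -
  have root: "v \<noteq> 0 \<and> v \<noteq> 2" if "v \<in> fourth_roots" for v
    using fourth_roots_norm[OF that] by auto
  \<comment> \<open>All adjacencies of the cross: the middle with its four arms, and
    \<open>1\<close> with \<open>2\<close>, each in both orders.\<close>
  consider "z = 0" | "z + e = 0" | "z = 1" "e = 1" | "z = 2" "e = - 1"
    using assms by (auto simp: cross_shape_def fourth_roots_def complex_eq_iff)
  then show ?thesis
  proof cases
    case 1
    then show ?thesis using root[OF assms(3)] by (simp add: cross_frame_def)
  next
    case 2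
    then have "z = - e" by (simp add: eq_neg_iff_add_eq_0)
    moreover have "- e \<in> fourth_roots" using assms(3) by (auto simp: fourth_roots_def)
    ultimately show ?thesis using root[of "- e"] 2 by (simp add: cross_frame_def)
  qed (auto simp: cross_frame_def)
qed

lemma cross_frame_normals: "bij_betw (\<lambda>z. cross_frame z *v up) cross_shape axes"
proof -
  define N where "N z = cross_frame z *v up" for z
  have N: "N 0 = vector [0, 0, 1]" "N 1 = vector [1, 0, 0]" "N \<i> = vector [0, 1, 0]"
    "N (- 1) = vector [- 1, 0, 0]" "N (- \<i>) = vector [0, - 1, 0]" "N 2 = vector [0, 0, - 1]"
  proof -
    have 2: "2 \<noteq> (1 :: complex)" "2 \<noteq> \<i>" "\<i> \<noteq> 2" "- 1 \<noteq> (2 :: complex)" "- \<i> \<noteq> 2"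
      by (simp_all add: complex_eq_iff)
    show "N 0 = vector [0, 0, 1]"
      unfolding N_def cross_frame_def by (simp add: vec_eq_iff forall_3) (simp add: up_component)
    show "N 1 = vector [1, 0, 0]" "N \<i> = vector [0, 1, 0]"
      "N (- 1) = vector [- 1, 0, 0]" "N (- \<i>) = vector [0, - 1, 0]"
      using 2 by (simp_all add: N_def cross_frame_def tilt_up)
    show "N 2 = vector [0, 0, - 1]"
    proof -
      have "tilt 1 *v vector [1, 0, 0] = vector [0, 0, - 1]"
        by (simp add: tilt_def vec_eq_iff forall_3 matrix_vector_3 spin_def flip: matrix_vector_mul_assoc)
      then show ?thesis by (simp add: N_def cross_frame_def tilt_up flip: matrix_vector_mul_assoc)
    qed
  qed
  have "axes = {axis 3 1, axis 1 1, axis 2 1, axis 1 (- 1), axis 2 (- 1), axis 3 (- 1)}"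
    unfolding axes_def using exhaust_3 by (auto; metis)
  also have "\<dots> = {vector [0, 0, 1], vector [1, 0, 0], vector [0, 1, 0],
      vector [- 1, 0, 0], vector [0, - 1, 0], vector [0, 0, - 1]}"
  proof -
    have "axis 3 1 = (vector [0, 0, 1] :: real^3)" "axis 1 1 = (vector [1, 0, 0] :: real^3)"
      "axis 2 1 = (vector [0, 1, 0] :: real^3)" "axis 1 (- 1) = (vector [- 1, 0, 0] :: real^3)"
      "axis 2 (- 1) = (vector [0, - 1, 0] :: real^3)" "axis 3 (- 1) = (vector [0, 0, - 1] :: real^3)"
      by (simp_all add: vec_eq_iff forall_3 axis_def)
    then show ?thesis by (simp only:)
  qed
  also have "\<dots> = N ` cross_shape" by (simp add: cross_shape_def N)
  finally have "axes = N ` cross_shape" .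
  moreover have "inj_on N cross_shape"
    by (simp add: inj_on_def cross_shape_def N vec_eq_iff forall_3)
  ultimately have "bij_betw N cross_shape axes" by (simp add: bij_betw_def)
  then show ?thesis by (simp add: N_def[abs_def])
qed

lemma cube_net_cross_net:
  assumes u: "u \<noteq> 0"
  shows "cube_net (cross_net u k)"
proof -
  let ?X = "cross_net u k"
  define s where "s z = k + u * z" for z
  have sq: "squares ?X = s ` cross_shape" and sv: "side_vec ?X = u"
    by (simp_all add: cross_net_def s_def)
  have fm: "fold_map ?X (s z) = placed u (cross_frame z) (s z)" for z
    using u by (simp add: cross_net_def s_def)
  have s_add: "s (z + e) = s z + u * e" for z e by (simp add: s_def algebra_simps)
  have s_inj: "s z = s z' \<longleftrightarrow> z = z'" for z z' using u by (simp add: s_def)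
  have lat: "s z \<in> lattice_points u k" if "z \<in> cross_shape" for z
    using that by (auto simp: s_def lattice_points_def cross_shape_def gauss_ints_def)
  define L where "L = {(p, q). p \<in> squares ?X \<and> q \<in> squares ?X \<and> meet_along_side (flat ?X p) (flat ?X q)}"
  have step: "(s z, s (z + e)) \<in> L" if "z \<in> cross_shape" "z + e \<in> cross_shape" "e \<in> fourth_roots" for z e
    using that adjacent_squares_meet[OF that(3) u, of "s z"] by (simp add: L_def sq sv s_add)
      (metis imageI s_add)
  have connected: "(p, q) \<in> L\<^sup>*" if pq: "p \<in> squares ?X" "q \<in> squares ?X" for p q
  proof -
    have 0: "(s 0, s z) \<in> L\<^sup>*" if z: "z \<in> cross_shape" for z
    proof -
      have r: "(s 0, s e) \<in> L" if "e \<in> fourth_roots" for e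
        using step[of 0 e] that by (simp add: cross_shape_cases)
      have "(s 1, s 2) \<in> L" using step[of 1 1] by (simp add: cross_shape_cases)
      then have "(s 0, s 2) \<in> L\<^sup>*" using r[of 1] by (meson fourth_roots_1 r_into_rtrancl rtrancl_into_rtrancl)
      then show ?thesis using z r unfolding cross_shape_cases by blast
    qed
    have "sym L" unfolding sym_def L_def meet_along_side_def by (auto simp: Int_commute)
    then have "sym (L\<^sup>*)" by (rule sym_rtrancl)
    then show ?thesis using 0 pq unfolding sq by (blast intro: rtrancl_trans dest: symD)
  qed
  have glued: "fold_map ?X p x = fold_map ?X q x"
    if pq: "p \<in> squares ?X" "q \<in> squares ?X" and meet: "meet_along_side (flat ?X p) (flat ?X q)"
      and xpq: "x \<in> flat ?X p \<inter> flat ?X q" for p q x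
  proof -
    obtain z z' where z: "z \<in> cross_shape" "p = s z" "z' \<in> cross_shape" "q = s z'"
      using pq unfolding sq by blast
    obtain e where e: "e \<in> fourth_roots" "q = p + u * e"
      using meet_along_side_squares[OF u lat[OF z(1)] lat[OF z(3)]] meet unfolding sv z(2,4) by metis
    then have z': "z' = z + e" using s_inj unfolding z(2,4) s_add[symmetric] by simp
    have e': "- e \<in> fourth_roots" using e(1) by (auto simp: fourth_roots_def)
    have x: "x \<in> square u (s z)" "x \<in> square u (s (z + e))" using xpq unfolding sv z(2,4) z' by auto
    have reverse: "s z = s (z + e) + u * - e" by (simp add: s_add)
    from cross_frame_step[OF z(1) _ e(1)] z(3) z' consider
      "cross_frame (z + e) = cross_frame z ** tilt e" | "cross_frame z = cross_frame (z + e) ** tilt (- e)" by auto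
    then show ?thesis
    proof cases
      case 1
      then show ?thesis
        using placed_tilted[OF u e(1) x(1) x(2)[unfolded s_add]]
        unfolding z(2,4) z' fm s_add[symmetric] by simp
    next
      case 2
      then show ?thesis
        using placed_tilted[OF u e' x(2)] x(1) unfolding z(2,4) z' fm reverse[symmetric] by simp
    qed
  qed
  have face: "face ?X (s z) = cube_face (norm u) (cross_frame z *v up)" if "z \<in> cross_shape" for z
    unfolding face_def fm sv by (rule placed_face[OF u cross_frame_cube_matrices[OF that]])
  have bij: "bij_betw (face ?X) (squares ?X) (cube_faces (norm u))"
  proof -
    have "bij_betw (cube_face (norm u)) axes (cube_faces (norm u))"
      using cube_face_inject[of _ _ "norm u"] u unfolding bij_betw_def inj_on_def cube_faces_eq by simp
    then have "bij_betw (cube_face (norm u) \<circ> (\<lambda>z. cross_frame z *v up)) cross_shape (cube_faces (norm u))"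
      by (rule bij_betw_trans[OF cross_frame_normals])
    then have "bij_betw (\<lambda>z. face ?X (s z)) cross_shape (cube_faces (norm u))"
      by (rule bij_betw_cong[THEN iffD1, rotated]) (simp add: face)
    then have "bij_betw (face ?X \<circ> s) cross_shape (cube_faces (norm u))" by (simp add: comp_def)
    moreover have "bij_betw s cross_shape (squares ?X)"
      unfolding sq bij_betw_def inj_on_def s_inj by simp
    ultimately show ?thesis using bij_betw_comp_iff by blast
  qed
  show ?thesis
    unfolding cube_net_def
  proof (intro conjI ballI impI allI)
    fix p q assume "p \<in> squares ?X" "q \<in> squares ?X"
    then show "(p, q) \<in> {(p, q). p \<in> squares ?X \<and> q \<in> squares ?X \<and> meet_along_side (flat ?X p) (flat ?X q)}\<^sup>*"
      using connected unfolding L_def by blast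
  next
    fix p x y assume "p \<in> squares ?X"
    then show "dist (fold_map ?X p x) (fold_map ?X p y) = dist x y"
      unfolding sq using placed_isometry[OF u] cross_frame_cube_matrices by (auto simp: fm)
  next
    fix p assume "p \<in> squares ?X"
    then show "0 < cross3 (fold_map ?X p 1 - fold_map ?X p 0) (fold_map ?X p \<i> - fold_map ?X p 0)
          \<bullet> fold_map ?X p (centre (side_vec ?X) p)"
      unfolding sq using placed_outward[OF u] cross_frame_cube_matrices by (auto simp: fm sv)
  next
    fix p q x assume "p \<in> squares ?X" "q \<in> squares ?X" "meet_along_side (flat ?X p) (flat ?X q)"
      "x \<in> flat ?X p \<inter> flat ?X q"
    then show "fold_map ?X p x = fold_map ?X q x" by (rule glued)
  qed (use bij sv in simp)
qed

theorem theorem6p2: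
  fixes F :: weave and \<kappa> :: "strand \<Rightarrow> colour" and a b :: int and c d k :: complex
  assumes "species_33_4 F c d a b"
    and "thick_striping \<kappa>" and "perfect_colouring F \<kappa>"
    and "k = c \<or> k = d"
    and "\<forall>x \<in> lattice_coset a b k. redundant_block_centre \<kappa> x"
  shows "(\<exists>X. lattice_unit_net a b k X) \<and>
    (\<forall>X. lattice_unit_net a b k X \<longrightarrow> perfectly_coloured_isonemal_woven_cube F \<kappa> X)"
proof (intro conjI allI impI)
  have ab: "coprime a b" "odd (a + b)" and k: "k \<in> gauss_ints"
    using assms(1,4) by (auto simp: species_33_4_def gauss_ints_def)
  \<comment> \<open>The imaginary part is twice the odd number \<open>a + b\<close>.\<close>
  have u: "lattice_gen1 a b \<noteq> 0"
    using ab(2) by (auto simp: lattice_gen1_def complex_eq_iff)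
  have "cross_shape \<subseteq> gauss_ints"
    by (auto simp: cross_shape_def gauss_ints_def)
  then have "squares (cross_net (lattice_gen1 a b) k) \<subseteq> lattice_coset a b k"
    by (auto simp: cross_net_def lattice_coset_eq lattice_points_def)
  then have "lattice_unit_net a b k (cross_net (lattice_gen1 a b) k)"
    using cube_net_cross_net[OF u] by (simp add: lattice_unit_net_def cross_net_def)
  then show "\<exists>X. lattice_unit_net a b k X" by blast
  fix X assume X: "lattice_unit_net a b k X"
  have "striped_net (lattice_gen1 a b) k X F \<kappa> a b"
    by unfold_locales
      (use X u ab k assms symmetry_group_lattice_motions[OF assms(1,4)]
        in \<open>simp_all add: lattice_unit_net_def lattice_coset_eq\<close>)
  then show "perfectly_coloured_isonemal_woven_cube F \<kappa> X"
    by (rule striped_net.perfectly_coloured)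
qed

end
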